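(* Let $x \in \mathbb{Z}^d \setminus \{0\}$. As $n$ tends to infinity, the quantity $\frac{1}{n} a(0,nx)$ (1) converges in $L^1$ if and only if $\mathbb{E}[V(0)] < +\infty$; (2) converges almost surely if and only if $\mathbb{E}[Z(0)] < +\infty$; (3) converges in probability if and only if $V(0) < +\infty$ almost surely. In any of these cases, the limit $\alpha(x)$ is deterministic, and $\alpha$ can be extended into a norm on $\mathbb{R}^d$. When $V(0) < +\infty$ a.s., we also have $$\liminf_{n \to +\infty} \frac{1}{n} a(0,nx) = \alpha(x) \quad \text{almost surely}.$$
   Context: Let $d \ge 2$ and let $(S_n)_{n\in\mathbb{N}}$ be the simple random walk on $\mathbb{Z}^d$, with law $\mathbf{P}_x$ and expectation $\mathbf{E}_x$ when started at $x$. Independently of $S$, let $(V(x))_{x\in\mathbb{Z}^d}$ be i.i.d. random variables with values in $[0,+\infty]$ (the potential), with law $\mathbb{P}$ and expectation $\mathbb{E}$. Standing assumptions: $V(0)$ is not almost surely equal to $0$, and $\mathbb{P}[V(0)<+\infty] > p_c$, where $p_c$ is the critical probability of site percolation on $\mathbb{Z}^d$. For $y \in \mathbb{Z}^d$ let $H_y = \inf\{n\ge 0 : S_n = y\}$. For $x,y\in\mathbb{Z}^d$, $$e(x,y) = \mathbf{E}_x\Big[\exp\Big(-\sum_{n=0}^{H_y-1} V(S_n)\Big)\mathbf{1}_{\{H_y<+\infty\}}\Big] \quad (e(x,y)=1 \text{ if } x=y), \qquad a(x,y) = -\log e(x,y) \in [0,+\infty],$$ with the conventions $e^{-\infty}=0$,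 $-\log 0=+\infty$. Write $x\sim y$ if $\|y-x\|_2=1$, and $Z(x) = \min_{y\sim x} V(y)$. The law of $a(0,nx)$ and the convergences are considered under $\mathbb{P}$. *)

theory Defs
  imports "HOL-Probability.Probability"
begin

section \<open>The lattice\<close>

text \<open>Points of \<open>\<int>\<^sup>d\<close> have type \<open>int ^ 'd\<close> with \<open>d = CARD('d)\<close>.\<close>

definition to_real_vec :: "int ^ 'd \<Rightarrow> real ^ 'd" where
  "to_real_vec x = (\<chi> i. real_of_int (x $ i))"

definition adjacent :: "int ^ 'd::finite \<Rightarrow> int ^ 'd \<Rightarrow> bool" (infix "\<sim>" 50) where
  "x \<sim> y \<longleftrightarrow> norm (to_real_vec (y - x)) = 1"

lemma finite_adjacent: "finite {y. x \<sim> (y :: int ^ 'd::finite)}"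
proof -
  have "{y. x \<sim> y} \<subseteq> (\<lambda>f. x + (\<chi> i. f i)) ` (PiE UNIV (\<lambda>_. {-1..1}))"
  proof
    fix y :: "int ^ 'd" assume "y \<in> {y. x \<sim> y}"
    then have n: "norm (to_real_vec (y - x)) = 1" by (simp add: adjacent_def)
    have "\<bar>(y - x) $ i\<bar> \<le> 1" for i
      using component_le_norm_cart[of "to_real_vec (y - x)" i] n
      unfolding to_real_vec_def vec_lambda_beta
      by (metis of_int_1_le_iff of_int_abs of_int_le_1_iff)
    then have "(\<lambda>i. (y - x) $ i) \<in> PiE UNIV (\<lambda>_. {-1..1})"
      by (auto simp: abs_le_iff) (smt (verit))+
    moreover have "y = x + (\<chi> i. (y - x) $ i)" by (simp add: vec_eq_iff)
    ultimately show "y \<in> (\<lambda>f. x + (\<chi> i. f i)) ` (PiE UNIV (\<lambda>_. {-1..1}))" by blast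
  qed
  then show ?thesis by (rule finite_subset) (intro finite_imageI finite_PiE; simp)
qed

lemma adjacent_nonempty: "{y. x \<sim> (y :: int ^ 'd::finite)} \<noteq> {}"
proof -
  fix k :: 'd
  have "to_real_vec ((x + axis k 1) - x) = (axis k 1 :: real ^ 'd)"
    by (simp add: to_real_vec_def vec_eq_iff axis_def)
  then have "x \<sim> x + axis k 1" by (simp add: adjacent_def norm_axis_1)
  then show ?thesis by blast
qed


section \<open>Critical probability of site percolation\<close>

text \<open>Every site is open with probability \<open>p\<close>, independently. A configuration \<open>\<eta>\<close>
  maps each site to whether it is open.\<close>

definition site_percolation :: "real \<Rightarrow> (int ^ 'd::finite \<Rightarrow> bool) measure" where
  "site_percolation p = Pi\<^sub>M UNIV (\<lambda>_. measure_pmf (bernoulli_pmf p))"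

definition open_cluster :: "(int ^ 'd::finite \<Rightarrow> bool) \<Rightarrow> int ^ 'd \<Rightarrow> (int ^ 'd) set" where
  "open_cluster \<eta> x = {y. \<eta> x \<and> (\<lambda>u v. u \<sim> v \<and> \<eta> u \<and> \<eta> v)\<^sup>*\<^sup>* x y}"

definition percolation_prob :: "'d::finite itself \<Rightarrow> real \<Rightarrow> real" where
  "percolation_prob _ p = measure (site_percolation p)
     {\<eta> \<in> space (site_percolation p). infinite (open_cluster \<eta> (0 :: int ^ 'd))}"

definition site_pc :: "'d::finite itself \<Rightarrow> real" where
  "site_pc T = Sup {p \<in> {0..1}. percolation_prob T p = 0}"


section \<open>Simple random walk\<close>

definition step_pmf :: "(int ^ 'd::finite) pmf" where
  "step_pmf = pmf_of_set {z. 0 \<sim> z}"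

definition walk_from :: "int ^ 'd::finite \<Rightarrow> (nat \<Rightarrow> int ^ 'd) \<Rightarrow> nat \<Rightarrow> int ^ 'd" where
  "walk_from x \<xi> n = x + (\<Sum>k<n. \<xi> k)"

text \<open>The law of the walk started at \<open>x\<close>, as a measure on trajectories.\<close>

definition srw :: "int ^ 'd::finite \<Rightarrow> (nat \<Rightarrow> int ^ 'd) measure" where
  "srw x = distr (Pi\<^sub>M UNIV (\<lambda>_. measure_pmf step_pmf)) (Pi\<^sub>M UNIV (\<lambda>_. count_space UNIV))
     (walk_from x)"

text \<open>\<open>hitting_time y S = \<infinity>\<close> if \<open>S\<close> never visits \<open>y\<close>, since \<open>Inf {} = \<infinity>\<close> in \<^typ>\<open>enat\<close>.\<close>

definition hitting_time :: "int ^ 'd \<Rightarrow> (nat \<Rightarrow> int ^ 'd) \<Rightarrow> enat" where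
  "hitting_time y S = (INF n \<in> {n. S n = y}. enat n)"

lemma measurable_walk_from:
  "walk_from x \<in> measurable (Pi\<^sub>M UNIV (\<lambda>_. measure_pmf step_pmf)) (Pi\<^sub>M UNIV (\<lambda>_. count_space UNIV))"
proof (rule measurable_PiM_single')
  fix n :: nat
  let ?P = "Pi\<^sub>M UNIV (\<lambda>_::nat. measure_pmf (step_pmf :: (int ^ 'a) pmf))"
  have comp: "(\<lambda>\<xi>. \<xi> k) \<in> measurable ?P (count_space UNIV)" for k
    using measurable_component_singleton[of k UNIV "\<lambda>_::nat. measure_pmf (step_pmf :: (int ^ 'a) pmf)"]
    by (simp cong: measurable_cong_sets)
  have "(\<lambda>\<xi>. (\<Sum>k<n. \<xi> k)) \<in> measurable ?P (count_space UNIV)"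
  proof (induction n)
    case (Suc n)
    have "(\<lambda>\<xi>. (\<lambda>u \<xi>. u + \<xi> n) (\<Sum>k<n. \<xi> k) \<xi>) \<in> measurable ?P (count_space UNIV)"
      by (rule measurable_compose_countable[OF _ Suc]) (rule measurable_compose[OF comp]; simp)
    then show ?case by simp
  qed simp
  then have "(\<lambda>\<xi>. x + (\<Sum>k<n. \<xi> k)) \<in> measurable ?P (count_space UNIV)"
    by (rule measurable_compose) simp
  then show "(\<lambda>\<xi>. walk_from x \<xi> n) \<in> measurable ?P (count_space UNIV)"
    by (simp add: walk_from_def)
qed auto

lemma prob_space_srw: "prob_space (srw x)"
  unfolding srw_def
  by (intro prob_space.prob_space_distr prob_space_PiM measurable_walk_from prob_space_measure_pmf)


section \<open>Travel cost in a fixed potential\<close>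

definition exp_minus :: "ennreal \<Rightarrow> real" where
  "exp_minus v = (if v = \<infinity> then 0 else exp (- enn2real v))"

definition minus_log :: "real \<Rightarrow> ereal" where
  "minus_log p = (if p = 0 then \<infinity> else ereal (- ln p))"

definition survival :: "(int ^ 'd::finite \<Rightarrow> ennreal) \<Rightarrow> int ^ 'd \<Rightarrow> (nat \<Rightarrow> int ^ 'd) \<Rightarrow> real" where
  "survival v y S = (case hitting_time y S of
     enat h \<Rightarrow> exp_minus (\<Sum>n<h. v (S n)) | \<infinity> \<Rightarrow> 0)"

definition green_e :: "(int ^ 'd::finite \<Rightarrow> ennreal) \<Rightarrow> int ^ 'd \<Rightarrow> int ^ 'd \<Rightarrow> real" where
  "green_e v x y = (\<integral>S. survival v y S \<partial>srw x)"

definition cost_a :: "(int ^ 'd::finite \<Rightarrow> ennreal) \<Rightarrow> int ^ 'd \<Rightarrow> int ^ 'd \<Rightarrow> ereal" where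
  "cost_a v x y = minus_log (green_e v x y)"

definition min_neighbour :: "(int ^ 'd::finite \<Rightarrow> ennreal) \<Rightarrow> int ^ 'd \<Rightarrow> ennreal" where
  "min_neighbour v x = Min (v ` {y. x \<sim> y})"

lemma survival_bounds: "0 \<le> survival v y S" "survival v y S \<le> 1"
  by (auto simp: survival_def exp_minus_def split: enat.split)

lemma hitting_time_eq_enat:
  "hitting_time y S = enat h \<longleftrightarrow> S h = y \<and> (\<forall>n<h. S n \<noteq> y)"
proof
  assume h: "hitting_time y S = enat h"
  have "enat ` {n. S n = y} \<noteq> {}"
  proof
    assume "enat ` {n. S n = y} = {}"
    with h show False unfolding hitting_time_def by (simp only: Inf_empty) (simp add: top_enat_def)
  qed
  then obtain n where "enat n \<in> enat ` {n. S n = y}" by blast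
  then have "Inf (enat ` {n. S n = y}) \<in> enat ` {n. S n = y}"
    by (rule wellorder_InfI)
  then have "S h = y" using h by (auto simp: hitting_time_def)
  moreover have "S n \<noteq> y" if "n < h" for n
    using h that INF_lower[of n "{n. S n = y}" enat] by (auto simp: hitting_time_def)
  ultimately show "S h = y \<and> (\<forall>n<h. S n \<noteq> y)" by blast
next
  assume h: "S h = y \<and> (\<forall>n<h. S n \<noteq> y)"
  show "hitting_time y S = enat h"
    unfolding hitting_time_def
  proof (rule antisym)
    show "(INF n \<in> {n. S n = y}. enat n) \<le> enat h"
      using h by (intro INF_lower) simp
    show "enat h \<le> (INF n \<in> {n. S n = y}. enat n)"
    proof (rule INF_greatest)
      fix n assume "n \<in> {n. S n = y}"
      then show "enat h \<le> enat n" using h by (auto simp flip: not_less)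
    qed
  qed
qed

lemma measurable_survival:
  "survival v y \<in> borel_measurable (srw x)"
proof -
  let ?N = "Pi\<^sub>M UNIV (\<lambda>_::nat. count_space (UNIV :: (int ^ 'a) set))"
  have [measurable]: "(\<lambda>S. S n) \<in> measurable ?N (count_space UNIV)" for n
    by (rule measurable_component_singleton) simp
  have v: "(\<lambda>S. v (S n)) \<in> borel_measurable ?N" for n
    by (rule measurable_compose[of "\<lambda>S. S n" _ "count_space UNIV"]) auto
  have hit: "Measurable.pred ?N (\<lambda>S. hitting_time y S = enat h)" for h
    unfolding hitting_time_eq_enat by measurable
  have em: "exp_minus \<in> borel_measurable borel"
    unfolding exp_minus_def by measurable
  have "hitting_time y \<in> measurable ?N (count_space UNIV)"
  proof (rule measurable_count_space_eq2_countable[THEN iffD2], intro conjI ballI)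
    fix a
    show "hitting_time y -` {a} \<inter> space ?N \<in> sets ?N"
    proof (cases a)
      case (enat h)
      then show ?thesis using hit[of h] by (simp add: pred_def vimage_def Int_def conj_commute)
    next
      case infinity
      then have "hitting_time y -` {a} \<inter> space ?N = {S \<in> space ?N. \<forall>h. \<not> hitting_time y S = enat h}"
        by (auto simp: not_infinity_eq)
      also have "\<dots> \<in> sets ?N" using hit by measurable
      finally show ?thesis .
    qed
  qed auto
  note hm = this
  define F where "F t S = (case t of enat h \<Rightarrow> exp_minus (\<Sum>n<h. v (S n)) | \<infinity> \<Rightarrow> 0)" for t S
  have F: "F t \<in> borel_measurable ?N" for t
  proof (cases t)
    case (enat h)
    have "(\<lambda>S. \<Sum>n<h. v (S n)) \<in> borel_measurable ?N"
      by (rule borel_measurable_sum) (rule v)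
    from measurable_compose[OF this em] show ?thesis
      by (simp add: F_def[abs_def] enat)
  next
    case infinity
    then show ?thesis by (simp add: F_def[abs_def])
  qed
  have "(\<lambda>S. F (hitting_time y S) S) \<in> borel_measurable ?N"
    by (rule measurable_compose_countable[OF F hm])
  then have "survival v y \<in> borel_measurable ?N"
    by (simp add: survival_def[abs_def] F_def)
  then show ?thesis by (simp add: srw_def)
qed

lemma green_e_bounds: "0 \<le> green_e v x y" "green_e v x y \<le> 1"
proof -
  interpret prob_space "srw x" by (rule prob_space_srw)
  show "0 \<le> green_e v x y" unfolding green_e_def by (simp add: survival_bounds)
  have "integrable (srw x) (survival v y)"
    by (rule integrable_const_bound[of _ 1]) (auto simp: survival_bounds measurable_survival)
  then show "green_e v x y \<le> 1"
    unfolding green_e_def by (rule integral_le_const) (simp add: survival_bounds)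
qed


section \<open>Random potential and modes of convergence\<close>

definition iid_field :: "'w measure \<Rightarrow> ('i \<Rightarrow> 'w \<Rightarrow> ennreal) \<Rightarrow> bool" where
  "iid_field M V \<longleftrightarrow> prob_space.indep_vars M (\<lambda>_. borel) V UNIV \<and>
     (\<forall>x y. distr M borel (V x) = distr M borel (V y))"

definition scaled_cost ::
    "(int ^ 'd::finite \<Rightarrow> 'w \<Rightarrow> ennreal) \<Rightarrow> int ^ 'd \<Rightarrow> nat \<Rightarrow> 'w \<Rightarrow> ereal" where
  "scaled_cost V x n \<omega> = cost_a (\<lambda>z. V z \<omega>) 0 (int n *s x) / ereal (real n)"

text \<open>Limits are finite random variables; the converging variables may take the value \<open>\<infinity>\<close>,
  in which case their distance to the limit is \<open>\<infinity>\<close>.\<close>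

definition tendsto_L1 :: "'w measure \<Rightarrow> (nat \<Rightarrow> 'w \<Rightarrow> ereal) \<Rightarrow> ('w \<Rightarrow> real) \<Rightarrow> bool" where
  "tendsto_L1 M X L \<longleftrightarrow> integrable M L \<and>
     (\<lambda>n. \<integral>\<^sup>+\<omega>. e2ennreal \<bar>X n \<omega> - ereal (L \<omega>)\<bar> \<partial>M) \<longlonglongrightarrow> 0"

definition tendsto_AE :: "'w measure \<Rightarrow> (nat \<Rightarrow> 'w \<Rightarrow> ereal) \<Rightarrow> ('w \<Rightarrow> real) \<Rightarrow> bool" where
  "tendsto_AE M X L \<longleftrightarrow> L \<in> borel_measurable M \<and>
     (AE \<omega> in M. (\<lambda>n. X n \<omega>) \<longlonglongrightarrow> ereal (L \<omega>))"

definition tendsto_prob :: "'w measure \<Rightarrow> (nat \<Rightarrow> 'w \<Rightarrow> ereal) \<Rightarrow> ('w \<Rightarrow> real) \<Rightarrow> bool" where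
  "tendsto_prob M X L \<longleftrightarrow> L \<in> borel_measurable M \<and>
     (\<forall>\<epsilon>>0. (\<lambda>n. measure M {\<omega> \<in> space M. \<bar>X n \<omega> - ereal (L \<omega>)\<bar> > ereal \<epsilon>}) \<longlonglongrightarrow> 0)"

definition is_norm :: "(real ^ 'd::finite \<Rightarrow> real) \<Rightarrow> bool" where
  "is_norm N \<longleftrightarrow> (\<forall>u. 0 \<le> N u) \<and> (\<forall>u. N u = 0 \<longleftrightarrow> u = 0) \<and>
     (\<forall>c u. N (c *\<^sub>R u) = \<bar>c\<bar> * N u) \<and> (\<forall>u w. N (u + w) \<le> N u + N w)"

end

theory Submission
  imports Defs "HOL-Real_Asymp.Real_Asymp"
begin

text \<open>
  If \<open>V 0\<close> is infinite with positive probability, then so is \<open>a(0, nx)\<close>, uniformly in \<open>n\<close>, and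
  none of the convergences can hold. Otherwise call a site closed if its potential exceeds a level
  \<open>K\<close> chosen so large that closed sites are very sparse. A box is bad at scale \<open>16^(k+1)\<close>
  if it contains two distant bad boxes of scale \<open>16^k\<close>; the probability of this decays doubly
  exponentially in \<open>k\<close>. A good box contains a hub of sites that are linked, to each other and to
  the hubs of the neighbouring good boxes, by paths of deterministically bounded cost. Attaching to every
  site \<open>y\<close> an anchor in a hub of the good box around \<open>y\<close>, the costs between anchors are
  integrable whatever the law of \<open>V\<close>, and Kingman's theorem along \<open>nx\<close> defines
  \<open>\<alpha>(x)\<close>.

  The costs between a site and its anchor form a stationary sequence, which gives convergence in
  probability. For the lower limit, any walk to \<open>nx\<close> must pass through a site that is cheaply
  linked to the anchor of \<open>nx\<close>, so \<open>a(0, nx)\<close> is at least the cost to the anchor of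
  \<open>nx\<close> up to an integrable error. The cost of leaving the anchor for the site itself is integrable
  if \<open>E[Z(0)] < \<infinity>\<close>, because the
  \<open>2d\<close> lattice rays into the site meet disjoint sets of sites; conversely \<open>a(0, nx) \<ge> Z(nx)\<close>
  and Borel--Cantelli make this condition necessary. Bounding the annealed quantity \<open>E e(0, x)\<close>
  shows that \<open>\<alpha>\<close> is positive.
\<close>

section \<open>The Green function of the killed walk\<close>

text \<open>The obstacle is that \<open>a(0, nx)\<close> need not be integrable:
  \<open>a(x, y)\<close> charges the start x but not y, and y is entered through one of its
  neighbours. Along nx the start is fixed, so its charge disappears after division by n, while the
  price of arriving is met anew for every n. Hence Z governs almost sure convergence and E[V(0)]
  only the mean, and Kingman's theorem is applied to costs from which both ends have been removed.
  For these, closed sites have to be avoided by detours controlled by geometry alone, never by the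
  values of V. The scales fit as follows. A box of level k+1 is searched within radius
  \<open>15 * 16^k\<close>, so it depends on radius \<open>16^(k+1)\<close> only, and bad boxes more
  than \<open>2 * 16^k\<close> apart are independent. This yields
  \<open>q(k+1) <= (31 * 16^k)^(2d) * q(k)^2\<close>. A detour at level k+1 costs
  \<open>66 d 16^k\<close> times one at level k; it grows like exp(O(k^2)), which a decay of order
  \<open>2^(-2^k)\<close> beats, together with any power of the side.\<close>

definition nbrs :: "(int ^ 'd::finite) set" where
  "nbrs = {z. 0 \<sim> z}"

lemma finite_nbrs [simp]: "finite (nbrs :: (int ^ 'd::finite) set)"
  unfolding nbrs_def by (rule finite_adjacent)

lemma nbrs_nonempty [simp]: "(nbrs :: (int ^ 'd::finite) set) \<noteq> {}"
  unfolding nbrs_def by (rule adjacent_nonempty)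

lemma card_nbrs_pos [simp]: "0 < card (nbrs :: (int ^ 'd::finite) set)"
  by (simp add: card_gt_0_iff)

lemma adjacent_iff_nbrs: "x \<sim> y \<longleftrightarrow> y - x \<in> nbrs"
  by (simp add: nbrs_def adjacent_def)

lemma adjacent_set_eq: "{y. x \<sim> y} = (+) x ` nbrs"
  by (auto simp: adjacent_iff_nbrs image_iff intro!: bexI[of _ "_ - x"])

lemma to_real_vec_uminus: "to_real_vec (- z) = - to_real_vec z"
  by (simp add: to_real_vec_def vec_eq_iff)

lemma uminus_nbrs: "z \<in> nbrs \<Longrightarrow> - z \<in> nbrs"
  by (simp add: nbrs_def adjacent_def to_real_vec_uminus)

lemma axis_in_nbrs: "axis i 1 \<in> nbrs" "axis i (-1) \<in> nbrs"
proof -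
  have "to_real_vec (axis i 1) = axis i 1"
    by (simp add: to_real_vec_def axis_def vec_eq_iff)
  then show *: "axis i 1 \<in> nbrs" by (simp add: nbrs_def adjacent_def)
  have "axis i (-1) = - axis i (1 :: int)" by (simp add: axis_def vec_eq_iff)
  then show "axis i (-1) \<in> nbrs" using uminus_nbrs[OF *] by simp
qed

lemma norm_nbrs: "z \<in> nbrs \<Longrightarrow> norm (to_real_vec z) = 1"
  by (simp add: nbrs_def adjacent_def)

lemma nbrs_component: "z \<in> nbrs \<Longrightarrow> \<bar>z $ i\<bar> \<le> 1"
  using component_le_norm_cart[of "to_real_vec z" i] norm_nbrs[of z]
  unfolding to_real_vec_def vec_lambda_beta
  by (metis of_int_1_le_iff of_int_abs of_int_le_1_iff)

lemma nbrs_neq_0: "z \<in> nbrs \<Longrightarrow> z \<noteq> 0"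
  using norm_nbrs[of z] by (auto simp: to_real_vec_def zero_vec_def[symmetric])

lemma exp_minus_0 [simp]: "exp_minus 0 = 1"
  by (simp add: exp_minus_def)

lemma exp_minus_bounds: "0 \<le> exp_minus v" "exp_minus v \<le> 1"
  by (auto simp: exp_minus_def)

lemma exp_minus_add: "exp_minus (a + b) = exp_minus a * exp_minus b"
  by (auto simp: exp_minus_def enn2real_plus less_top exp_diff exp_minus inverse_eq_divide)

lemma exp_minus_antimono: "a \<le> b \<Longrightarrow> exp_minus b \<le> exp_minus a"
  by (auto simp: exp_minus_def less_top top_unique intro: enn2real_mono)

lemma exp_minus_ennreal: "0 \<le> t \<Longrightarrow> exp_minus (ennreal t) = exp (- t)"
  by (simp add: exp_minus_def)

lemma measurable_exp_minus [measurable]: "exp_minus \<in> borel_measurable borel"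
  unfolding exp_minus_def by measurable

section \<open>Finite-horizon approximation of the Green function\<close>

abbreviation steps_measure :: "(nat \<Rightarrow> int ^ 'd::finite) measure" where
  "steps_measure \<equiv> Pi\<^sub>M UNIV (\<lambda>_. measure_pmf step_pmf)"

text \<open>The survival weight restricted to hitting times at most n. Recursion on the first step
  lets its expectation be computed by the finite recursion \<open>green_upto\<close>, on which later
  inequalities are proved by induction before n tends to infinity.\<close>

primrec surv_upto :: "(int ^ 'd::finite \<Rightarrow> ennreal) \<Rightarrow> int ^ 'd \<Rightarrow> nat \<Rightarrow> int ^ 'd \<Rightarrow> (nat \<Rightarrow> int ^ 'd) \<Rightarrow> real" where
  "surv_upto v y 0 x \<xi> = of_bool (x = y)"
| "surv_upto v y (Suc n) x \<xi> = (if x = y then 1 else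
     exp_minus (v x) * surv_upto v y n (x + \<xi> 0) (\<lambda>k. \<xi> (Suc k)))"

lemma hitting_time_Suc:
  assumes "S 0 \<noteq> y"
  shows "hitting_time y S = eSuc (hitting_time y (\<lambda>k. S (Suc k)))"
proof (cases "hitting_time y (\<lambda>k. S (Suc k))")
  case (enat h)
  then have "S (Suc h) = y" "\<forall>n<h. S (Suc n) \<noteq> y" by (auto simp: hitting_time_eq_enat)
  then have "hitting_time y S = enat (Suc h)"
    unfolding hitting_time_eq_enat using assms by (auto simp: less_Suc_eq_0_disj)
  then show ?thesis using enat by (simp add: eSuc_enat)
next
  case infinity
  have "hitting_time y S = \<infinity>"
  proof (rule ccontr)
    assume "hitting_time y S \<noteq> \<infinity>"
    then obtain h where h: "S h = y" "\<forall>n<h. S n \<noteq> y"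
      by (auto simp: not_infinity_eq hitting_time_eq_enat)
    then obtain h' where "h = Suc h'" using assms by (cases h) auto
    then have "hitting_time y (\<lambda>k. S (Suc k)) = enat h'"
      using h by (auto simp: hitting_time_eq_enat)
    with infinity show False by simp
  qed
  then show ?thesis using infinity by simp
qed

lemma walk_from_Suc: "walk_from x \<xi> (Suc k) = walk_from (x + \<xi> 0) (\<lambda>k. \<xi> (Suc k)) k"
  by (simp add: walk_from_def sum.lessThan_Suc_shift add.assoc del: sum.lessThan_Suc)

lemma walk_from_0 [simp]: "walk_from x \<xi> 0 = x"
  by (simp add: walk_from_def)

lemma surv_upto_eq:
  "surv_upto v y n x \<xi> = (if hitting_time y (walk_from x \<xi>) \<le> enat n then survival v y (walk_from x \<xi>) else 0)"
proof (induction n arbitrary: x \<xi>)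
  case 0
  have *: "hitting_time y (walk_from x \<xi>) = enat 0 \<longleftrightarrow> x = y"
    by (simp only: hitting_time_eq_enat) (simp add: walk_from_def)
  show ?case
  proof (cases "x = y")
    case True
    with * have hit: "hitting_time y (walk_from x \<xi>) = enat 0" by simp
    then have "survival v y (walk_from x \<xi>) = 1"
      by (simp only: survival_def enat.case lessThan_0 sum.empty exp_minus_0)
    moreover have "hitting_time y (walk_from x \<xi>) \<le> enat 0" unfolding hit ..
    ultimately show ?thesis using True by simp
  next
    case False
    with * have "\<not> hitting_time y (walk_from x \<xi>) \<le> enat 0"
      by (metis enat_0 le_zero_eq)
    then show ?thesis using False by simp
  qed
next
  case (Suc n)
  have w0: "walk_from x \<xi> 0 = x" by (simp add: walk_from_def)
  show ?case
  proof (cases "x = y")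
    case True
    then have hit: "hitting_time y (walk_from x \<xi>) = enat 0" by (simp add: hitting_time_eq_enat)
    then have "survival v y (walk_from x \<xi>) = 1"
      by (simp only: survival_def enat.case lessThan_0 sum.empty exp_minus_0)
    moreover have "hitting_time y (walk_from x \<xi>) \<le> enat (Suc n)" unfolding hit by simp
    ultimately show ?thesis using True by simp
  next
    case False
    let ?S' = "walk_from (x + \<xi> 0) (\<lambda>k. \<xi> (Suc k))"
    have h: "hitting_time y (walk_from x \<xi>) = eSuc (hitting_time y ?S')"
      using hitting_time_Suc[of "walk_from x \<xi>" y] False by (simp add: w0 walk_from_Suc)
    have "survival v y (walk_from x \<xi>) = exp_minus (v x) * survival v y ?S'"
      by (simp add: survival_def h walk_from_Suc sum.lessThan_Suc_shift w0 exp_minus_add eSuc_enat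
          del: sum.lessThan_Suc split: enat.split)
    moreover have "hitting_time y (walk_from x \<xi>) \<le> enat (Suc n) \<longleftrightarrow> hitting_time y ?S' \<le> enat n"
      unfolding h by (simp add: eSuc_enat[symmetric])
    ultimately show ?thesis using False by (simp add: Suc.IH)
  qed
qed

lemma surv_upto_bounds: "0 \<le> surv_upto v y n x \<xi>" "surv_upto v y n x \<xi> \<le> 1"
  by (auto simp: surv_upto_eq survival_bounds)

lemma surv_upto_tendsto: "(\<lambda>n. surv_upto v y n x \<xi>) \<longlonglongrightarrow> survival v y (walk_from x \<xi>)"
proof (cases "hitting_time y (walk_from x \<xi>)")
  case (enat h)
  then have "eventually (\<lambda>n. surv_upto v y n x \<xi> = survival v y (walk_from x \<xi>)) sequentially"
    by (intro eventually_sequentiallyI[of h]) (simp add: surv_upto_eq)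
  then show ?thesis by (rule tendsto_eventually)
qed (simp add: surv_upto_eq survival_def)

lemma measurable_step: "(\<lambda>\<xi>. \<xi> k) \<in> measurable steps_measure (count_space UNIV)"
  using measurable_component_singleton[of k UNIV "\<lambda>_::nat. measure_pmf step_pmf"]
  by (simp cong: measurable_cong_sets)

lemma measurable_step_shift: "(\<lambda>\<xi> k. \<xi> (Suc k)) \<in> measurable steps_measure steps_measure"
  by (rule measurable_PiM_single') (auto intro: measurable_component_singleton simp: space_PiM)

lemma measurable_surv_upto [measurable]: "surv_upto v y n x \<in> borel_measurable steps_measure"
proof (induction n arbitrary: x)
  case (Suc n)
  have "(\<lambda>\<xi>. surv_upto v y n (x + \<xi> 0) (\<lambda>k. \<xi> (Suc k))) \<in> borel_measurable steps_measure"
    by (rule measurable_compose_countable[OF _ measurable_step[of 0],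
          where f="\<lambda>z \<xi>. surv_upto v y n (x + z) (\<lambda>k. \<xi> (Suc k))"])
       (rule measurable_compose[OF measurable_step_shift Suc.IH])
  then show ?case by (cases "x = y") (simp_all add: fun_eq_iff)
next
  case 0
  have "surv_upto v y 0 x = (\<lambda>_. of_bool (x = y))" by (simp add: fun_eq_iff)
  then show ?case by simp
qed

primrec green_upto :: "(int ^ 'd::finite \<Rightarrow> ennreal) \<Rightarrow> int ^ 'd \<Rightarrow> nat \<Rightarrow> int ^ 'd \<Rightarrow> real" where
  "green_upto v y 0 x = of_bool (x = y)"
| "green_upto v y (Suc n) x = (if x = y then 1 else
     exp_minus (v x) * ((\<Sum>z\<in>nbrs. green_upto v y n (x + z)) / card (nbrs :: (int ^ 'd) set)))"

lemma integral_surv_upto: "(\<integral>\<xi>. surv_upto v y n x \<xi> \<partial>steps_measure) = green_upto v y n x"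
proof (induction n arbitrary: x)
  case 0
  interpret prob_space "steps_measure :: (nat \<Rightarrow> int ^ 'a) measure"
    by (intro prob_space_PiM prob_space_measure_pmf)
  show ?case by (simp add: prob_space)
next
  case (Suc n)
  let ?p = "measure_pmf (step_pmf :: (int ^ 'a) pmf)"
  let ?S = "steps_measure :: (nat \<Rightarrow> int ^ 'a) measure"
  interpret S: prob_space ?S
    by (intro prob_space_PiM prob_space_measure_pmf)
  interpret seq: sequence_space ?p ..
  interpret pair: pair_prob_space ?p ?S ..
  show ?case
  proof (cases "x = y")
    case True
    then show ?thesis by (simp add: S.prob_space)
  next
    case False
    define f where "f \<xi> = surv_upto v y n (x + \<xi> 0) (\<lambda>k. \<xi> (Suc k))" for \<xi>
    have f_meas [measurable]: "f \<in> borel_measurable ?S"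
      unfolding f_def by (rule measurable_compose_countable[OF _ measurable_step[of 0],
          where f="\<lambda>z \<xi>. surv_upto v y n (x + z) (\<lambda>k. \<xi> (Suc k))"])
       (rule measurable_compose[OF measurable_step_shift measurable_surv_upto])
    have cn: "(\<lambda>(s, \<omega>). case_nat s \<omega>) \<in> measurable (?p \<Otimes>\<^sub>M ?S) ?S"
      by measurable
    \<comment> \<open>The Markov property: the step sequence has the law of an independent pair of
      first step and remaining sequence.\<close>
    have "(\<integral>\<xi>. f \<xi> \<partial>?S) = (\<integral>\<xi>. f \<xi> \<partial>distr (?p \<Otimes>\<^sub>M ?S) ?S (\<lambda>(s, \<omega>). case_nat s \<omega>))"
      by (simp add: seq.PiM_iter)
    also have "\<dots> = (\<integral>q. f (case q of (s, \<omega>) \<Rightarrow> case_nat s \<omega>) \<partial>(?p \<Otimes>\<^sub>M ?S))"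
      by (rule integral_distr[OF cn f_meas])
    also have "\<dots> = (\<integral>q. (case q of (s, \<omega>) \<Rightarrow> surv_upto v y n (x + s) \<omega>) \<partial>(?p \<Otimes>\<^sub>M ?S))"
      by (rule Bochner_Integration.integral_cong) (auto simp: f_def)
    also have "\<dots> = (\<integral>s. (\<integral>\<omega>. surv_upto v y n (x + s) \<omega> \<partial>?S) \<partial>?p)"
    proof (rule pair.integral_fst'[symmetric, where f="\<lambda>q. case q of (s, \<omega>) \<Rightarrow> surv_upto v y n (x + s) \<omega>", simplified])
      have "(\<lambda>q. f (case q of (s, \<omega>) \<Rightarrow> case_nat s \<omega>)) \<in> borel_measurable (?p \<Otimes>\<^sub>M ?S)"
        by (rule measurable_compose[OF cn f_meas])
      then have "(\<lambda>(s, \<omega>). surv_upto v y n (x + s) \<omega>) \<in> borel_measurable (?p \<Otimes>\<^sub>M ?S)"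
        by (simp add: f_def split_beta')
      then show "integrable (?p \<Otimes>\<^sub>M ?S) (\<lambda>(s, \<omega>). surv_upto v y n (x + s) \<omega>)"
        by (intro pair.P.integrable_const_bound[of _ 1]) (auto simp: surv_upto_bounds)
    qed
    also have "\<dots> = (\<integral>s. green_upto v y n (x + s) \<partial>?p)" by (simp add: Suc.IH)
    also have "\<dots> = (\<Sum>z\<in>nbrs. green_upto v y n (x + z)) / card (nbrs :: (int ^ 'a) set)"
      unfolding step_pmf_def nbrs_def[symmetric] by (subst integral_pmf_of_set) auto
    finally show ?thesis using False by (simp add: f_def)
  qed
qed

lemma green_upto_tendsto: "(\<lambda>n. green_upto v y n x) \<longlonglongrightarrow> green_e v x y"
proof -
  interpret prob_space "steps_measure :: (nat \<Rightarrow> int ^ 'a) measure"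
    by (intro prob_space_PiM prob_space_measure_pmf)
  have m: "survival v y \<in> borel_measurable (Pi\<^sub>M UNIV (\<lambda>_. count_space UNIV))"
    using measurable_survival[of v y x] by (simp add: srw_def)
  have "green_e v x y = (\<integral>\<xi>. survival v y (walk_from x \<xi>) \<partial>steps_measure)"
    unfolding green_e_def srw_def by (rule integral_distr[OF measurable_walk_from m])
  moreover have "(\<lambda>n. \<integral>\<xi>. surv_upto v y n x \<xi> \<partial>steps_measure) \<longlonglongrightarrow> (\<integral>\<xi>. survival v y (walk_from x \<xi>) \<partial>steps_measure)"
    by (rule integral_dominated_convergence[where w="\<lambda>_. 1"])
       (auto simp: surv_upto_bounds surv_upto_tendsto intro: measurable_compose[OF measurable_walk_from m])
  ultimately show ?thesis by (simp add: integral_surv_upto)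
qed

lemma green_upto_bounds: "0 \<le> green_upto v y n x" "green_upto v y n x \<le> 1"
proof -
  interpret prob_space "steps_measure :: (nat \<Rightarrow> int ^ 'a) measure"
    by (intro prob_space_PiM prob_space_measure_pmf)
  have "integrable steps_measure (surv_upto v y n x)"
    by (rule integrable_const_bound[of _ 1]) (auto simp: surv_upto_bounds)
  then show "green_upto v y n x \<le> 1" "0 \<le> green_upto v y n x"
    unfolding integral_surv_upto[symmetric]
    by (auto intro!: integral_le_const integral_nonneg_AE simp: surv_upto_bounds)
qed

lemma green_e_le: "(\<And>n. green_upto v y n x \<le> C) \<Longrightarrow> green_e v x y \<le> C"
  by (rule LIMSEQ_le_const2[OF green_upto_tendsto]) auto

lemma green_e_self [simp]: "green_e v y y = 1"
proof (rule LIMSEQ_unique[OF green_upto_tendsto])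
  have "green_upto v y n y = 1" for n by (cases n) auto
  then show "(\<lambda>n. green_upto v y n y) \<longlonglongrightarrow> 1" by simp
qed

section \<open>First-passage inequalities\<close>

lemma green_e_step:
  fixes x y :: "int ^ 'd::finite"
  assumes "x \<noteq> y"
  shows "green_e v x y = exp_minus (v x) * ((\<Sum>z\<in>nbrs. green_e v (x + z) y) / card (nbrs :: (int ^ 'd) set))"
proof (rule LIMSEQ_unique)
  show "(\<lambda>n. green_upto v y (Suc n) x) \<longlonglongrightarrow> green_e v x y"
    using green_upto_tendsto by (rule LIMSEQ_Suc)
  show "(\<lambda>n. green_upto v y (Suc n) x) \<longlonglongrightarrow>
    exp_minus (v x) * ((\<Sum>z\<in>nbrs. green_e v (x + z) y) / card (nbrs :: (int ^ 'd) set))"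
    using assms by (auto intro!: tendsto_intros green_upto_tendsto)
qed

text \<open>A substitute for the strong Markov property at the first visit of y. Induction on the
  horizon of the first leg: as long as the walk is neither at y nor at z, both sides obey the same
  one-step equation.\<close>

lemma green_e_triangle: "green_e v x y * green_e v y z \<le> green_e v x z"
proof -
  have "green_upto v y n x * green_e v y z \<le> green_e v x z" for n x
  proof (induction n arbitrary: x)
    case 0
    show ?case by (auto simp: green_e_bounds)
  next
    case (Suc n)
    show ?case
    proof (cases "x = y")
      case False
      show ?thesis
      proof (cases "x = z")
        case True
        then show ?thesis using green_upto_bounds[of v y "Suc n" x] green_e_bounds[of v y z]
          by (simp only: green_e_self) (rule mult_le_one; simp)
      next
        case xz: False
        have "green_upto v y (Suc n) x * green_e v y z =
          exp_minus (v x) * ((\<Sum>u\<in>nbrs. green_upto v y n (x + u) * green_e v y z) / card (nbrs :: (int ^ 'a) set))"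
          using False by (simp add: sum_distrib_right)
        also have "\<dots> \<le> exp_minus (v x) * ((\<Sum>u\<in>nbrs. green_e v (x + u) z) / card (nbrs :: (int ^ 'a) set))"
          by (intro mult_left_mono divide_right_mono sum_mono Suc.IH) (auto simp: exp_minus_bounds)
        also have "\<dots> = green_e v x z" using green_e_step[OF xz] by simp
        finally show ?thesis .
      qed
    qed simp
  qed
  then show ?thesis
    by (intro LIMSEQ_le_const2[OF tendsto_mult_right[OF green_upto_tendsto]]) auto
qed

lemma green_e_adjacent:
  fixes x :: "int ^ 'd::finite"
  assumes "z \<in> nbrs"
  shows "exp_minus (v x) / card (nbrs :: (int ^ 'd) set) \<le> green_e v x (x + z)"
proof -
  have "green_e v (x + z) (x + z) \<le> (\<Sum>u\<in>nbrs. green_e v (x + u) (x + z))"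
    using assms by (intro member_le_sum) (auto simp: green_e_bounds)
  then have "exp_minus (v x) * (1 / card (nbrs :: (int ^ 'd) set)) \<le>
    exp_minus (v x) * ((\<Sum>u\<in>nbrs. green_e v (x + u) (x + z)) / card (nbrs :: (int ^ 'd) set))"
    by (intro mult_left_mono divide_right_mono) (auto simp: exp_minus_bounds)
  also have "\<dots> = green_e v x (x + z)" using green_e_step[of x "x + z" v] nbrs_neq_0[OF assms] by simp
  finally show ?thesis by simp
qed

lemma avg_le_const:
  fixes f :: "int ^ 'd::finite \<Rightarrow> real"
  assumes "\<And>z. z \<in> nbrs \<Longrightarrow> f z \<le> C"
  shows "(\<Sum>z\<in>nbrs. f z) / card (nbrs :: (int ^ 'd) set) \<le> C"
proof -
  have "(\<Sum>z\<in>nbrs. f z) \<le> card (nbrs :: (int ^ 'd) set) * C"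
    using assms by (rule sum_bounded_above)
  then show ?thesis by (simp add: field_simps)
qed

lemma green_e_le_start:
  assumes "x \<noteq> y"
  shows "green_e v x y \<le> exp_minus (v x)"
  unfolding green_e_step[OF assms]
  by (intro mult_left_le avg_le_const green_e_bounds exp_minus_bounds)

text \<open>The last site before the first visit of y is a neighbour of y, and its potential is
  paid. The induction follows the walk until it stands next to y.\<close>

lemma green_e_le_min_neighbour:
  assumes "x \<noteq> y"
  shows "green_e v x y \<le> exp_minus (min_neighbour v y)"
proof (rule green_e_le)
  fix n show "green_upto v y n x \<le> exp_minus (min_neighbour v y)"
    using assms
  proof (induction n arbitrary: x)
    case (Suc n)
    show ?case
    proof (cases "x - y \<in> nbrs")
      case True
      then have "min_neighbour v y \<le> v x"
        unfolding min_neighbour_def by (intro Min_le) (auto simp: adjacent_iff_nbrs intro!: finite_imageI finite_adjacent)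
      moreover have "green_upto v y (Suc n) x \<le> exp_minus (v x)"
        using Suc.prems mult_left_le[OF avg_le_const[of "\<lambda>z. green_upto v y n (x + z)" 1, OF green_upto_bounds(2)] exp_minus_bounds(1), of "v x"]
        by simp
      ultimately show ?thesis using exp_minus_antimono by (metis order_trans)
    next
      case False
      \<comment> \<open>A walk not adjacent to y cannot be at y after one step, so the induction
        hypothesis applies.\<close>
      have "green_upto v y n (x + z) \<le> exp_minus (min_neighbour v y)" if "z \<in> nbrs" for z
      proof (rule Suc.IH)
        have "x - y = - z \<Longrightarrow> False" using False uminus_nbrs[OF that] by simp
        then show "x + z \<noteq> y" by (auto simp: algebra_simps)
      qed
      then have "(\<Sum>z\<in>nbrs. green_upto v y n (x + z)) / card (nbrs :: (int ^ 'a) set) \<le> exp_minus (min_neighbour v y)"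
        by (rule avg_le_const)
      then have "exp_minus (v x) * ((\<Sum>z\<in>nbrs. green_upto v y n (x + z)) / card (nbrs :: (int ^ 'a) set)) \<le> 1 * exp_minus (min_neighbour v y)"
        by (intro mult_mono) (auto simp: exp_minus_bounds green_upto_bounds intro!: divide_nonneg_nonneg sum_nonneg)
      then show ?thesis using Suc.prems by simp
    qed
  qed (simp add: exp_minus_bounds)
qed

text \<open>Q is closed under steps taken outside U, so a walk from x to y has to visit U. Dropping
  what is paid after this visit, a union bound over the visited site gives the sum.\<close>

lemma green_e_separation:
  assumes "finite U" "x \<in> Q" "\<And>u z. u \<in> Q \<Longrightarrow> u \<notin> U \<Longrightarrow> z \<in> nbrs \<Longrightarrow> u + z \<in> Q" "y \<notin> Q - U"
  shows "green_e v x y \<le> (\<Sum>u\<in>U. green_e v x u)"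
proof (rule green_e_le)
  fix n show "green_upto v y n x \<le> (\<Sum>u\<in>U. green_e v x u)"
    using assms(2)
  proof (induction n arbitrary: x)
    case 0
    show ?case
    proof (cases "x = y")
      case True
      then have "x \<in> U" using 0 assms(4) by auto
      then have "green_e v x x \<le> (\<Sum>u\<in>U. green_e v x u)"
        using assms(1) by (intro member_le_sum) (auto simp: green_e_bounds)
      then show ?thesis using True by simp
    qed (simp add: sum_nonneg green_e_bounds)
  next
    case (Suc n)
    show ?case
    proof (cases "x \<in> U")
      case True
      then have "green_e v x x \<le> (\<Sum>u\<in>U. green_e v x u)"
        using assms(1) by (intro member_le_sum) (auto simp: green_e_bounds)
      then show ?thesis using green_upto_bounds(2)[of v y "Suc n" x] by (simp only: green_e_self)
    next
      case False
      then have xy: "x \<noteq> y" using Suc.prems assms(4) by auto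
      have "green_upto v y (Suc n) x = exp_minus (v x) * ((\<Sum>z\<in>nbrs. green_upto v y n (x + z)) / card (nbrs :: (int ^ 'a) set))"
        using xy by simp
      also have "\<dots> \<le> exp_minus (v x) * ((\<Sum>z\<in>nbrs. \<Sum>u\<in>U. green_e v (x + z) u) / card (nbrs :: (int ^ 'a) set))"
        by (intro mult_left_mono divide_right_mono sum_mono Suc.IH assms(3) Suc.prems False) (auto simp: exp_minus_bounds)
      also have "\<dots> = (\<Sum>u\<in>U. exp_minus (v x) * ((\<Sum>z\<in>nbrs. green_e v (x + z) u) / card (nbrs :: (int ^ 'a) set)))"
        by (subst sum.swap) (simp add: sum_distrib_left sum_divide_distrib)
      also have "\<dots> = (\<Sum>u\<in>U. green_e v x u)"
        using False by (intro sum.cong refl green_e_step[symmetric]) auto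
      finally show ?thesis .
    qed
  qed
qed

section \<open>Symmetries, monotonicity and measurability\<close>

lemma green_upto_shift: "green_upto (\<lambda>z. v (z + t)) y n x = green_upto v (y + t) n (x + t)"
  by (induction n arbitrary: x) (simp_all add: add.assoc add.commute add.left_commute)

lemma green_e_shift: "green_e (\<lambda>z. v (z + t)) x y = green_e v (x + t) (y + t)"
  using green_upto_tendsto[of "\<lambda>z. v (z + t)" y x] green_upto_tendsto[of v "y + t" "x + t"]
  unfolding green_upto_shift by (rule LIMSEQ_unique)

lemma sum_nbrs_uminus: "(\<Sum>z\<in>nbrs. f (- z)) = (\<Sum>z\<in>nbrs. f z)"
  by (rule sum.reindex_bij_witness[of _ uminus uminus]) (auto simp: uminus_nbrs)

lemma green_upto_uminus: "green_upto (\<lambda>z. v (- z)) y n x = green_upto v (- y) n (- x)"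
proof (induction n arbitrary: x)
  case (Suc n)
  show ?case using sum_nbrs_uminus[of "\<lambda>z. green_upto v (- y) n (- x + z)"]
    by (simp add: Suc.IH)
qed simp

lemma green_e_uminus: "green_e (\<lambda>z. v (- z)) x y = green_e v (- x) (- y)"
  using green_upto_tendsto[of "\<lambda>z. v (- z)" y x] green_upto_tendsto[of v "- y" "- x"]
  unfolding green_upto_uminus by (rule LIMSEQ_unique)

lemma green_upto_antimono:
  assumes "\<And>z. v' z \<le> v z"
  shows "green_upto v y n x \<le> green_upto v' y n x"
proof (induction n arbitrary: x)
  case (Suc n)
  then show ?case
    by (auto intro!: mult_mono divide_right_mono sum_mono exp_minus_antimono assms
        divide_nonneg_nonneg sum_nonneg simp: exp_minus_bounds green_upto_bounds)
qed simp

lemma measurable_green_upto [measurable (raw)]: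
  assumes [measurable]: "\<And>z. (\<lambda>\<omega>. V \<omega> z) \<in> borel_measurable M"
  shows "(\<lambda>\<omega>. green_upto (V \<omega>) y n x) \<in> borel_measurable M"
  by (induction n arbitrary: x) simp_all

lemma measurable_green_e [measurable (raw)]:
  assumes [measurable]: "\<And>z. (\<lambda>\<omega>. V \<omega> z) \<in> borel_measurable M"
  shows "(\<lambda>\<omega>. green_e (V \<omega>) x y) \<in> borel_measurable M"
  by (rule borel_measurable_LIMSEQ_real[OF green_upto_tendsto]) measurable

text \<open>Environments are real valued with potential \<open>\<bar>w z\<bar>\<close>: they live on
  a product of real lines and all costs are finite. The extended valued \<open>cost_a\<close>
  returns only in the transfer to V.\<close>

definition cost :: "(int ^ 'd::finite \<Rightarrow> real) \<Rightarrow> int ^ 'd \<Rightarrow> int ^ 'd \<Rightarrow> real" where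
  "cost w x y = - ln (green_e (\<lambda>z. ennreal \<bar>w z\<bar>) x y)"

definition l1_dist :: "int ^ 'd::finite \<Rightarrow> int ^ 'd \<Rightarrow> nat" where
  "l1_dist x y = (\<Sum>i\<in>UNIV. nat \<bar>x $ i - y $ i\<bar>)"

text \<open>Supports induction along a lattice path from x to y, one coordinate step at a
  time.\<close>

lemma l1_dist_step:
  assumes "x \<noteq> y"
  obtains z i where "z = axis i 1 \<or> z = axis i (-1)" "l1_dist x y = Suc (l1_dist (x + z) y)"
proof -
  obtain i where i: "x $ i \<noteq> y $ i" using assms by (auto simp: vec_eq_iff)
  define z where "z = (axis i (if x $ i < y $ i then 1 else -1) :: int ^ 'a)"
  have "z = axis i 1 \<or> z = axis i (-1)" by (simp add: z_def)
  moreover have "l1_dist x y = nat \<bar>x $ i - y $ i\<bar> + (\<Sum>j\<in>UNIV - {i}. nat \<bar>x $ j - y $ j\<bar>)"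
    unfolding l1_dist_def by (rule sum.remove) auto
  moreover have "l1_dist (x + z) y = nat \<bar>(x + z) $ i - y $ i\<bar> + (\<Sum>j\<in>UNIV - {i}. nat \<bar>(x + z) $ j - y $ j\<bar>)"
    unfolding l1_dist_def by (rule sum.remove) auto
  moreover have "(\<Sum>j\<in>UNIV - {i}. nat \<bar>(x + z) $ j - y $ j\<bar>) = (\<Sum>j\<in>UNIV - {i}. nat \<bar>x $ j - y $ j\<bar>)"
    by (rule sum.cong) (auto simp: z_def axis_def)
  moreover have "nat \<bar>x $ i - y $ i\<bar> = Suc (nat \<bar>(x + z) $ i - y $ i\<bar>)"
    using i by (auto simp: z_def axis_def)
  ultimately show ?thesis by (intro that[of z i]) auto
qed

lemma green_e_pos: "0 < green_e (\<lambda>z. ennreal \<bar>w z\<bar>) x y"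
proof (induction "l1_dist x y" arbitrary: x)
  case 0
  have "x = y"
  proof (rule ccontr)
    assume "x \<noteq> y"
    then obtain z i where "z = axis i 1 \<or> z = axis i (-1)" "l1_dist x y = Suc (l1_dist (x + z) y)"
      by (rule l1_dist_step)
    with 0 show False by simp
  qed
  then show ?case by simp
next
  case (Suc n)
  then have "x \<noteq> y" by (auto simp: l1_dist_def)
  then obtain z i where "z = axis i 1 \<or> z = axis i (-1)" "l1_dist x y = Suc (l1_dist (x + z) y)"
    by (rule l1_dist_step)
  then have z: "z \<in> nbrs" "l1_dist x y = Suc (l1_dist (x + z) y)" by (auto simp: axis_in_nbrs)
  have "0 < green_e (\<lambda>z. ennreal \<bar>w z\<bar>) (x + z) y" using Suc z by simp
  moreover have "0 < green_e (\<lambda>z. ennreal \<bar>w z\<bar>) x (x + z)"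
    by (rule less_le_trans[OF _ green_e_adjacent[OF z(1)]]) (simp add: exp_minus_ennreal)
  ultimately show ?case
    using green_e_triangle[of "\<lambda>z. ennreal \<bar>w z\<bar>" x "x + z" y] by (meson less_le_trans mult_pos_pos)
qed

lemma exp_minus_cost: "exp (- cost w x y) = green_e (\<lambda>z. ennreal \<bar>w z\<bar>) x y"
  by (simp add: cost_def green_e_pos)

lemma cost_nonneg: "0 \<le> cost w x y"
  using green_e_bounds(2) by (simp add: cost_def ln_le_zero_iff green_e_pos)

lemma cost_self [simp]: "cost w x x = 0"
  by (simp add: cost_def)

lemma cost_triangle: "cost w x z \<le> cost w x y + cost w y z"
proof -
  have "exp (- (cost w x y + cost w y z)) = exp (- cost w x y) * exp (- cost w y z)"
    by (simp add: exp_add[symmetric])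
  also have "\<dots> \<le> exp (- cost w x z)"
    unfolding exp_minus_cost by (rule green_e_triangle)
  finally have "exp (- (cost w x y + cost w y z)) \<le> exp (- cost w x z)" .
  then show ?thesis by simp
qed

lemma cost_adjacent:
  fixes x :: "int ^ 'd::finite"
  assumes "z \<in> nbrs"
  shows "cost w x (x + z) \<le> \<bar>w x\<bar> + ln (card (nbrs :: (int ^ 'd) set))"
proof -
  have "exp (- (\<bar>w x\<bar> + ln (card (nbrs :: (int ^ 'd) set)))) = exp_minus (ennreal \<bar>w x\<bar>) / card (nbrs :: (int ^ 'd) set)"
    by (simp add: exp_minus_ennreal exp_diff)
  also have "\<dots> \<le> exp (- cost w x (x + z))"
    unfolding exp_minus_cost by (rule green_e_adjacent[OF assms])
  finally show ?thesis by simp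
qed

lemma cost_shift: "cost (\<lambda>z. w (z + t)) x y = cost w (x + t) (y + t)"
  by (simp add: cost_def green_e_shift[of "\<lambda>z. ennreal \<bar>w z\<bar>"])

lemma cost_uminus: "cost (\<lambda>z. w (- z)) x y = cost w (- x) (- y)"
  by (simp add: cost_def green_e_uminus[of "\<lambda>z. ennreal \<bar>w z\<bar>"])

lemma measurable_cost [measurable (raw)]:
  assumes [measurable]: "\<And>z. (\<lambda>\<omega>. W \<omega> z) \<in> borel_measurable M"
  shows "(\<lambda>\<omega>. cost (W \<omega>) x y) \<in> borel_measurable M"
  unfolding cost_def by measurable

section \<open>The subadditive ergodic theorem\<close>

text \<open>For a fixed slope, the existence of an additive constant C is stable under the shift, so
  a zero-one law decides it. Countably many slopes then determine the limit.\<close>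

lemma tendsto_of_linear_bounds:
  fixes s :: "nat \<Rightarrow> real"
  assumes "\<forall>k::nat. \<exists>C. \<forall>n. s n \<le> (\<mu> + 1 / Suc k) * real n + C"
    and "\<forall>k::nat. \<exists>C. \<forall>n. (\<mu> - 1 / Suc k) * real n - C \<le> s n"
  shows "(\<lambda>n. s n / real n) \<longlonglongrightarrow> \<mu>"
proof (rule LIMSEQ_I)
  fix r :: real assume "0 < r"
  then obtain k where k: "1 / real (Suc k) < r / 2" using nat_approx_posE[of "r / 2"] by auto
  obtain C where C: "\<And>n. s n \<le> (\<mu> + 1 / Suc k) * real n + C" using assms(1) by blast
  obtain C' where C': "\<And>n. (\<mu> - 1 / Suc k) * real n - C' \<le> s n" using assms(2) by blast
  obtain N :: nat where N: "(\<bar>C\<bar> + \<bar>C'\<bar>) / (r / 2) < N" using reals_Archimedean2 by blast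
  have "norm (s n / real n - \<mu>) < r" if "n \<ge> max 1 N" for n
  proof -
    have n: "real n > 0" "\<bar>C\<bar> + \<bar>C'\<bar> < r / 2 * n"
      using that N \<open>0 < r\<close> by (auto simp: field_simps) (smt (verit) of_nat_le_iff mult_left_mono)
    have kn: "1 / Suc k * real n \<le> r / 2 * real n" using k n by (intro mult_right_mono) auto
    have "s n \<le> \<mu> * n + 1 / Suc k * n + C" "\<mu> * n - 1 / Suc k * n - C' \<le> s n"
      using C[of n] C'[of n] by (simp_all add: algebra_simps)
    then have "\<bar>s n - \<mu> * n\<bar> < r * n" using n kn by (simp only: abs_less_iff) linarith
    moreover have "s n / n - \<mu> = (s n - \<mu> * n) / n" using n by (simp add: field_simps)
    ultimately show ?thesis using n by (simp add: field_simps abs_divide)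
  qed
  then show "\<exists>no. \<forall>n\<ge>no. norm (s n / real n - \<mu>) < r" by blast
qed

text \<open>The zero-one law is required for all powers of T, because Kingman's theorem passes to
  \<open>T ^^ m\<close>, and for events that are merely forward stable.\<close>

locale ergodic_map = prob_space P for P :: "'a measure" +
  fixes T :: "'a \<Rightarrow> 'a"
  assumes T_meas [measurable]: "T \<in> measurable P P"
    and T_distr: "distr P P T = P"
    and T_ergodic: "\<And>m A. 0 < m \<Longrightarrow> A \<in> sets P \<Longrightarrow> (\<And>\<omega>. \<omega> \<in> A \<Longrightarrow> (T ^^ m) \<omega> \<in> A)
      \<Longrightarrow> prob A = 0 \<or> prob A = 1"
begin

lemma T_pow_meas [measurable]: "T ^^ i \<in> measurable P P"
  by (induction i) (auto simp: measurable_compose comp_def)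

lemma T_pow_distr: "distr P P (T ^^ i) = P"
proof (induction i)
  case 0
  show ?case using distr_id[of P] by (simp add: id_def)
next
  case (Suc i)
  have "distr P P (T \<circ> (T ^^ i)) = distr (distr P P (T ^^ i)) P T"
    by (subst distr_distr) auto
  with Suc T_distr show ?case by (simp add: comp_def)
qed

lemma T_pow_space: "\<omega> \<in> space P \<Longrightarrow> (T ^^ i) \<omega> \<in> space P"
  using measurable_space[OF T_pow_meas] .

lemma integrable_T_pow:
  fixes g :: "'a \<Rightarrow> real"
  assumes "integrable P g"
  shows "integrable P (\<lambda>\<omega>. g ((T ^^ i) \<omega>))" "(\<integral>\<omega>. g ((T ^^ i) \<omega>) \<partial>P) = (\<integral>\<omega>. g \<omega> \<partial>P)"
  using integrable_distr[OF T_pow_meas, of i g] integral_distr[OF T_pow_meas, of g i] assms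
  by (simp_all add: T_pow_distr)

lemma subadditive_sum_bound:
  fixes f :: "nat \<Rightarrow> 'a \<Rightarrow> real"
  assumes "f 0 = (\<lambda>_. 0)"
    and "\<And>m n \<omega>. \<omega> \<in> space P \<Longrightarrow> f (m + n) \<omega> \<le> f m \<omega> + f n ((T ^^ m) \<omega>)"
    and "\<omega> \<in> space P"
  shows "f n \<omega> \<le> (\<Sum>i<n. f 1 ((T ^^ i) \<omega>))"
proof (induction n)
  case (Suc n)
  show ?case using assms(2)[of \<omega> n 1] Suc assms(3) by simp
qed (simp add: assms(1))

text \<open>Greedy tiling. The event that the bound holds is forward stable. If it had probability
  0, almost every point would start a block of some length m with \<open>f m < c * m\<close>.
  Cutting an orbit segment into such blocks of length at most N, and paying \<open>f 1\<close> where
  none is available, would make the mean of \<open>f n\<close> grow at a rate below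
  \<gamma>.\<close>

lemma subadditive_eventually_ge:
  fixes f :: "nat \<Rightarrow> 'a \<Rightarrow> real" and c \<gamma> :: real
  assumes f_meas [measurable]: "\<And>n. f n \<in> borel_measurable P"
    and nonneg: "\<And>n \<omega>. 0 \<le> f n \<omega>"
    and f0: "f 0 = (\<lambda>_. 0)"
    and subadd: "\<And>m n \<omega>. \<omega> \<in> space P \<Longrightarrow> f (m + n) \<omega> \<le> f m \<omega> + f n ((T ^^ m) \<omega>)"
    and int1: "integrable P (f 1)"
    and \<gamma>: "\<And>n. 0 < n \<Longrightarrow> \<gamma> * n \<le> (\<integral>\<omega>. f n \<omega> \<partial>P)"
    and c: "c < \<gamma>"
  shows "AE \<omega> in P. \<exists>C. \<forall>n. c * real n - C \<le> f n \<omega>"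
proof (cases "0 \<le> c")
  case False
  then have "c * real n - 0 \<le> f n \<omega>" for n \<omega>
    using nonneg[of n \<omega>] mult_nonpos_nonneg[of c "real n"] by linarith
  then show ?thesis by blast
next
  case True
  define A where "A = {\<omega> \<in> space P. \<exists>C::nat. \<forall>n. c * real n - real C \<le> f n \<omega>}"
  have A_sets [measurable]: "A \<in> sets P" unfolding A_def by measurable
  have A_inv: "T \<omega> \<in> A" if "\<omega> \<in> A" for \<omega>
  proof -
    from that obtain C :: nat where \<omega>: "\<omega> \<in> space P" and C: "\<And>n. c * real n - real C \<le> f n \<omega>"
      by (auto simp: A_def)
    obtain C' :: nat where C': "real C + f 1 \<omega> - c \<le> real C'" using real_arch_simple by blast
    have "c * real n - real C' \<le> f n (T \<omega>)" for n
      using C[of "1 + n"] subadd[OF \<omega>, of 1 n] C' by (simp add: algebra_simps)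
    then show ?thesis using \<omega> measurable_space[OF T_meas] by (auto simp: A_def)
  qed
  have "prob A = 0 \<or> prob A = 1"
    using T_ergodic[of 1 A] A_inv by simp
  then show ?thesis
  proof
    assume "prob A = 1"
    then have "AE \<omega> in P. \<omega> \<in> A" by (simp add: prob_eq_1)
    then show ?thesis by eventually_elim (auto simp: A_def)
  next
    assume "prob A = 0"
    then have notA: "AE \<omega> in P. \<omega> \<notin> A" by (simp add: prob_eq_0)
    \<comment> \<open>The points at which no cheap block of length at most N starts. They become
      negligible as N grows, even when weighted with \<open>f 1\<close>.\<close>
    define B where "B N = {\<omega> \<in> space P. \<forall>n\<in>{1..N}. c * real n \<le> f n \<omega>}" for N
    have B_sets [measurable]: "B N \<in> sets P" for N unfolding B_def by measurable
    have "AE \<omega> in P. (\<lambda>N. f 1 \<omega> * indicator (B N) \<omega>) \<longlonglongrightarrow> 0"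
      using notA AE_space
    proof eventually_elim
      case (elim \<omega>)
      then obtain n where n: "f n \<omega> < c * real n" unfolding A_def
        by (auto simp: not_le) (metis diff_zero of_nat_0)
      then have "n > 0" using nonneg[of n \<omega>] by (cases n) auto
      have "\<omega> \<notin> B N" if "n \<le> N" for N
        using n \<open>n > 0\<close> that by (auto simp: B_def not_le intro!: bexI[of _ n])
      then have "eventually (\<lambda>N. f 1 \<omega> * indicator (B N) \<omega> = 0) sequentially"
        by (intro eventually_sequentiallyI[of n]) auto
      then show ?case by (rule tendsto_eventually)
    qed
    then have "(\<lambda>N. \<integral>\<omega>. f 1 \<omega> * indicator (B N) \<omega> \<partial>P) \<longlonglongrightarrow> (\<integral>\<omega>. 0 \<partial>P)"
      by (rule integral_dominated_convergence[where w="f 1", rotated 3])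
         (use int1 nonneg in \<open>auto simp: indicator_def\<close>)
    then have "eventually (\<lambda>N. (\<integral>\<omega>. f 1 \<omega> * indicator (B N) \<omega> \<partial>P) < (\<gamma> - c) / 2) sequentially"
      using c by (intro order_tendstoD(2)) auto
    then obtain N where N: "(\<integral>\<omega>. f 1 \<omega> * indicator (B N) \<omega> \<partial>P) < (\<gamma> - c) / 2"
      by (auto simp: eventually_sequentially)
    define \<phi> where "\<phi> \<omega> = c + f 1 \<omega> * indicator (B N) \<omega>" for \<omega>
    have \<phi>_int: "integrable P \<phi>" unfolding \<phi>_def
      using int1 by (intro Bochner_Integration.integrable_add integrable_mult_indicator[where 'b=real, simplified mult.commute])
        (auto intro!: integrable_real_mult_indicator)
    have \<phi>_nonneg: "0 \<le> \<phi> \<omega>" and \<phi>_ge: "c \<le> \<phi> \<omega>" for \<omega>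
      using True nonneg by (auto simp: \<phi>_def)
    \<comment> \<open>The price of the tiling: \<phi> at every index, and \<open>f 1\<close> on the
      last N indices, where a block may no longer fit.\<close>
    define R where "R n \<omega> = (\<Sum>i<n. \<phi> ((T ^^ i) \<omega>)) + (\<Sum>i\<in>{n-N..<n}. f 1 ((T ^^ i) \<omega>))" for n \<omega>
    have R_step: "(\<Sum>i<m. \<phi> ((T ^^ i) \<omega>)) + R (n - m) ((T ^^ m) \<omega>) \<le> R n \<omega>" if "m \<le> n" for m n \<omega>
    proof -
      have pow: "(T ^^ i) ((T ^^ m) \<omega>) = (T ^^ (i + m)) \<omega>" for i by (simp add: funpow_add)
      have "(\<Sum>i<n-m. \<phi> ((T ^^ i) ((T ^^ m) \<omega>))) = (\<Sum>i\<in>{m..<n}. \<phi> ((T ^^ i) \<omega>))"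
        unfolding pow using that
        by (intro sum.reindex_bij_witness[of _ "\<lambda>i. i - m" "\<lambda>i. i + m"]) auto
      moreover have "(\<Sum>i<m. \<phi> ((T ^^ i) \<omega>)) + (\<Sum>i\<in>{m..<n}. \<phi> ((T ^^ i) \<omega>)) = (\<Sum>i<n. \<phi> ((T ^^ i) \<omega>))"
        using that sum.atLeastLessThan_concat[of 0 m n "\<lambda>i. \<phi> ((T ^^ i) \<omega>)"] by (simp add: lessThan_atLeast0)
      moreover have "(\<Sum>i\<in>{n-m-N..<n-m}. f 1 ((T ^^ i) ((T ^^ m) \<omega>))) = (\<Sum>i\<in>{n-m-N+m..<n}. f 1 ((T ^^ i) \<omega>))"
        unfolding pow using that
        by (intro sum.reindex_bij_witness[of _ "\<lambda>i. i - m" "\<lambda>i. i + m"]) auto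
      moreover have "\<dots> \<le> (\<Sum>i\<in>{n-N..<n}. f 1 ((T ^^ i) \<omega>))"
        by (rule sum_mono2) (use nonneg in auto)
      ultimately show ?thesis by (simp add: R_def)
    qed
    have bound: "f n \<omega> \<le> R n \<omega>" if "\<omega> \<in> space P" for n \<omega>
      using that
    proof (induction n arbitrary: \<omega> rule: less_induct)
      case (less n)
      show ?case
      proof (cases "n \<le> N")
        case True
        then have "f n \<omega> \<le> (\<Sum>i\<in>{n-N..<n}. f 1 ((T ^^ i) \<omega>))"
          using subadditive_sum_bound[OF f0 subadd less.prems, of n] by (simp add: lessThan_atLeast0)
        also have "\<dots> \<le> R n \<omega>" using \<phi>_nonneg by (simp add: R_def sum_nonneg)
        finally show ?thesis .
      next
        case nN: False
        show ?thesis
        proof (cases "\<omega> \<in> B N")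
          case True
          have "f n \<omega> \<le> f 1 \<omega> + f (n - 1) ((T ^^ 1) \<omega>)"
            using subadd[OF less.prems, of 1 "n - 1"] nN by simp
          also have "f (n - 1) ((T ^^ 1) \<omega>) \<le> R (n - 1) ((T ^^ 1) \<omega>)"
            using nN T_pow_space[OF less.prems, of 1] by (intro less.IH) auto
          also have "f 1 \<omega> \<le> (\<Sum>i<1. \<phi> ((T ^^ i) \<omega>))" using True \<open>0 \<le> c\<close> by (simp add: \<phi>_def)
          also have "(\<Sum>i<1. \<phi> ((T ^^ i) \<omega>)) + R (n - 1) ((T ^^ 1) \<omega>) \<le> R n \<omega>"
            using nN by (intro R_step) auto
          finally show ?thesis by simp
        next
          case False
          then obtain m where m: "1 \<le> m" "m \<le> N" "f m \<omega> < c * real m"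
            using less.prems by (auto simp: B_def not_le)
          have "f n \<omega> \<le> f m \<omega> + f (n - m) ((T ^^ m) \<omega>)"
            using subadd[OF less.prems, of m "n - m"] nN m by simp
          also have "f (n - m) ((T ^^ m) \<omega>) \<le> R (n - m) ((T ^^ m) \<omega>)"
            using nN m T_pow_space[OF less.prems, of m] by (intro less.IH) auto
          also have "f m \<omega> \<le> (\<Sum>i<m. c)" using m by (simp add: mult.commute)
          also have "\<dots> \<le> (\<Sum>i<m. \<phi> ((T ^^ i) \<omega>))" by (rule sum_mono) (rule \<phi>_ge)
          also have "(\<Sum>i<m. \<phi> ((T ^^ i) \<omega>)) + R (n - m) ((T ^^ m) \<omega>) \<le> R n \<omega>"
            using nN m by (intro R_step) auto
          finally show ?thesis by simp
        qed
      qed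
    qed
    have R_int: "integrable P (R n)" for n
      unfolding R_def using \<phi>_int int1 by (intro Bochner_Integration.integrable_add Bochner_Integration.integrable_sum integrable_T_pow) auto
    have E\<phi>: "(\<integral>\<omega>. \<phi> \<omega> \<partial>P) \<le> (c + \<gamma>) / 2"
    proof -
      have "(\<integral>\<omega>. \<phi> \<omega> \<partial>P) = c + (\<integral>\<omega>. f 1 \<omega> * indicator (B N) \<omega> \<partial>P)"
        unfolding \<phi>_def using int1 by (subst Bochner_Integration.integral_add)
          (auto intro!: integrable_real_mult_indicator simp: prob_space)
      then show ?thesis using N by (simp add: field_simps)
    qed
    \<comment> \<open>The rate on the right is halfway between c and \<gamma>, so a large n gives a
      contradiction.\<close>
    have "\<gamma> * n \<le> (c + \<gamma>) / 2 * n + N * (\<integral>\<omega>. f 1 \<omega> \<partial>P)" if "0 < n" for n :: nat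
    proof -
      have "\<gamma> * n \<le> (\<integral>\<omega>. f n \<omega> \<partial>P)" using \<gamma>[OF that] .
      also have "\<dots> \<le> (\<integral>\<omega>. R n \<omega> \<partial>P)"
        by (rule integral_mono') (use R_int bound order_trans[OF nonneg bound] in auto)
      also have "\<dots> = n * (\<integral>\<omega>. \<phi> \<omega> \<partial>P) + card {n-N..<n} * (\<integral>\<omega>. f 1 \<omega> \<partial>P)"
        unfolding R_def using \<phi>_int int1
        by (simp add: Bochner_Integration.integral_add Bochner_Integration.integral_sum integrable_T_pow
            del: card_atLeastLessThan)
      also have "\<dots> \<le> n * ((c + \<gamma>) / 2) + N * (\<integral>\<omega>. f 1 \<omega> \<partial>P)"
        using E\<phi> nonneg by (intro add_mono mult_left_mono mult_right_mono) (auto simp: integral_nonneg_AE)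
      finally show ?thesis by (simp add: mult.commute)
    qed
    note ineq = this
    obtain n :: nat where "N * (\<integral>\<omega>. f 1 \<omega> \<partial>P) / ((\<gamma> - c) / 2) < n" using reals_Archimedean2 by blast
    then have n: "N * (\<integral>\<omega>. f 1 \<omega> \<partial>P) < n * ((\<gamma> - c) / 2)" using c by (simp add: field_simps)
    have "0 \<le> N * (\<integral>\<omega>. f 1 \<omega> \<partial>P)" using nonneg by (simp add: integral_nonneg_AE)
    then have "0 < n" using n by (cases n) auto
    have "\<gamma> * n - (c + \<gamma>) / 2 * n = n * ((\<gamma> - c) / 2)" by (simp add: field_simps)
    with ineq[OF \<open>0 < n\<close>] n have False by linarith
    then show ?thesis ..
  qed
qed

text \<open>The mirror image of the previous tiling for additive sums: blocks now satisfy
  \<open>s m > c * m\<close>, and points that start no such block contribute nothing.\<close>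

lemma birkhoff_eventually_le:
  fixes g :: "'a \<Rightarrow> real"
  assumes int: "integrable P g" and nonneg: "\<And>\<omega>. 0 \<le> g \<omega>" and c: "(\<integral>\<omega>. g \<omega> \<partial>P) < c"
  shows "AE \<omega> in P. \<exists>C. \<forall>n. (\<Sum>i<n. g ((T ^^ i) \<omega>)) \<le> c * real n + C"
proof -
  note [measurable] = borel_measurable_integrable[OF int]
  have c0: "0 < c" using c integral_nonneg_AE[of g P, OF AE_I2[OF nonneg]] by simp
  define s where "s n \<omega> = (\<Sum>i<n. g ((T ^^ i) \<omega>))" for n \<omega>
  have s_meas [measurable]: "s n \<in> borel_measurable P" for n unfolding s_def by measurable
  have s_add: "s (m + n) \<omega> = s m \<omega> + s n ((T ^^ m) \<omega>)" for m n \<omega>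
  proof (induction n)
    case (Suc n)
    then show ?case by (simp add: s_def funpow_add[of n m, unfolded comp_def, THEN fun_cong, symmetric] add.commute[of n m])
  qed (simp add: s_def)
  define A where "A = {\<omega> \<in> space P. \<exists>C::nat. \<forall>n. s n \<omega> \<le> c * real n + real C}"
  have A_sets [measurable]: "A \<in> sets P" unfolding A_def by measurable
  have A_inv: "T \<omega> \<in> A" if "\<omega> \<in> A" for \<omega>
  proof -
    from that obtain C :: nat where \<omega>: "\<omega> \<in> space P" and C: "\<And>n. s n \<omega> \<le> c * real n + real C"
      by (auto simp: A_def)
    obtain C' :: nat where C': "real C + c \<le> real C'" using real_arch_simple by blast
    have "s n (T \<omega>) \<le> c * real n + real C'" for n
      using C[of "1 + n"] s_add[of 1 n \<omega>] nonneg[of \<omega>] C' by (simp add: algebra_simps) (simp add: s_def)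
    then show ?thesis using \<omega> measurable_space[OF T_meas] by (auto simp: A_def)
  qed
  have "prob A = 0 \<or> prob A = 1"
    using T_ergodic[of 1 A] A_inv by simp
  then show ?thesis
  proof
    assume "prob A = 1"
    then have "AE \<omega> in P. \<omega> \<in> A" by (simp add: prob_eq_1)
    then show ?thesis by eventually_elim (auto simp: A_def s_def)
  next
    assume "prob A = 0"
    then have notA: "AE \<omega> in P. \<omega> \<notin> A" by (simp add: prob_eq_0)
    define B where "B N = {\<omega> \<in> space P. \<forall>n\<in>{1..N}. s n \<omega> \<le> c * real n}" for N
    have B_sets [measurable]: "B N \<in> sets P" for N unfolding B_def by measurable
    have "AE \<omega> in P. (\<lambda>N. c * indicator (B N) \<omega>) \<longlonglongrightarrow> (0::real)"
      using notA AE_space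
    proof eventually_elim
      case (elim \<omega>)
      then obtain n where n: "c * real n < s n \<omega>" unfolding A_def
        by (auto simp: not_le) (metis add_0_right of_nat_0)
      then have "n > 0" by (cases n) (auto simp: s_def)
      have "\<omega> \<notin> B N" if "n \<le> N" for N
        using n \<open>n > 0\<close> that by (auto simp: B_def not_le intro!: bexI[of _ n])
      then have "eventually (\<lambda>N. c * indicator (B N) \<omega> = (0::real)) sequentially"
        by (intro eventually_sequentiallyI[of n]) auto
      then show ?case by (rule tendsto_eventually)
    qed
    then have "(\<lambda>N. \<integral>\<omega>. c * indicator (B N) \<omega> \<partial>P) \<longlonglongrightarrow> (\<integral>\<omega>. 0 \<partial>P)"
      by (rule integral_dominated_convergence[where w="\<lambda>_. c", rotated 3])
         (use c0 in \<open>auto simp: indicator_def\<close>)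
    then have "eventually (\<lambda>N. (\<integral>\<omega>. c * indicator (B N) \<omega> \<partial>P) < (c - (\<integral>\<omega>. g \<omega> \<partial>P)) / 2) sequentially"
      using c by (intro order_tendstoD(2)) auto
    then obtain N where N: "(\<integral>\<omega>. c * indicator (B N) \<omega> \<partial>P) < (c - (\<integral>\<omega>. g \<omega> \<partial>P)) / 2"
      by (auto simp: eventually_sequentially)
    \<comment> \<open>\<open>q\<close> charges c at every point where a block of length at most N
      begins with average above c. The tiling bounds it by \<open>s\<close>, up to
      \<open>c * N\<close> for the untiled end.\<close>
    define q where "q n \<omega> = (\<Sum>i<n. c - c * indicator (B N) ((T ^^ i) \<omega>))" for n \<omega>
    have q_le: "q n \<omega> \<le> c * n" for n \<omega>
      using sum_mono[of "{..<n}" "\<lambda>i. c - c * indicator (B N) ((T ^^ i) \<omega>)" "\<lambda>_. c"] c0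
      by (simp add: q_def mult.commute)
    have q_add: "q n \<omega> \<le> c * m + q (n - m) ((T ^^ m) \<omega>)" if "m \<le> n" for m n \<omega>
    proof -
      have "q n \<omega> = q m \<omega> + (\<Sum>i\<in>{m..<n}. c - c * indicator (B N) ((T ^^ i) \<omega>))"
        unfolding q_def using that sum.atLeastLessThan_concat[of 0 m n "\<lambda>i. c - c * indicator (B N) ((T ^^ i) \<omega>)"]
        by (simp add: lessThan_atLeast0)
      also have "(\<Sum>i\<in>{m..<n}. c - c * indicator (B N) ((T ^^ i) \<omega>)) = q (n - m) ((T ^^ m) \<omega>)"
        unfolding q_def using that
        by (intro sum.reindex_bij_witness[of _ "\<lambda>i. i + m" "\<lambda>i. i - m"]) (auto simp: fun_cong[OF funpow_add, symmetric, simplified comp_def])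
      finally show ?thesis using q_le[of m \<omega>] by simp
    qed
    have bound: "q n \<omega> \<le> s n \<omega> + c * N" if "\<omega> \<in> space P" for n \<omega>
      using that
    proof (induction n arbitrary: \<omega> rule: less_induct)
      case (less n)
      have s0: "0 \<le> s n \<omega>" for n \<omega> using nonneg by (simp add: s_def sum_nonneg)
      show ?case
      proof (cases "n \<le> N")
        case True
        then have "c * n \<le> c * N" using c0 by simp
        then show ?thesis using q_le[of n \<omega>] s0[of n \<omega>] by linarith
      next
        case nN: False
        show ?thesis
        proof (cases "\<omega> \<in> B N")
          case True
          obtain n' where n': "n = Suc n'" using nN by (cases n) auto
          have "q n \<omega> = q n' (T \<omega>)"
            unfolding q_def n' by (subst sum.lessThan_Suc_shift) (use True in \<open>simp add: funpow_swap1\<close>)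
          also have "\<dots> \<le> s n' (T \<omega>) + c * N"
            using n' T_pow_space[OF less.prems, of 1] by (intro less.IH) auto
          also have "s n' (T \<omega>) \<le> s n \<omega>" using s_add[of 1 n' \<omega>] s0[of 1 \<omega>] n' by simp
          finally show ?thesis by simp
        next
          case False
          then obtain m where m: "1 \<le> m" "m \<le> N" "c * real m < s m \<omega>"
            using less.prems by (auto simp: B_def not_le)
          have "q n \<omega> \<le> c * m + q (n - m) ((T ^^ m) \<omega>)" using nN m by (intro q_add) auto
          also have "q (n - m) ((T ^^ m) \<omega>) \<le> s (n - m) ((T ^^ m) \<omega>) + c * N"
            using nN m T_pow_space[OF less.prems, of m] by (intro less.IH) auto
          finally show ?thesis using m s_add[of m "n - m" \<omega>] nN by simp
        qed
      qed
    qed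
    have ind_int: "integrable P (\<lambda>\<omega>. c * indicator (B N) \<omega>)"
      by (rule integrable_const_bound[of _ c]) (use c0 in \<open>auto simp: indicator_def\<close>)
    have qint: "integrable P (q n)" "(\<integral>\<omega>. q n \<omega> \<partial>P) = n * (c - (\<integral>\<omega>. c * indicator (B N) \<omega> \<partial>P))" for n
      unfolding q_def using integrable_T_pow[OF ind_int]
      by (auto simp: Bochner_Integration.integral_sum Bochner_Integration.integral_diff prob_space
          simp del: integral_mult_right_zero)
    have sint: "integrable P (s n)" "(\<integral>\<omega>. s n \<omega> \<partial>P) = n * (\<integral>\<omega>. g \<omega> \<partial>P)" for n
      unfolding s_def using integrable_T_pow[OF int] by (auto simp: Bochner_Integration.integral_sum)
    have "n * (c - (\<integral>\<omega>. c * indicator (B N) \<omega> \<partial>P)) \<le> n * (\<integral>\<omega>. g \<omega> \<partial>P) + c * N" for n :: nat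
    proof -
      have "(\<integral>\<omega>. q n \<omega> \<partial>P) \<le> (\<integral>\<omega>. s n \<omega> + c * N \<partial>P)"
        by (rule integral_mono) (use qint sint bound in auto)
      then show ?thesis using qint sint by (simp add: prob_space)
    qed
    note ineq = this
    define u where "u = (c - (\<integral>\<omega>. g \<omega> \<partial>P)) / 2"
    have u: "u > 0" using c by (simp add: u_def)
    obtain n :: nat where "c * N / u < n" using reals_Archimedean2 by blast
    then have n: "c * N < n * u" using u by (simp add: field_simps)
    have "n * ((\<integral>\<omega>. g \<omega> \<partial>P) + u) \<le> n * (c - (\<integral>\<omega>. c * indicator (B N) \<omega> \<partial>P))"
      using N by (intro mult_left_mono) (auto simp: u_def field_simps)
    with ineq[of n] n have False by (simp add: algebra_simps)
    then show ?thesis ..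
  qed
qed

lemma (in ergodic_map) ergodic_map_pow:
  assumes "0 < m"
  shows "ergodic_map P (T ^^ m)"
proof
  fix k A assume "0 < (k::nat)" "A \<in> sets P" "\<And>\<omega>. \<omega> \<in> A \<Longrightarrow> ((T ^^ m) ^^ k) \<omega> \<in> A"
  then show "prob A = 0 \<or> prob A = 1"
    using T_ergodic[of "m * k" A] assms by (simp add: funpow_mult mult.commute)
qed (auto simp: T_pow_distr)

lemma birkhoff:
  fixes g :: "'a \<Rightarrow> real"
  assumes int: "integrable P g" and nonneg: "\<And>\<omega>. 0 \<le> g \<omega>"
  shows "AE \<omega> in P. (\<lambda>n. (\<Sum>i<n. g ((T ^^ i) \<omega>)) / real n) \<longlonglongrightarrow> (\<integral>\<omega>. g \<omega> \<partial>P)"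
proof -
  note [measurable] = borel_measurable_integrable[OF int]
  define \<mu> where "\<mu> = (\<integral>\<omega>. g \<omega> \<partial>P)"
  define s where "s n \<omega> = (\<Sum>i<n. g ((T ^^ i) \<omega>))" for n \<omega>
  have s_add: "s (m + n) \<omega> = s m \<omega> + s n ((T ^^ m) \<omega>)" for m n \<omega>
  proof (induction n)
    case (Suc n)
    then show ?case by (simp add: s_def funpow_add[of n m, unfolded comp_def, THEN fun_cong, symmetric] add.commute[of n m])
  qed (simp add: s_def)
  have s0: "s 0 = (\<lambda>_. 0)" and sn: "0 \<le> s n \<omega>" for n \<omega> by (auto simp: s_def nonneg sum_nonneg)
  have "AE \<omega> in P. \<forall>k::nat. \<exists>C. \<forall>n. s n \<omega> \<le> (\<mu> + 1 / Suc k) * real n + C"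
    unfolding AE_all_countable s_def \<mu>_def
    by (intro allI birkhoff_eventually_le int nonneg) auto
  moreover have "AE \<omega> in P. \<forall>k::nat. \<exists>C. \<forall>n. (\<mu> - 1 / Suc k) * real n - C \<le> s n \<omega>"
    unfolding AE_all_countable
  proof (intro allI subadditive_eventually_ge[where \<gamma>=\<mu>])
    fix n show "s n \<in> borel_measurable P" unfolding s_def by measurable
    show "integrable P (s 1)" using int by (simp add: s_def[abs_def])
    show "\<mu> * n \<le> (\<integral>\<omega>. s n \<omega> \<partial>P)"
      using integrable_T_pow[OF int] by (simp add: s_def \<mu>_def Bochner_Integration.integral_sum)
  qed (auto simp: s_add s0 sn)
  ultimately have "AE \<omega> in P. (\<lambda>n. s n \<omega> / real n) \<longlonglongrightarrow> \<mu>"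
    by eventually_elim (rule tendsto_of_linear_bounds)
  then show ?thesis by (simp add: s_def \<mu>_def)
qed

text \<open>A single term is the difference of two consecutive Birkhoff sums, and their averages
  share the same finite limit.\<close>

lemma orbit_sublinear:
  fixes g :: "'a \<Rightarrow> real"
  assumes int: "integrable P g" and nonneg: "\<And>\<omega>. 0 \<le> g \<omega>"
  shows "AE \<omega> in P. (\<lambda>n. g ((T ^^ n) \<omega>) / real n) \<longlonglongrightarrow> 0"
  using birkhoff[OF assms]
proof eventually_elim
  case (elim \<omega>)
  define s where "s n = (\<Sum>i<n. g ((T ^^ i) \<omega>))" for n
  define \<mu> where "\<mu> = (\<integral>\<omega>. g \<omega> \<partial>P)"
  have s: "(\<lambda>n. s n / real n) \<longlonglongrightarrow> \<mu>" using elim by (simp add: s_def \<mu>_def)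
  have "(\<lambda>n. s (Suc n) / real (Suc n) * (real (Suc n) / real n) - s n / real n) \<longlonglongrightarrow> \<mu> * 1 - \<mu>"
  proof (intro tendsto_diff tendsto_mult s)
    show "(\<lambda>n. s (Suc n) / real (Suc n)) \<longlonglongrightarrow> \<mu>" using s by (rule LIMSEQ_Suc)
    show "(\<lambda>n. real (Suc n) / real n) \<longlonglongrightarrow> 1" by real_asymp
  qed
  moreover have "s (Suc n) / real (Suc n) * (real (Suc n) / real n) - s n / real n = g ((T ^^ n) \<omega>) / real n" for n
    by (simp add: s_def diff_divide_distrib[symmetric] del: of_nat_Suc)
  ultimately show ?case by simp
qed

theorem kingman:
  fixes f :: "nat \<Rightarrow> 'a \<Rightarrow> real"
  assumes f_meas [measurable]: "\<And>n. f n \<in> borel_measurable P"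
    and nonneg: "\<And>n \<omega>. 0 \<le> f n \<omega>"
    and f0: "f 0 = (\<lambda>_. 0)"
    and subadd: "\<And>m n \<omega>. \<omega> \<in> space P \<Longrightarrow> f (m + n) \<omega> \<le> f m \<omega> + f n ((T ^^ m) \<omega>)"
    and int1: "integrable P (f 1)"
  defines "\<gamma> \<equiv> (INF n\<in>{0<..}. (\<integral>\<omega>. f n \<omega> \<partial>P) / real n)"
  shows "AE \<omega> in P. (\<lambda>n. f n \<omega> / real n) \<longlonglongrightarrow> \<gamma>"
    and "(\<lambda>n. (\<integral>\<omega>. f n \<omega> \<partial>P) / real n) \<longlonglongrightarrow> \<gamma>"
    and "\<And>n. integrable P (f n)"
proof -
  have bound: "f n \<omega> \<le> (\<Sum>i<n. f 1 ((T ^^ i) \<omega>))" if "\<omega> \<in> space P" for n \<omega>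
    by (rule subadditive_sum_bound[OF f0 subadd that])
  show int: "integrable P (f n)" for n
  proof (rule Bochner_Integration.integrable_bound)
    show "integrable P (\<lambda>\<omega>. \<Sum>i<n. f 1 ((T ^^ i) \<omega>))"
      using integrable_T_pow(1)[OF int1] by auto
    show "AE \<omega> in P. norm (f n \<omega>) \<le> norm (\<Sum>i<n. f 1 ((T ^^ i) \<omega>))"
      using bound nonneg by (auto intro: order_trans[OF _ abs_ge_self])
  qed simp
  define e where "e n = (\<integral>\<omega>. f n \<omega> \<partial>P)" for n
  have e0: "0 \<le> e n" for n unfolding e_def by (intro integral_nonneg_AE) (auto simp: nonneg)
  have bdd: "bdd_below ((\<lambda>n. e n / real n) ` {0<..})" by (rule bdd_belowI[of _ 0]) (auto simp: e0)
  have \<gamma>_le: "\<gamma> * real n \<le> e n" if "0 < n" for n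
    using cINF_lower[OF bdd, of n] that by (auto simp: \<gamma>_def e_def field_simps)
  have \<gamma>_approx: "\<exists>m>0. e m < (\<gamma> + \<epsilon>) * real m" if "0 < \<epsilon>" for \<epsilon>
  proof -
    have "\<exists>m\<in>{0<..}. e m / real m < \<gamma> + \<epsilon>"
      using that by (subst cINF_less_iff[OF _ bdd, symmetric]) (auto simp: \<gamma>_def e_def)
    then show ?thesis by (auto simp: field_simps)
  qed
  have e_add: "e (m + n) \<le> e m + e n" for m n
  proof -
    have "e (m + n) \<le> (\<integral>\<omega>. f m \<omega> + f n ((T ^^ m) \<omega>) \<partial>P)" unfolding e_def
      by (rule integral_mono) (use int integrable_T_pow(1)[OF int] subadd in auto)
    then show ?thesis using int integrable_T_pow[OF int] by (simp add: e_def)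
  qed
  \<comment> \<open>Fekete's argument: division with remainder by an m whose mean is almost
    optimal.\<close>
  have e_lin: "\<exists>C. \<forall>n. e n \<le> (\<gamma> + \<epsilon>) * real n + C" if "0 < \<epsilon>" for \<epsilon>
  proof -
    obtain m where m: "m > 0" "e m < (\<gamma> + \<epsilon>) * real m" using \<gamma>_approx[OF \<open>0 < \<epsilon>\<close>] by blast
    have mult: "e (m * q) \<le> real q * e m" for q
    proof (induction q)
      case (Suc q)
      then show ?case using e_add[of m "m * q"] by (simp add: algebra_simps)
    qed (simp add: e_def f0)
    have pos: "0 \<le> \<gamma> + \<epsilon>" using m e0[of m] by (smt (verit) mult_nonpos_nonneg of_nat_0_le_iff)
    have "e n \<le> (\<gamma> + \<epsilon>) * real n + (\<Sum>r<m. e r)" for n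
    proof -
      have "e n \<le> e (m * (n div m)) + e (n mod m)" using e_add[of "m * (n div m)" "n mod m"] by simp
      also have "e (m * (n div m)) \<le> real (n div m) * ((\<gamma> + \<epsilon>) * real m)"
        using mult[of "n div m"] m by (meson less_imp_le mult_left_mono of_nat_0_le_iff order_trans)
      also have "real (n div m) * ((\<gamma> + \<epsilon>) * real m) = (\<gamma> + \<epsilon>) * real (n div m * m)" by simp
      also have "\<dots> \<le> (\<gamma> + \<epsilon>) * real n" using pos by (intro mult_left_mono) (simp_all del: of_nat_mult)
      also have "e (n mod m) \<le> (\<Sum>r<m. e r)" using m e0 by (intro member_le_sum) auto
      finally show ?thesis by simp
    qed
    then show ?thesis by blast
  qed
  show "(\<lambda>n. (\<integral>\<omega>. f n \<omega> \<partial>P) / real n) \<longlonglongrightarrow> \<gamma>"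
    unfolding e_def[symmetric]
  proof (rule tendsto_of_linear_bounds)
    show "\<forall>k::nat. \<exists>C. \<forall>n. e n \<le> (\<gamma> + 1 / Suc k) * real n + C" using e_lin by auto
    have "(\<gamma> - 1 / Suc k) * real n - 0 \<le> e n" for k n
    proof (cases "n = 0")
      case False
      then show ?thesis using \<gamma>_le[of n] by (simp add: algebra_simps) (smt (verit) divide_nonneg_nonneg of_nat_0_le_iff)
    qed (simp add: e0)
    then show "\<forall>k::nat. \<exists>C. \<forall>n. (\<gamma> - 1 / Suc k) * real n - C \<le> e n" by blast
  qed
  have lower: "AE \<omega> in P. \<forall>k::nat. \<exists>C. \<forall>n. (\<gamma> - 1 / Suc k) * real n - C \<le> f n \<omega>"
    unfolding AE_all_countable
    by (intro allI subadditive_eventually_ge[where \<gamma>=\<gamma>] f_meas nonneg f0 subadd int1)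
       (auto simp: \<gamma>_le[unfolded e_def])
  \<comment> \<open>Again division by an almost optimal m: the blocks are summed with Birkhoff's
    theorem for \<open>T ^^ m\<close>, and the remainder is handled by
    \<open>orbit_sublinear\<close>.\<close>
  have upper: "AE \<omega> in P. \<exists>C. \<forall>n. f n \<omega> \<le> (\<gamma> + \<epsilon>) * real n + C" if "0 < \<epsilon>" for \<epsilon>
  proof -
    obtain m where m: "m > 0" "e m < (\<gamma> + \<epsilon> / 2) * real m" using \<gamma>_approx[of "\<epsilon> / 2"] \<open>0 < \<epsilon>\<close> by auto
    interpret S: ergodic_map P "T ^^ m" by (rule ergodic_map_pow[OF m(1)])
    \<comment> \<open>\<open>h\<close> dominates \<open>f r\<close> for all remainders r < m at once
      and is integrable.\<close>
    define h where "h \<omega> = (\<Sum>j<m. f 1 ((T ^^ j) \<omega>))" for \<omega>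
    have h_int: "integrable P h" unfolding h_def using integrable_T_pow(1)[OF int1] by auto
    have h0: "0 \<le> h \<omega>" for \<omega> by (simp add: h_def sum_nonneg nonneg)
    have fr: "f r \<omega> \<le> h \<omega>" if "r < m" "\<omega> \<in> space P" for r \<omega>
      unfolding h_def by (rule order_trans[OF bound[OF that(2)] sum_mono2]) (use that nonneg in auto)
    have pos: "0 \<le> \<gamma> + \<epsilon> / 2" using m e0[of m] by (smt (verit) mult_nonpos_nonneg of_nat_0_le_iff)
    have pow: "((T ^^ m) ^^ q) \<omega> = (T ^^ (m * q)) \<omega>" for q \<omega>
      by (simp add: funpow_mult mult.commute)
    have mult: "f (m * q) \<omega> \<le> (\<Sum>i<q. f m (((T ^^ m) ^^ i) \<omega>))" if "\<omega> \<in> space P" for q \<omega>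
    proof (induction q)
      case (Suc q)
      then show ?case using subadd[OF that, of "m * q" m] by (simp add: pow add.commute)
    qed (simp add: f0)
    have "AE \<omega> in P. \<exists>C. \<forall>q. (\<Sum>i<q. f m (((T ^^ m) ^^ i) \<omega>)) \<le> ((\<gamma> + \<epsilon> / 2) * real m) * real q + C"
      using m by (intro S.birkhoff_eventually_le int nonneg) (simp add: e_def)
    moreover have "AE \<omega> in P. (\<lambda>n. h (((T ^^ m) ^^ n) \<omega>) / real n) \<longlonglongrightarrow> 0"
      by (rule S.orbit_sublinear[OF h_int h0])
    ultimately show ?thesis using AE_space
    proof eventually_elim
      case (elim \<omega>)
      obtain C where C: "\<And>q. (\<Sum>i<q. f m (((T ^^ m) ^^ i) \<omega>)) \<le> ((\<gamma> + \<epsilon> / 2) * real m) * real q + C"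
        using elim(1) by blast
      have "eventually (\<lambda>q. h (((T ^^ m) ^^ q) \<omega>) / real q < \<epsilon> / 2) sequentially"
        using elim(2) that by (intro order_tendstoD(2)) auto
      then obtain q0 where q0: "\<And>q. q0 \<le> q \<Longrightarrow> h (((T ^^ m) ^^ q) \<omega>) / real q < \<epsilon> / 2"
        by (auto simp: eventually_sequentially)
      define C' where "C' = (\<Sum>q\<le>q0. h (((T ^^ m) ^^ q) \<omega>))"
      have hq: "h (((T ^^ m) ^^ q) \<omega>) \<le> \<epsilon> / 2 * real q + C'" for q
      proof (cases "q \<le> q0")
        case True
        then have "h (((T ^^ m) ^^ q) \<omega>) \<le> C'" unfolding C'_def using h0 by (intro member_le_sum) auto
        moreover have "0 \<le> \<epsilon> / 2 * real q" using \<open>0 < \<epsilon>\<close> by simp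
        ultimately show ?thesis by linarith
      next
        case False
        then have "h (((T ^^ m) ^^ q) \<omega>) \<le> \<epsilon> / 2 * real q" using q0[of q] by (simp add: field_simps)
        moreover have "0 \<le> C'" unfolding C'_def by (simp add: h0 sum_nonneg)
        ultimately show ?thesis by linarith
      qed
      have "f n \<omega> \<le> (\<gamma> + \<epsilon>) * real n + (C + C')" for n
      proof -
        define q where "q = n div m"
        have mq: "m * q \<le> n" by (simp add: q_def)
        have "q \<le> m * q" using m by (cases m) auto
        from this mq have q: "q \<le> n" by (rule le_trans)
        have "f n \<omega> \<le> f (m * q) \<omega> + f (n mod m) ((T ^^ (m * q)) \<omega>)"
          using subadd[OF elim(3), of "m * q" "n mod m"] by (simp add: q_def)
        also have "f (n mod m) ((T ^^ (m * q)) \<omega>) \<le> h (((T ^^ m) ^^ q) \<omega>)"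
          unfolding pow using m T_pow_space[OF elim(3)] by (intro fr) auto
        also have "\<dots> \<le> \<epsilon> / 2 * real q + C'" by (rule hq)
        also have "\<epsilon> / 2 * real q \<le> \<epsilon> / 2 * real n" using q \<open>0 < \<epsilon>\<close> by (intro mult_left_mono) auto
        also have "f (m * q) \<omega> \<le> (\<gamma> + \<epsilon> / 2) * real (m * q) + C"
          using mult[OF elim(3), of q] C[of q] by (simp add: mult.assoc)
        also have "(\<gamma> + \<epsilon> / 2) * real (m * q) \<le> (\<gamma> + \<epsilon> / 2) * real n"
          using mq pos by (intro mult_left_mono) (simp_all del: of_nat_mult)
        finally show ?thesis by (simp add: algebra_simps)
      qed
      then show ?case by blast
    qed
  qed
  have "AE \<omega> in P. \<forall>k::nat. \<exists>C. \<forall>n. f n \<omega> \<le> (\<gamma> + 1 / Suc k) * real n + C"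
    unfolding AE_all_countable by (intro allI upper) auto
  with lower show "AE \<omega> in P. (\<lambda>n. f n \<omega> / real n) \<longlonglongrightarrow> \<gamma>"
    by eventually_elim (rule tendsto_of_linear_bounds)
qed

end

section \<open>Independent environments and mixing\<close>

definition depends_on :: "'i set \<Rightarrow> (('i \<Rightarrow> real) \<Rightarrow> 'b) \<Rightarrow> bool" where
  "depends_on A g \<longleftrightarrow> (\<forall>w w'. (\<forall>z\<in>A. w z = w' z) \<longrightarrow> g w = g w')"

lemma depends_onD: "depends_on A g \<Longrightarrow> (\<And>z. z \<in> A \<Longrightarrow> w z = w' z) \<Longrightarrow> g w = g w'"
  by (auto simp: depends_on_def)

definition translate :: "int ^ 'd \<Rightarrow> (int ^ 'd \<Rightarrow> real) \<Rightarrow> int ^ 'd \<Rightarrow> real" where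
  "translate t w = (\<lambda>z. w (z + t))"

lemma translate_translate: "translate s (translate t w) = translate (s + t) w"
  by (simp add: translate_def add.assoc)

lemma translate_0 [simp]: "translate 0 w = w"
  by (simp add: translate_def)

lemma translate_funpow: "translate x ^^ m = translate (int m *s x)"
proof (induction m)
  case (Suc m)
  have "x + int m *s x = int (Suc m) *s x" by (simp add: vec_eq_iff algebra_simps)
  then show ?case using Suc by (auto simp: translate_translate)
qed (simp add: fun_eq_iff)

locale iid_env =
  fixes \<nu> :: "real measure" and P :: "(int ^ 'd::finite \<Rightarrow> real) measure"
  assumes prob_space_\<nu>: "prob_space \<nu>" and sets_\<nu>: "sets \<nu> = sets borel"
    and P_eq: "P = Pi\<^sub>M UNIV (\<lambda>_. \<nu>)"
begin

sublocale prob_space P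
  unfolding P_eq by (intro prob_space_PiM prob_space_\<nu>)

lemma space_P [simp]: "space P = UNIV"
  using sets_eq_imp_space_eq[OF sets_\<nu>] by (simp add: P_eq space_PiM)

lemma sets_P [measurable_cong]: "sets P = sets (Pi\<^sub>M UNIV (\<lambda>_. borel))"
  unfolding P_eq by (intro sets_PiM_cong) (auto simp: sets_\<nu>)

lemma sets_Collect_P: "Measurable.pred P E \<Longrightarrow> {w. E w} \<in> sets P"
  by (drule predE) simp

lemma measurable_coord [measurable]: "(\<lambda>w. w z) \<in> borel_measurable P"
  by measurable

lemma measurable_into_P:
  assumes "\<And>z. (\<lambda>\<omega>. f \<omega> z) \<in> borel_measurable N"
  shows "f \<in> measurable N P"
proof -
  have "f \<in> measurable N (Pi\<^sub>M UNIV (\<lambda>_. borel))"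
    by (rule measurable_PiM_single') (use assms in auto)
  then show ?thesis by (simp cong: measurable_cong_sets add: sets_P)
qed

lemma distr_coord: "distr P borel (\<lambda>w. w z) = \<nu>"
proof -
  interpret product_prob_space "\<lambda>_. \<nu>" UNIV
    by (intro product_prob_spaceI prob_space_\<nu>)
  have "distr P borel (\<lambda>w. w z) = distr P \<nu> (\<lambda>w. w z)"
    by (intro distr_cong) (auto simp: sets_\<nu>)
  also have "\<dots> = \<nu>" unfolding P_eq by (rule PiM_component) auto
  finally show ?thesis .
qed

lemma indep_coords: "indep_vars (\<lambda>_. borel) (\<lambda>z w. w z) UNIV"
proof (subst indep_vars_iff_distr_eq_PiM)
  have "distr P (Pi\<^sub>M UNIV (\<lambda>_. borel)) (\<lambda>w. \<lambda>i\<in>UNIV. w i) = distr P P (\<lambda>w. w)"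
    by (intro distr_cong) (auto simp: sets_P)
  then show "distr P (Pi\<^sub>M UNIV (\<lambda>_. borel)) (\<lambda>w. \<lambda>i\<in>UNIV. w i) = Pi\<^sub>M UNIV (\<lambda>i. distr P borel (\<lambda>w. w i))"
    by (simp add: distr_coord distr_id2 P_eq[symmetric])
qed auto

section \<open>Independence of functions of disjoint sets of sites\<close>

lemma nn_integral_indep:
  fixes g h :: "(int ^ 'd \<Rightarrow> real) \<Rightarrow> ennreal"
  assumes g [measurable]: "g \<in> borel_measurable P" and h [measurable]: "h \<in> borel_measurable P"
    and dep: "depends_on A g" "depends_on B h" and disj: "A \<inter> B = {}"
  shows "(\<integral>\<^sup>+w. g w * h w \<partial>P) = (\<integral>\<^sup>+w. g w \<partial>P) * (\<integral>\<^sup>+w. h w \<partial>P)"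
proof -
  \<comment> \<open>Filling the sites outside A with 0 makes a function that depends on A only
    factor through the restriction to A.\<close>
  define ext where "ext A u = (\<lambda>z. if z \<in> A then u z else 0)" for A and u :: "int ^ 'd \<Rightarrow> real"
  have ext_meas: "ext A \<in> measurable (Pi\<^sub>M A (\<lambda>_. borel)) P" for A
  proof (rule measurable_into_P)
    fix z show "(\<lambda>u. ext A u z) \<in> borel_measurable (Pi\<^sub>M A (\<lambda>_. borel))"
      by (cases "z \<in> A") (auto simp: ext_def)
  qed
  have "indep_var (Pi\<^sub>M A (\<lambda>_. borel)) (\<lambda>w. restrict (\<lambda>z. w z) A) (Pi\<^sub>M B (\<lambda>_. borel)) (\<lambda>w. restrict (\<lambda>z. w z) B)"
    by (rule indep_var_restrict[OF indep_coords disj]) auto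
  then have "indep_var borel ((g \<circ> ext A) \<circ> (\<lambda>w. restrict (\<lambda>z. w z) A)) borel ((h \<circ> ext B) \<circ> (\<lambda>w. restrict (\<lambda>z. w z) B))"
    by (rule indep_var_compose) (auto intro: measurable_comp[OF ext_meas])
  moreover have "(g \<circ> ext A) \<circ> (\<lambda>w. restrict (\<lambda>z. w z) A) = g"
    by (rule ext) (auto simp: ext_def intro!: depends_onD[OF dep(1)])
  moreover have "(h \<circ> ext B) \<circ> (\<lambda>w. restrict (\<lambda>z. w z) B) = h"
    by (rule ext) (auto simp: ext_def intro!: depends_onD[OF dep(2)])
  ultimately have "indep_var borel g borel h" by simp
  then have "indep_vars (\<lambda>_. borel) (case_bool g h) UNIV"
    unfolding indep_var_def by (auto cong: indep_vars_cong simp: if_distrib split: bool.splits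
        elim!: indep_vars_cong[THEN iffD1, rotated -1])
  then have "(\<integral>\<^sup>+w. (\<Prod>b\<in>UNIV. case_bool g h b w) \<partial>P) = (\<Prod>b\<in>UNIV. \<integral>\<^sup>+w. case_bool g h b w \<partial>P)"
    by (intro indep_vars_nn_integral) auto
  then show ?thesis by (simp add: UNIV_bool mult.commute)
qed

lemma prob_indep:
  assumes [measurable]: "Measurable.pred P E" "Measurable.pred P F"
    and dep: "depends_on A E" "depends_on B F" and disj: "A \<inter> B = {}"
  shows "prob {w. E w \<and> F w} = prob {w. E w} * prob {w. F w}"
proof -
  have [measurable]: "{w. E w} \<in> sets P" "{w. F w} \<in> sets P" "{w. E w \<and> F w} \<in> sets P"
    using predE[OF assms(1)] predE[OF assms(2)] by (auto simp: Collect_conj_eq)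
  have "(\<integral>\<^sup>+w. indicator {w. E w} w * indicator {w. F w} w \<partial>P) = (\<integral>\<^sup>+w. indicator {w. E w \<and> F w} w \<partial>P)"
    by (intro nn_integral_cong) (auto simp: indicator_def)
  then have "emeasure P {w. E w \<and> F w} = (\<integral>\<^sup>+w. indicator {w. E w} w * indicator {w. F w} w \<partial>P)"
    by simp
  also have "\<dots> = emeasure P {w. E w} * emeasure P {w. F w}"
    using dep by (subst nn_integral_indep[OF _ _ _ _ disj]) (auto simp: depends_on_def indicator_def)
  finally show ?thesis by (simp add: emeasure_eq_measure ennreal_mult[symmetric])
qed

section \<open>Stationarity and mixing\<close>

lemma measurable_translate [measurable]: "translate t \<in> measurable P P"
  by (rule measurable_into_P) (simp add: translate_def)

lemma distr_translate: "distr P P (translate t) = P"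
proof -
  have "distr (Pi\<^sub>M UNIV (\<lambda>_::int ^ 'd. \<nu>)) (Pi\<^sub>M UNIV (\<lambda>_. \<nu>)) (\<lambda>\<omega>. \<lambda>n\<in>UNIV. \<omega> (n + t)) = Pi\<^sub>M UNIV (\<lambda>_. \<nu>)"
    by (rule distr_PiM_reindex[where f="\<lambda>z. z + t"]) (auto intro: prob_space_\<nu> simp: inj_on_def)
  then show ?thesis by (simp add: P_eq translate_def[abs_def] restrict_def)
qed

lemma distr_reflect: "distr P P (\<lambda>w z. w (- z)) = P"
proof -
  have "distr (Pi\<^sub>M UNIV (\<lambda>_::int ^ 'd. \<nu>)) (Pi\<^sub>M UNIV (\<lambda>_. \<nu>)) (\<lambda>\<omega>. \<lambda>n\<in>UNIV. \<omega> (- n)) = Pi\<^sub>M UNIV (\<lambda>_. \<nu>)"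
    by (rule distr_PiM_reindex[where f=uminus]) (auto intro: prob_space_\<nu> simp: inj_on_def)
  then show ?thesis by (simp add: P_eq restrict_def)
qed

lemma prob_translate:
  assumes "Measurable.pred P E"
  shows "prob {w. E (translate t w)} = prob {w. E w}"
proof -
  have E: "{w. E w} \<in> sets P" using predE[OF assms] by simp
  have "prob {w. E w} = measure (distr P P (translate t)) {w. E w}" by (simp add: distr_translate)
  also have "\<dots> = prob {w. E (translate t w)}" by (subst measure_distr[OF measurable_translate E]) (simp add: vimage_def)
  finally show ?thesis ..
qed

text \<open>In a coordinate where x does not vanish, the shift by nx eventually exceeds all
  differences between the two finite windows, which makes them disjoint.\<close>

lemma cylinder_mixing:
  assumes x: "x \<noteq> 0" and J: "finite J" "finite J'"
    and EF: "Measurable.pred P E" "Measurable.pred P F"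
    and dep: "depends_on J E" "depends_on J' F"
  shows "\<forall>\<^sub>F n in sequentially. prob {w. E w \<and> F (translate (int n *s x) w)} = prob {w. E w} * prob {w. F w}"
proof -
  obtain i where i: "x $ i \<noteq> 0" using x by (auto simp: vec_eq_iff)
  define m where "m = Max (insert 0 ((\<lambda>(j, j'). nat \<bar>j $ i - j' $ i\<bar>) ` (J \<times> J')))"
  have m: "nat \<bar>j $ i - j' $ i\<bar> \<le> m" if "j \<in> J" "j' \<in> J'" for j j'
    unfolding m_def using that J by (intro Max_ge) auto
  have "prob {w. E w \<and> F (translate (int n *s x) w)} = prob {w. E w} * prob {w. F w}" if n: "n \<ge> Suc m" for n
  proof -
    let ?J = "(\<lambda>z. z + int n *s x) ` J'"
    have "J \<inter> ?J = {}"
    proof (rule ccontr)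
      assume "J \<inter> ?J \<noteq> {}"
      then obtain j j' where j: "j \<in> J" "j' \<in> J'" "j = j' + int n *s x" by auto
      then have "\<bar>j $ i - j' $ i\<bar> = int n * \<bar>x $ i\<bar>" by (simp add: abs_mult)
      moreover have "int n * 1 \<le> int n * \<bar>x $ i\<bar>" using i by (intro mult_left_mono) auto
      ultimately show False using m[OF j(1,2)] n by linarith
    qed
    moreover have "depends_on ?J (\<lambda>w. F (translate (int n *s x) w))"
      unfolding depends_on_def by (auto intro!: depends_onD[OF dep(2)] simp: translate_def)
    ultimately have "prob {w. E w \<and> F (translate (int n *s x) w)} = prob {w. E w} * prob {w. F (translate (int n *s x) w)}"
      using EF dep(1) by (intro prob_indep) (auto intro: measurable_compose[OF measurable_translate])
    then show ?thesis using prob_translate[OF EF(2)] by simp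
  qed
  then show ?thesis by (auto simp: eventually_sequentially)
qed

lemma cylinder_generator:
  "\<exists>G. sets P = sigma_sets UNIV G \<and> Int_stable G \<and> G \<subseteq> Pow UNIV \<and>
    (\<forall>A\<in>G. A \<in> sets P \<and> (\<exists>J. finite J \<and> depends_on J (\<lambda>w. w \<in> A)))"
proof (intro exI[of _ "prod_algebra UNIV (\<lambda>_. borel)"] conjI ballI)
  show *: "sets P = sigma_sets UNIV (prod_algebra UNIV (\<lambda>_. borel))"
    by (simp add: sets_P sets_PiM)
  show "Int_stable (prod_algebra UNIV (\<lambda>_::int ^ 'd. borel :: real measure))" by (rule Int_stable_prod_algebra)
  fix A :: "(int ^ 'd \<Rightarrow> real) set" assume A: "A \<in> prod_algebra UNIV (\<lambda>_. borel)"
  then obtain J E where "A = prod_emb UNIV (\<lambda>_. borel) J (\<Pi>\<^sub>E j\<in>J. E j)" "finite J"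
    by (elim prod_algebraE) blast
  moreover from this have "depends_on J (\<lambda>w. w \<in> A)"
    unfolding depends_on_def by (auto simp: prod_emb_def PiE_iff)
  ultimately show "\<exists>J. finite J \<and> depends_on J (\<lambda>w. w \<in> A)" by blast
  show "A \<in> sets P" using A * by auto
qed simp

text \<open>The countable union step of the Dynkin arguments in \<open>mixing\<close>;
  \<open>prob (A i)\<close> is the summable majorant for Tannery's theorem.\<close>

lemma tendsto_prob_union:
  fixes A :: "nat \<Rightarrow> (int ^ 'd \<Rightarrow> real) set"
  assumes "disjoint_family A" "\<And>i. A i \<in> sets P" "\<And>i n. B i n \<in> sets P"
    and "\<And>i n. prob (B i n) \<le> prob (A i)" "\<And>n. disjoint_family (\<lambda>i. B i n)"
    and "\<And>i. (\<lambda>n. prob (B i n)) \<longlonglongrightarrow> prob (A i) * c"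
  shows "(\<lambda>n. prob (\<Union>i. B i n)) \<longlonglongrightarrow> prob (\<Union>i. A i) * c"
proof -
  have sumA: "(\<lambda>i. prob (A i)) sums prob (\<Union>i. A i)"
    using assms by (intro finite_measure_UNION) auto
  have sumB: "(\<lambda>i. prob (B i n)) sums prob (\<Union>i. B i n)" for n
    using assms by (intro finite_measure_UNION) auto
  have "\<forall>\<^sub>F (k, n) in at_top \<times>\<^sub>F sequentially. norm (prob (B k n)) \<le> prob (A k)"
    by (rule always_eventually) (use assms in auto)
  then have "(\<lambda>n. \<Sum>i. prob (B i n)) \<longlonglongrightarrow> (\<Sum>i. prob (A i) * c)"
    using tannerys_theorem[of "\<lambda>k n. prob (B k n)" "\<lambda>k. prob (A k) * c" sequentially "\<lambda>k. prob (A k)"] assms sumA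
    by (auto simp: sums_iff)
  then show ?thesis using sumA sumB by (simp add: sums_iff suminf_mult2[symmetric])
qed

text \<open>Distant cylinders are independent; one Dynkin argument in each of the two events extends
  this to all of them.\<close>

theorem mixing:
  assumes x: "x \<noteq> 0" and A: "A \<in> sets P" and B: "B \<in> sets P"
  shows "(\<lambda>n. prob {w \<in> A. translate (int n *s x) w \<in> B}) \<longlonglongrightarrow> prob A * prob B"
proof -
  obtain G where "sets P = sigma_sets UNIV G \<and> Int_stable G \<and> G \<subseteq> Pow UNIV \<and>
    (\<forall>A\<in>G. A \<in> sets P \<and> (\<exists>J. finite J \<and> depends_on J (\<lambda>w. w \<in> A)))"
    using cylinder_generator ..
  then have G: "sets P = sigma_sets UNIV G" "Int_stable G" "G \<subseteq> Pow UNIV"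
    "\<And>A. A \<in> G \<Longrightarrow> A \<in> sets P \<and> (\<exists>J. finite J \<and> depends_on J (\<lambda>w. w \<in> A))"
    by auto
  define M where "M A B \<longleftrightarrow> (\<lambda>n. prob {w \<in> A. translate (int n *s x) w \<in> B}) \<longlonglongrightarrow> prob A * prob B" for A B
  have [measurable]: "{w \<in> A. translate (int n *s x) w \<in> B} \<in> sets P" if "A \<in> sets P" "B \<in> sets P" for A B n
    using that by measurable
  have prob_pre: "prob {w. translate t w \<in> B} = prob B" if "B \<in> sets P" for B t
    using prob_translate[of "\<lambda>w. w \<in> B" t] that by (simp add: pred_def)
  have pre_sets: "{w. translate t w \<in> B} \<in> sets P" if "B \<in> sets P" for B t
    using measurable_sets[OF measurable_translate that, of t] by (simp add: vimage_def)
  have cyl: "M A B" if AB: "A \<in> G" "B \<in> G" for A B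
  proof -
    obtain J J' where J: "A \<in> sets P" "finite J" "depends_on J (\<lambda>w. w \<in> A)" "B \<in> sets P" "finite J'" "depends_on J' (\<lambda>w. w \<in> B)"
      using G(4)[OF AB(1)] G(4)[OF AB(2)] by blast
    have "\<forall>\<^sub>F n in sequentially. prob {w. w \<in> A \<and> translate (int n *s x) w \<in> B} = prob {w. w \<in> A} * prob {w. w \<in> B}"
      using J by (intro cylinder_mixing[OF x]) (auto simp: pred_def)
    then show ?thesis unfolding M_def by (intro tendsto_eventually) simp
  qed
  have half: "M A B" if "B \<in> G" "A \<in> sigma_sets UNIV G" for A B
    using G(2,3) that(2)
  proof (induction rule: sigma_sets_induct_disjoint)
    case (basic A)
    then show ?case using that(1) cyl by blast
  next
    case empty
    then show ?case by (simp add: M_def)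
  next
    case (compl A)
    have s: "A \<in> sets P" "B \<in> sets P" using compl that G by auto
    have "prob {w \<in> UNIV - A. translate (int n *s x) w \<in> B} = prob B - prob {w \<in> A. translate (int n *s x) w \<in> B}" for n
    proof -
      have "{w \<in> UNIV - A. translate (int n *s x) w \<in> B} = {w. translate (int n *s x) w \<in> B} - {w \<in> A. translate (int n *s x) w \<in> B}" by auto
      then show ?thesis using s pre_sets prob_pre by (simp add: finite_measure_Diff subset_eq)
    qed
    moreover have "(\<lambda>n. prob B - prob {w \<in> A. translate (int n *s x) w \<in> B}) \<longlonglongrightarrow> prob B - prob A * prob B"
      using compl unfolding M_def by (intro tendsto_intros)
    moreover have "prob (UNIV - A) = 1 - prob A" using prob_compl[OF s(1)] by simp
    ultimately show ?case by (simp only: M_def left_diff_distrib mult_1_left)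
  next
    case (union A)
    have s: "\<And>i. A i \<in> sets P" "B \<in> sets P" using union that G by auto
    have "(\<lambda>n. prob (\<Union>i. {w \<in> A i. translate (int n *s x) w \<in> B})) \<longlonglongrightarrow> prob (\<Union>i. A i) * prob B"
      using union s by (intro tendsto_prob_union) (auto simp: M_def disjoint_family_on_def intro!: finite_measure_mono)
    moreover have "(\<Union>i. {w \<in> A i. translate (int n *s x) w \<in> B}) = {w \<in> (\<Union>i. A i). translate (int n *s x) w \<in> B}" for n by auto
    ultimately show ?case by (simp add: M_def)
  qed
  have "M A B" if "B \<in> sigma_sets UNIV G"
    using G(2,3) that
  proof (induction rule: sigma_sets_induct_disjoint)
    case (basic B)
    then show ?case using half A G by auto
  next
    case empty
    then show ?case by (simp add: M_def)
  next
    case (compl B)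
    have s: "A \<in> sets P" "B \<in> sets P" using compl A G by auto
    have "prob {w \<in> A. translate (int n *s x) w \<in> UNIV - B} = prob A - prob {w \<in> A. translate (int n *s x) w \<in> B}" for n
    proof -
      have "{w \<in> A. translate (int n *s x) w \<in> UNIV - B} = A - {w \<in> A. translate (int n *s x) w \<in> B}" by auto
      then show ?thesis using s by (simp add: finite_measure_Diff subset_eq)
    qed
    moreover have "(\<lambda>n. prob A - prob {w \<in> A. translate (int n *s x) w \<in> B}) \<longlonglongrightarrow> prob A - prob A * prob B"
      using compl unfolding M_def by (intro tendsto_intros)
    moreover have "prob (UNIV - B) = 1 - prob B" using prob_compl[OF s(2)] by simp
    ultimately show ?case by (simp only: M_def right_diff_distrib mult_1_right)
  next
    case (union B)
    have s: "A \<in> sets P" "\<And>i. B i \<in> sets P" using union A G by auto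
    have "(\<lambda>n. prob (\<Union>i. {w \<in> A. translate (int n *s x) w \<in> B i})) \<longlonglongrightarrow> prob (\<Union>i. B i) * prob A"
    proof (rule tendsto_prob_union)
      fix i n show "prob {w \<in> A. translate (int n *s x) w \<in> B i} \<le> prob (B i)"
        unfolding prob_pre[OF s(2), of "int n *s x" i, symmetric]
        by (intro finite_measure_mono pre_sets s) auto
    qed (use union s in \<open>auto simp: M_def disjoint_family_on_def mult.commute\<close>)
    moreover have "(\<Union>i. {w \<in> A. translate (int n *s x) w \<in> B i}) = {w \<in> A. translate (int n *s x) w \<in> (\<Union>i. B i)}" for n by auto
    ultimately show ?case by (simp add: M_def mult.commute)
  qed
  then show ?thesis using B G(1) by (auto simp: M_def)
qed

text \<open>For an event that is forward stable under the m-th power, the mixing relation along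
  multiples of mx reads \<open>prob A = prob A * prob A\<close>.\<close>

lemma ergodic_translate:
  assumes "x \<noteq> 0"
  shows "ergodic_map P (translate x)"
proof (unfold_locales, fact measurable_translate, fact distr_translate)
  fix m :: nat and A assume m: "0 < m" and A: "A \<in> sets P" and inv: "\<And>\<omega>. \<omega> \<in> A \<Longrightarrow> (translate x ^^ m) \<omega> \<in> A"
  let ?y = "int m *s x"
  have y: "?y \<noteq> 0" using assms m by (auto simp: vec_eq_iff)
  have inv': "translate (int n *s ?y) w \<in> A" if "w \<in> A" for n w
  proof (induction n)
    case (Suc n)
    have "int (Suc n) *s ?y = ?y + int n *s ?y" by (simp add: vec_eq_iff algebra_simps)
    then show ?case using inv[OF Suc] by (simp add: translate_funpow translate_translate)
  qed (use that in simp)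
  have "{w \<in> A. translate (int n *s ?y) w \<in> A} = A" for n using inv' by auto
  then have "(\<lambda>n. prob A) \<longlonglongrightarrow> prob A * prob A" using mixing[OF y A A] by simp
  then have "prob A = prob A * prob A" by (simp add: tendsto_const_iff)
  then show "prob A = 0 \<or> prob A = 1" by auto
qed

end

section \<open>Hierarchy of obstacles\<close>

definition cube :: "int \<Rightarrow> int ^ 'd \<Rightarrow> (int ^ 'd) set" where
  "cube r y = {z. \<forall>i. \<bar>z $ i - y $ i\<bar> \<le> r}"

lemma cube_refl [simp]: "0 \<le> r \<Longrightarrow> y \<in> cube r y"
  by (simp add: cube_def)

lemma cube_sym: "z \<in> cube r y \<Longrightarrow> y \<in> cube r z"
  by (simp add: cube_def abs_minus_commute)

lemma cube_trans: "z \<in> cube r y \<Longrightarrow> y \<in> cube s x \<Longrightarrow> z \<in> cube (r + s) x"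
  unfolding cube_def mem_Collect_eq
proof
  fix i assume "\<forall>i. \<bar>z $ i - y $ i\<bar> \<le> r" "\<forall>i. \<bar>y $ i - x $ i\<bar> \<le> s"
  then have "\<bar>z $ i - y $ i\<bar> \<le> r" "\<bar>y $ i - x $ i\<bar> \<le> s" by auto
  then show "\<bar>z $ i - x $ i\<bar> \<le> r + s" by linarith
qed

lemma cube_mono: "r \<le> s \<Longrightarrow> cube r y \<subseteq> cube s y"
  by (auto simp: cube_def) (meson order_trans)

lemma cube_add: "z + t \<in> cube r (y + t) \<longleftrightarrow> z \<in> cube r y"
  by (simp add: cube_def)

lemma finite_cube: "finite (cube r (y :: int ^ 'd::finite))"
  and card_cube: "0 \<le> r \<Longrightarrow> card (cube r (y :: int ^ 'd::finite)) \<le> nat (2 * r + 1) ^ CARD('d)"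
proof -
  let ?F = "PiE UNIV (\<lambda>i. {y $ i - r..y $ i + r})"
  have sub: "cube r y \<subseteq> (\<lambda>f. \<chi> i. f i) ` ?F"
  proof
    fix z assume "z \<in> cube r y"
    then have "(\<lambda>i. z $ i) \<in> ?F" by (auto simp: cube_def abs_le_iff) (smt (verit))+
    then show "z \<in> (\<lambda>f. \<chi> i. f i) ` ?F" by (rule rev_image_eqI) (simp add: vec_eq_iff)
  qed
  have fin: "finite ?F" by (intro finite_PiE) auto
  show "finite (cube r y)" using sub fin by (meson finite_surj)
  assume r: "0 \<le> r"
  have "card (cube r y) \<le> card ?F"
    by (rule surj_card_le[OF fin sub])
  also have "\<dots> = nat (2 * r + 1) ^ CARD('d)"
    using r by (simp add: card_PiE)
  finally show "card (cube r y) \<le> nat (2 * r + 1) ^ CARD('d)" .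
qed

abbreviation scale :: "nat \<Rightarrow> int" where
  "scale k \<equiv> 16 ^ k"

text \<open>
  \<open>c\<close> is the set of closed sites. A site stands for the box of side \<open>scale k\<close> around it,
  but boxes may overlap, so that the construction is translation covariant. If \<open>y\<close> is not bad at level
  \<open>Suc k\<close>, its bad sites at level \<open>k\<close> are close together, hence most coordinate hyperplanes
  avoid them: their union is the spine, and the hub is a spine of hubs.
\<close>

primrec bad :: "(int ^ 'd \<Rightarrow> bool) \<Rightarrow> nat \<Rightarrow> int ^ 'd \<Rightarrow> bool" where
  "bad c 0 y \<longleftrightarrow> c y"
| "bad c (Suc k) y \<longleftrightarrow> (\<exists>z \<in> cube (15 * scale k) y. \<exists>z' \<in> cube (15 * scale k) y.
     bad c k z \<and> bad c k z' \<and> z' \<notin> cube (2 * scale k) z)"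

definition unobstructed :: "(int ^ 'd \<Rightarrow> bool) \<Rightarrow> nat \<Rightarrow> int ^ 'd \<Rightarrow> 'd \<Rightarrow> int \<Rightarrow> bool" where
  "unobstructed c k y i t \<longleftrightarrow> (\<forall>z \<in> cube (15 * scale k) y. bad c k z \<longrightarrow> z $ i \<noteq> t)"

definition spine :: "(int ^ 'd \<Rightarrow> bool) \<Rightarrow> nat \<Rightarrow> int ^ 'd \<Rightarrow> (int ^ 'd) set" where
  "spine c k y = {z \<in> cube (15 * scale k) y. \<exists>i. unobstructed c k y i (z $ i)}"

primrec hub :: "(int ^ 'd \<Rightarrow> bool) \<Rightarrow> nat \<Rightarrow> int ^ 'd \<Rightarrow> (int ^ 'd) set" where
  "hub c 0 y = {y}"
| "hub c (Suc k) y = (\<Union>z \<in> spine c k y. hub c k z)"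

text \<open>The radius \<open>2 * scale k\<close> serves two ends: it contains the first overshoot
  out of the cube of radius \<open>scale k\<close>, and it matches the separation in
  \<open>bad\<close>, so that clusters of bad sites miss a hyperplane through y.\<close>

definition clear :: "(int ^ 'd \<Rightarrow> bool) \<Rightarrow> nat \<Rightarrow> int ^ 'd \<Rightarrow> bool" where
  "clear c k y \<longleftrightarrow> (\<forall>z \<in> cube (2 * scale k) y. \<not> bad c k z)"

lemma scale_ge_1: "1 \<le> scale k"
  by simp

text \<open>The search radius \<open>15 * scale k\<close> and the radius \<open>scale k\<close> on
  which the lower level depends add up to \<open>scale (Suc k)\<close>.\<close>

lemma bad_cong: "(\<And>z. z \<in> cube (scale k) y \<Longrightarrow> c z = c' z) \<Longrightarrow> bad c k y = bad c' k y"
proof (induction k arbitrary: y)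
  case (Suc k)
  have "bad c k z = bad c' k z" if "z \<in> cube (15 * scale k) y" for z
  proof (rule Suc.IH)
    fix u assume "u \<in> cube (scale k) z"
    from cube_trans[OF this that] show "c u = c' u" by (intro Suc.prems) simp
  qed
  then show ?case by (metis bad.simps(2))
qed simp

lemma bad_add: "bad (\<lambda>z. c (z + t)) k y \<longleftrightarrow> bad c k (y + t)"
proof (induction k arbitrary: y)
  case (Suc k)
  have "bad c (Suc k) (y + t) \<longleftrightarrow> (\<exists>z. z + t \<in> cube (15 * scale k) (y + t) \<and> (\<exists>z'. z' + t \<in> cube (15 * scale k) (y + t) \<and>
     bad c k (z + t) \<and> bad c k (z' + t) \<and> z' + t \<notin> cube (2 * scale k) (z + t)))"
    unfolding bad.simps Bex_def by (metis diff_add_cancel)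
  then show ?case by (auto simp: Suc.IH cube_add Bex_def)
qed simp

lemma unobstructed_add: "unobstructed (\<lambda>z. c (z + t)) k y i s \<longleftrightarrow> unobstructed c k (y + t) i (s + t $ i)"
proof -
  have "unobstructed c k (y + t) i (s + t $ i) \<longleftrightarrow>
    (\<forall>z. z + t \<in> cube (15 * scale k) (y + t) \<longrightarrow> bad c k (z + t) \<longrightarrow> (z + t) $ i \<noteq> s + t $ i)"
    unfolding unobstructed_def Ball_def by (metis diff_add_cancel)
  then show ?thesis by (auto simp: unobstructed_def bad_add cube_add)
qed

lemma spine_add: "z \<in> spine (\<lambda>z. c (z + t)) k y \<longleftrightarrow> z + t \<in> spine c k (y + t)"
  by (simp add: spine_def unobstructed_add cube_add)

lemma hub_add: "u \<in> hub (\<lambda>z. c (z + t)) k y \<longleftrightarrow> u + t \<in> hub c k (y + t)"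
proof (induction k arbitrary: y)
  case 0
  show ?case by (simp)
next
  case (Suc k)
  have "u + t \<in> hub c (Suc k) (y + t) \<longleftrightarrow> (\<exists>z. z + t \<in> spine c k (y + t) \<and> u + t \<in> hub c k (z + t))"
    unfolding hub.simps UN_iff Bex_def by (metis diff_add_cancel)
  then show ?case by (auto simp: spine_add Suc.IH)
qed

lemma clear_add: "clear (\<lambda>z. c (z + t)) k y \<longleftrightarrow> clear c k (y + t)"
proof -
  have "clear c k (y + t) \<longleftrightarrow> (\<forall>z. z + t \<in> cube (2 * scale k) (y + t) \<longrightarrow> \<not> bad c k (z + t))"
    unfolding clear_def Ball_def by (metis diff_add_cancel)
  then show ?thesis by (auto simp: clear_def bad_add cube_add)
qed

lemma clear_not_bad: "clear c k y \<Longrightarrow> \<not> bad c k y"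
  by (simp add: clear_def)

lemma spine_good: "z \<in> spine c k y \<Longrightarrow> \<not> bad c k z"
  by (auto simp: spine_def unobstructed_def)

text \<open>If y is good, its bad sites lie within \<open>2 * scale k\<close> of any one of them and
  block at most \<open>4 * scale k + 1\<close> values of a coordinate. Two such windows, for y and
  for y', cannot fill the \<open>30 * scale k - 1\<close> values at hand.\<close>

lemma unobstructed_exists:
  assumes y: "\<not> bad c (Suc k) y" and y': "\<not> bad c (Suc k) y'" and near: "\<bar>y' $ i - y $ i\<bar> \<le> 1"
  obtains t where "\<bar>t - y $ i\<bar> \<le> 15 * scale k" "\<bar>t - y' $ i\<bar> \<le> 15 * scale k"
    "unobstructed c k y i t" "unobstructed c k y' i t"
proof -
  have cover: "\<exists>a. \<forall>t. \<not> unobstructed c k y i t \<longrightarrow> t \<in> {a - 2 * scale k..a + 2 * scale k}"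
    if "\<not> bad c (Suc k) y" for y
  proof (cases "\<exists>z \<in> cube (15 * scale k) y. bad c k z")
    case True
    then obtain z where z: "z \<in> cube (15 * scale k) y" "bad c k z" by blast
    have "t \<in> {z $ i - 2 * scale k..z $ i + 2 * scale k}" if t: "\<not> unobstructed c k y i t" for t
    proof -
      obtain z' where z': "z' \<in> cube (15 * scale k) y" "bad c k z'" "z' $ i = t"
        using t by (auto simp: unobstructed_def)
      then have "z' \<in> cube (2 * scale k) z" using z \<open>\<not> bad c (Suc k) y\<close> by auto
      then have "\<bar>z' $ i - z $ i\<bar> \<le> 2 * scale k" by (simp add: cube_def)
      then show ?thesis using z' by auto
    qed
    then show ?thesis by blast
  qed (auto simp: unobstructed_def)
  obtain a where a: "\<And>t. \<not> unobstructed c k y i t \<Longrightarrow> t \<in> {a - 2 * scale k..a + 2 * scale k}"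
    using cover[OF y] by blast
  obtain b where b: "\<And>t. \<not> unobstructed c k y' i t \<Longrightarrow> t \<in> {b - 2 * scale k..b + 2 * scale k}"
    using cover[OF y'] by blast
  let ?F = "{a - 2 * scale k..a + 2 * scale k} \<union> {b - 2 * scale k..b + 2 * scale k}"
  \<comment> \<open>Shortened by one at both ends, so that the value also lies within
    \<open>15 * scale k\<close> of \<open>y' $ i\<close>.\<close>
  let ?X = "{y $ i - (15 * scale k - 1)..y $ i + (15 * scale k - 1)}"
  have "card ?F \<le> card {a - 2 * scale k..a + 2 * scale k} + card {b - 2 * scale k..b + 2 * scale k}"
    by (rule card_Un_le)
  also have "\<dots> < card ?X"
  proof -
    have "nat (4 * s + 1) + nat (4 * s + 1) < nat (30 * s - 1)" if "1 \<le> s" for s :: int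
      using that by linarith
    from this[OF scale_ge_1[of k]] show ?thesis by simp
  qed
  finally have "\<not> ?X \<subseteq> ?F" using card_mono[of ?F ?X] by auto
  then obtain t where "t \<in> ?X" "t \<notin> ?F" by blast
  then show ?thesis using near a b by (intro that[of t]) (auto simp: abs_le_iff)
qed

section \<open>Cost of detours between hubs\<close>

definition override :: "'d set \<Rightarrow> int ^ 'd \<Rightarrow> int ^ 'd::finite \<Rightarrow> int ^ 'd" where
  "override J z z' = (\<chi> j. if j \<in> J then z' $ j else z $ j)"

text \<open>Both directions are recorded because the cost is not symmetric.\<close>

definition linked :: "('a \<Rightarrow> 'a \<Rightarrow> real) \<Rightarrow> 'a set \<Rightarrow> 'a set \<Rightarrow> real \<Rightarrow> bool" where
  "linked a A B m \<longleftrightarrow> (\<forall>u\<in>A. \<forall>v\<in>B. a u v \<le> m \<and> a v u \<le> m)"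

lemma linked_sym: "linked a A B m \<Longrightarrow> linked a B A m"
  by (simp add: linked_def)

lemma linked_mono: "linked a A B m \<Longrightarrow> m \<le> m' \<Longrightarrow> linked a A B m'"
  by (force simp: linked_def)

lemma linked_trans:
  assumes "\<And>x y z. a x z \<le> a x y + a y z" "linked a A B m" "linked a B C m'" "B \<noteq> {}"
  shows "linked a A C (m + m')"
proof -
  obtain b where b: "b \<in> B" using assms(4) by blast
  show ?thesis unfolding linked_def
  proof (intro ballI conjI)
    fix u v assume "u \<in> A" "v \<in> C"
    then show "a u v \<le> m + m'" "a v u \<le> m + m'"
      using assms(2,3) b assms(1)[where x=u and y=b and z=v] assms(1)[where x=v and y=b and z=u]
      unfolding linked_def by fastforce+
  qed
qed

text \<open>Equality is allowed: taking y' = y, the same statement bounds the costs inside one hub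
  and shows that it is nonempty.\<close>

definition axis_near :: "'d \<Rightarrow> int ^ 'd \<Rightarrow> int ^ 'd \<Rightarrow> bool" where
  "axis_near i y y' \<longleftrightarrow> (\<forall>j. j \<noteq> i \<longrightarrow> y' $ j = y $ j) \<and> \<bar>y' $ i - y $ i\<bar> \<le> 1"

text \<open>Hubs of consecutive good sites on a segment are chained. The summand 1 accounts for the
  empty segment, where two points of a single hub have to be linked.\<close>

lemma linked_line:
  fixes D :: real and t :: int
  assumes tri: "\<And>x y z. a x z \<le> a x y + a y z"
    and link: "\<And>y y' i. \<not> bad c k y \<Longrightarrow> \<not> bad c k y' \<Longrightarrow> axis_near i y y' \<Longrightarrow>
      hub c k y \<noteq> {} \<and> linked a (hub c k y) (hub c k y') D"
    and good: "\<And>s. min (z $ i) t \<le> s \<Longrightarrow> s \<le> max (z $ i) t \<Longrightarrow> \<not> bad c k (override {i} z (\<chi> j. s))"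
  shows "linked a (hub c k z) (hub c k (override {i} z (\<chi> j. t))) ((1 + real_of_int \<bar>t - z $ i\<bar>) * D)"
  using good
proof (induction "nat \<bar>t - z $ i\<bar>" arbitrary: t)
  case 0
  then have t: "t = z $ i" by simp
  then have "override {i} z (\<chi> j. t) = z" by (simp add: override_def vec_eq_iff)
  with t 0(2)[of t] link[of z z i] show ?case by (auto simp: axis_near_def)
next
  case (Suc n)
  define t' where "t' = (if z $ i < t then t - 1 else t + 1)"
  let ?p = "override {i} z (\<chi> j. t)" and ?p' = "override {i} z (\<chi> j. t')"
  have ne: "z $ i \<noteq> t" using Suc(2) by auto
  have n: "n = nat \<bar>t' - z $ i\<bar>" and abs: "\<bar>t - z $ i\<bar> = \<bar>t' - z $ i\<bar> + 1"
    using Suc(2) ne by (auto simp: t'_def)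
  have rng: "min (z $ i) t \<le> t'" "t' \<le> max (z $ i) t" using ne by (auto simp: t'_def)
  have "linked a (hub c k z) (hub c k ?p') ((1 + real_of_int \<bar>t' - z $ i\<bar>) * D)"
    using rng by (intro Suc(1)[OF n] Suc(3)) auto
  moreover have "axis_near i ?p' ?p" by (auto simp: axis_near_def override_def t'_def)
  then have "hub c k ?p' \<noteq> {} \<and> linked a (hub c k ?p') (hub c k ?p) D"
    using rng by (intro link Suc(3)) auto
  ultimately have "linked a (hub c k z) (hub c k ?p) ((1 + real_of_int \<bar>t' - z $ i\<bar>) * D + D)"
    using linked_trans[where a=a, OF tri] by blast
  then show ?case by (simp add: abs algebra_simps)
qed

text \<open>The coordinates in J are moved one after another. Each straight piece stays within r of
  y in these coordinates, hence has length at most 2r and meets no bad site.\<close>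

lemma linked_override:
  fixes y z o' :: "int ^ 'd::finite" and D :: real and r :: int
  assumes tri: "\<And>x y z. a x z \<le> a x y + a y z"
    and link: "\<And>y y' i. \<not> bad c k y \<Longrightarrow> \<not> bad c k y' \<Longrightarrow> axis_near i y y' \<Longrightarrow>
      hub c k y \<noteq> {} \<and> linked a (hub c k y) (hub c k y') D"
    and D: "0 \<le> D"
    and good: "\<And>p. (\<And>j. j \<in> J \<Longrightarrow> \<bar>p $ j - y $ j\<bar> \<le> r) \<Longrightarrow> (\<And>j. j \<notin> J \<Longrightarrow> p $ j = z $ j) \<Longrightarrow> \<not> bad c k p"
    and z: "\<And>j. j \<in> J \<Longrightarrow> \<bar>z $ j - y $ j\<bar> \<le> r" and o': "\<And>j. j \<in> J \<Longrightarrow> \<bar>o' $ j - y $ j\<bar> \<le> r"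
  shows "linked a (hub c k z) (hub c k (override J z o')) (D + card J * (1 + 2 * real_of_int r) * D)"
proof -
  have "finite J" by simp
  then have "I \<subseteq> J \<Longrightarrow> linked a (hub c k z) (hub c k (override I z o')) (D + card I * (1 + 2 * real_of_int r) * D)" for I
  proof (induction I rule: infinite_finite_induct)
    case empty
    have "override {} z o' = z" by (simp add: override_def vec_eq_iff)
    moreover have "\<not> bad c k z" using z by (intro good) auto
    ultimately show ?case using link[of z z undefined] by (auto simp: axis_near_def)
  next
    case (insert i I)
    let ?p = "override I z o'"
    have p': "override (insert i I) z o' = override {i} ?p (\<chi> j. o' $ i)"
      by (simp add: override_def vec_eq_iff)
    have i: "?p $ i = z $ i" using insert by (simp add: override_def)
    have goodp: "\<not> bad c k (override {i} ?p (\<chi> j. s))" if "\<bar>s - y $ i\<bar> \<le> r" for s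
      using insert.prems that z o' by (intro good) (auto simp: override_def)
    have zi: "\<bar>z $ i - y $ i\<bar> \<le> r" and oi: "\<bar>o' $ i - y $ i\<bar> \<le> r" using insert.prems z o' by auto
    have "linked a (hub c k ?p) (hub c k (override {i} ?p (\<chi> j. o' $ i))) ((1 + real_of_int \<bar>o' $ i - ?p $ i\<bar>) * D)"
    proof (rule linked_line[OF tri link])
      fix s assume "min (?p $ i) (o' $ i) \<le> s" "s \<le> max (?p $ i) (o' $ i)"
      then have "\<bar>s - y $ i\<bar> \<le> r" unfolding i using zi oi by linarith
      then show "\<not> bad c k (override {i} ?p (\<chi> j. s))" by (rule goodp)
    qed auto
    moreover have "(1 + real_of_int \<bar>o' $ i - ?p $ i\<bar>) * D \<le> (1 + 2 * real_of_int r) * D"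
    proof -
      have "\<bar>o' $ i - ?p $ i\<bar> \<le> 2 * r" unfolding i using zi oi by linarith
      then show ?thesis using D by (intro mult_right_mono) linarith+
    qed
    ultimately have "linked a (hub c k ?p) (hub c k (override (insert i I) z o')) ((1 + 2 * real_of_int r) * D)"
      unfolding p' by (rule linked_mono)
    moreover have "hub c k ?p \<noteq> {}"
    proof -
      have "override {i} ?p (\<chi> j. z $ i) = ?p" using i by (simp add: override_def vec_eq_iff) (metis i override_def vec_lambda_beta)
      then have "\<not> bad c k ?p" using goodp[OF zi] by simp
      then show ?thesis using link[of ?p ?p undefined] by (auto simp: axis_near_def)
    qed
    moreover have "linked a (hub c k z) (hub c k ?p) (D + card I * (1 + 2 * real_of_int r) * D)"
      using insert by auto
    ultimately have "linked a (hub c k z) (hub c k (override (insert i I) z o'))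
      ((D + card I * (1 + 2 * real_of_int r) * D) + (1 + 2 * real_of_int r) * D)"
      using linked_trans[where a=a, OF tri] by blast
    then show ?case using insert by (simp add: algebra_simps)
  qed auto
  then show ?thesis by blast
qed

text \<open>The cost of linking hubs in units of the cost of one open step. The factor 66 comes from
  the two halves of 33 each in \<open>hub_linked\<close>.\<close>

primrec detour :: "nat \<Rightarrow> nat \<Rightarrow> real" where
  "detour d 0 = 1"
| "detour d (Suc k) = 66 * real d * 16 ^ k * detour d k"

lemma detour_nonneg: "0 \<le> detour d k"
  by (induction k) auto

text \<open>Everything is joined through the hub of one site o' all of whose coordinates are
  unobstructed for both y and y'. A spine site z has one unobstructed coordinate j. First all other
  coordinates are moved within the hyperplane through z, then coordinate j; during the second move
  another coordinate already agrees with o' and keeps the path off the bad sites. This needs a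
  coordinate other than j, hence dimension at least 2.\<close>

theorem hub_linked:
  fixes y :: "int ^ 'd::finite" and \<kappa> :: real
  assumes dim: "2 \<le> CARD('d)"
    and tri: "\<And>x y z. a x z \<le> a x y + a y z"
    and base: "\<And>y y' i. \<not> c y \<Longrightarrow> \<not> c y' \<Longrightarrow> axis_near i y y' \<Longrightarrow> a y y' \<le> \<kappa>"
    and \<kappa>: "0 \<le> \<kappa>"
    and "\<not> bad c k y" "\<not> bad c k y'" "axis_near i y y'"
  shows "hub c k y \<noteq> {} \<and> linked a (hub c k y) (hub c k y') (\<kappa> * detour CARD('d) k)"
  using assms(5-)
proof (induction k arbitrary: y y' i)
  case 0
  have "axis_near i y' y" using 0(3) by (auto simp: axis_near_def abs_minus_commute)
  then show ?case using base 0 by (auto simp: linked_def)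
next
  case (Suc k)
  define D :: real where "D = \<kappa> * detour CARD('d) k"
  have D: "0 \<le> D" using \<kappa> detour_nonneg by (simp add: D_def)
  note link = Suc.IH[folded D_def]
  have near: "\<bar>y' $ m - y $ m\<bar> \<le> 1" for m
    using Suc.prems(3) by (cases "m = i") (auto simp: axis_near_def)
  have "\<forall>m. \<exists>t. \<bar>t - y $ m\<bar> \<le> 15 * scale k \<and> \<bar>t - y' $ m\<bar> \<le> 15 * scale k \<and>
    unobstructed c k y m t \<and> unobstructed c k y' m t"
    using unobstructed_exists[OF Suc.prems(1,2) near] by metis
  then obtain t where t: "\<And>m. \<bar>t m - y $ m\<bar> \<le> 15 * scale k \<and> \<bar>t m - y' $ m\<bar> \<le> 15 * scale k \<and>
    unobstructed c k y m (t m) \<and> unobstructed c k y' m (t m)" by metis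
  define o' where "o' = (\<chi> m. t m)"
  have half: "linked a (hub c k z) (hub c k o') (33 * CARD('d) * 16 ^ k * D)"
    if z: "z \<in> spine c k y" and o': "o' \<in> cube (15 * scale k) y" "\<And>m. unobstructed c k y m (o' $ m)" for z y
  proof -
    obtain j where j: "unobstructed c k y j (z $ j)" and zb: "z \<in> cube (15 * scale k) y"
      using z by (auto simp: spine_def)
    obtain m where m: "m \<noteq> j" using dim
      by (metis (full_types) UNIV_I card_1_singleton_iff card_le_Suc0_iff_eq finite not_less_eq_eq numeral_2_eq_2)
    have goodj: "\<not> bad c k p" if "p $ j = z $ j" "\<And>i. \<bar>p $ i - y $ i\<bar> \<le> 15 * scale k" for p
      using j that by (auto simp: unobstructed_def cube_def)
    have goodm: "\<not> bad c k p" if "p $ m = o' $ m" "\<And>i. \<bar>p $ i - y $ i\<bar> \<le> 15 * scale k" for p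
      using o'(2)[of m] that by (auto simp: unobstructed_def cube_def)
    have zb': "\<bar>z $ i - y $ i\<bar> \<le> 15 * scale k" and ob': "\<bar>o' $ i - y $ i\<bar> \<le> 15 * scale k" for i
      using zb o'(1) by (auto simp: cube_def)
    define p where "p = override (- {j}) z o'"
    have pj: "p $ j = z $ j" by (simp add: p_def override_def)
    have pb: "\<bar>p $ i - y $ i\<bar> \<le> 15 * scale k" for i using zb' ob' by (simp add: p_def override_def)
    have pm: "p $ i = o' $ i" if "i \<noteq> j" for i using that by (simp add: p_def override_def)
    have "linked a (hub c k z) (hub c k p) (D + card (- {j}) * (1 + 2 * real_of_int (15 * scale k)) * D)"
      unfolding p_def
    proof (rule linked_override[OF tri link D])
      fix q assume q: "\<And>i. i \<in> - {j} \<Longrightarrow> \<bar>q $ i - y $ i\<bar> \<le> 15 * scale k" "\<And>i. i \<notin> - {j} \<Longrightarrow> q $ i = z $ i"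
      have qj: "q $ j = z $ j" using q(2) by simp
      have "\<bar>q $ i - y $ i\<bar> \<le> 15 * scale k" for i using q(1)[of i] zb'[of i] qj by (cases "i = j") auto
      then show "\<not> bad c k q" using qj by (intro goodj) auto
    qed (use zb' ob' in auto)
    moreover have "linked a (hub c k p) (hub c k (override {j} p o')) (D + card {j} * (1 + 2 * real_of_int (15 * scale k)) * D)"
    proof (rule linked_override[OF tri link D])
      fix q assume q: "\<And>i. i \<in> {j} \<Longrightarrow> \<bar>q $ i - y $ i\<bar> \<le> 15 * scale k" "\<And>i. i \<notin> {j} \<Longrightarrow> q $ i = p $ i"
      have qm: "q $ m = o' $ m" using q(2)[of m] pm[OF m] m by simp
      have "\<bar>q $ i - y $ i\<bar> \<le> 15 * scale k" for i using q(1)[of i] q(2)[of i] pb[of i] by (cases "i = j") auto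
      then show "\<not> bad c k q" using qm by (intro goodm) auto
    qed (use pb ob' in auto)
    moreover have "override {j} p o' = o'" using pm by (auto simp: override_def vec_eq_iff)
    moreover have "hub c k p \<noteq> {}"
      using link[of p p undefined] goodj[OF pj pb] by (auto simp: axis_near_def)
    ultimately have L: "linked a (hub c k z) (hub c k o')
      ((D + card (- {j}) * (1 + 2 * real_of_int (15 * scale k)) * D) + (D + card {j} * (1 + 2 * real_of_int (15 * scale k)) * D))"
      using linked_trans[where a=a, OF tri] by metis
    have cardj: "real (card (- {j})) = real CARD('d) - 1"
      by (simp add: Compl_eq_Diff_UNIV card_Diff_singleton)
    \<comment> \<open>Two initial links and d straight pieces of length at most
      \<open>30 * 16 ^ k\<close>.\<close>
    have "(D + card (- {j}) * (1 + 2 * real_of_int (15 * scale k)) * D) + (D + card {j} * (1 + 2 * real_of_int (15 * scale k)) * D)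
      = 2 * D + CARD('d) * D + 30 * CARD('d) * (16 ^ k * D)"
      unfolding cardj by (simp add: algebra_simps)
    also have "\<dots> \<le> 33 * CARD('d) * 16 ^ k * D"
    proof -
      have 1: "1 * D \<le> 16 ^ k * D" using D by (intro mult_right_mono) auto
      have 2: "2 * (16 ^ k * D) \<le> CARD('d) * (16 ^ k * D)" using D dim by (intro mult_right_mono) auto
      have 3: "CARD('d) * D \<le> CARD('d) * (16 ^ k * D)" using 1 by (intro mult_left_mono) auto
      have "0 \<le> CARD('d) * (16 ^ k * D)" using D by simp
      moreover have "33 * CARD('d) * 16 ^ k * D = 33 * (CARD('d) * (16 ^ k * D))"
        and "30 * CARD('d) * (16 ^ k * D) = 30 * (CARD('d) * (16 ^ k * D))" by simp_all
      ultimately show ?thesis using 1 2 3 by linarith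
    qed
    finally show ?thesis using L linked_mono by blast
  qed
  have oy: "o' \<in> cube (15 * scale k) y" "\<And>m. unobstructed c k y m (o' $ m)"
    and oy': "o' \<in> cube (15 * scale k) y'" "\<And>m. unobstructed c k y' m (o' $ m)"
    using t by (auto simp: cube_def o'_def)
  have o_spine: "o' \<in> spine c k y" using oy by (auto simp: spine_def)
  have o_ne: "hub c k o' \<noteq> {}"
    using link[of o' o' undefined] spine_good[OF o_spine] by (auto simp: axis_near_def)
  have "linked a (hub c (Suc k) y) (hub c (Suc k) y') (33 * CARD('d) * 16 ^ k * D + 33 * CARD('d) * 16 ^ k * D)"
    unfolding linked_def
  proof (intro ballI)
    fix u v assume "u \<in> hub c (Suc k) y" "v \<in> hub c (Suc k) y'"
    then obtain z z' where "z \<in> spine c k y" "u \<in> hub c k z" "z' \<in> spine c k y'" "v \<in> hub c k z'"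
      by auto
    moreover from this have "linked a (hub c k z) (hub c k z') (33 * CARD('d) * 16 ^ k * D + 33 * CARD('d) * 16 ^ k * D)"
      using linked_trans[where a=a, OF tri half[OF _ oy] linked_sym[OF half[OF _ oy']] o_ne] by blast
    ultimately show "a u v \<le> 33 * CARD('d) * 16 ^ k * D + 33 * CARD('d) * 16 ^ k * D \<and>
      a v u \<le> 33 * CARD('d) * 16 ^ k * D + 33 * CARD('d) * 16 ^ k * D"
      by (auto simp: linked_def)
  qed
  moreover have "hub c (Suc k) y \<noteq> {}" using o_spine o_ne by auto
  ultimately show ?case by (simp add: D_def algebra_simps)
qed

text \<open>A site that is clear lies on its own spine. Otherwise every coordinate hyperplane
  through y would contain a bad site; these sites are within \<open>2 * scale k\<close> of each
  other, so any one of them is that close to y in every coordinate, against clearness.\<close>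

lemma hub_subset_Suc:
  assumes "clear c k y" "\<not> bad c (Suc k) y"
  shows "hub c k y \<subseteq> hub c (Suc k) y"
proof -
  have "\<exists>i. unobstructed c k y i (y $ i)"
  proof (rule ccontr)
    assume "\<not> ?thesis"
    then have "\<forall>i. \<exists>z. z \<in> cube (15 * scale k) y \<and> bad c k z \<and> z $ i = y $ i"
      by (auto simp: unobstructed_def)
    then obtain z where z: "\<And>i. z i \<in> cube (15 * scale k) y" "\<And>i. bad c k (z i)" "\<And>i. z i $ i = y $ i"
      by metis
    fix i0 :: 'a
    have "\<bar>z i0 $ i - y $ i\<bar> \<le> 2 * scale k" for i
    proof -
      have "z i \<in> cube (2 * scale k) (z i0)" using assms(2) z by auto
      then have "\<bar>z i $ i - z i0 $ i\<bar> \<le> 2 * scale k" by (simp add: cube_def)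
      then show ?thesis using z(3)[of i] by (simp add: abs_minus_commute)
    qed
    then have "z i0 \<in> cube (2 * scale k) y" by (simp add: cube_def)
    with assms(1) z(2) show False by (auto simp: clear_def)
  qed
  then have "y \<in> spine c k y" by (auto simp: spine_def)
  then show ?thesis by auto
qed

text \<open>An anchor chosen at one level thus remains in the hubs of all higher levels, so anchors
  with different levels can be compared at the larger one.\<close>

lemma hub_mono:
  assumes "\<And>j. n \<le> j \<Longrightarrow> clear c j y" "n \<le> k"
  shows "hub c n y \<subseteq> hub c k y"
  using assms(2)
proof (induction k rule: dec_induct)
  case (step k)
  then have "hub c k y \<subseteq> hub c (Suc k) y"
    using assms(1)[of k] clear_not_bad[OF assms(1)[of "Suc k"]] by (intro hub_subset_Suc) auto
  with step show ?case by blast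
qed simp

lemma self_in_hub:
  assumes "\<And>j. j < k \<Longrightarrow> clear c j u" "\<not> bad c k u"
  shows "u \<in> hub c k u"
  using assms
proof (induction k)
  case (Suc k)
  have "u \<in> hub c k u" using Suc by (intro Suc.IH) (auto dest: clear_not_bad)
  then show ?case using hub_subset_Suc[of c k u] Suc.prems by auto
qed simp

text \<open>Either the part of the path before it leaves a box of the smaller scale is itself obstructed at the
  smaller scale, or it passes near a bad box of that scale. This happens near \<open>p 0\<close> and again far
  from it, which yields two distant bad boxes.\<close>

theorem escape_obstructed:
  assumes steps: "\<And>i. p (Suc i) \<in> cube 1 (p i)"
    and exit: "p m \<notin> cube (scale k) (p 0)"
    and obst: "\<And>i. i \<le> m \<Longrightarrow> \<exists>j<k. \<not> clear c j (p i)"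
  shows "bad c k (p 0)"
  using assms
proof (induction k arbitrary: p m)
  case 0
  show ?case using 0(3)[of 0] by simp
next
  case (Suc k)
  \<comment> \<open>Steps have sup-norm at most 1, so at its first exit the path is still inside the
    cube enlarged by 1.\<close>
  have first_exit: "\<exists>m'. l \<le> m' \<and> m' \<le> m \<and> p m' \<notin> cube r (p l) \<and> (\<forall>i. l \<le> i \<longrightarrow> i \<le> m' \<longrightarrow> p i \<in> cube (r + 1) (p l))"
    if "l \<le> m" "p m \<notin> cube r (p l)" "0 \<le> r" for l r
  proof -
    define m' where "m' = (LEAST m'. l \<le> m' \<and> p m' \<notin> cube r (p l))"
    have lm: "l \<le> m \<and> p m \<notin> cube r (p l)" using that by simp
    have m': "l \<le> m' \<and> p m' \<notin> cube r (p l)" unfolding m'_def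
      using lm by (rule LeastI[where P="\<lambda>m'. l \<le> m' \<and> p m' \<notin> cube r (p l)"])
    have "m' \<le> m" unfolding m'_def using lm by (rule Least_le)
    have before: "p i \<in> cube r (p l)" if "l \<le> i" "i < m'" for i
      using not_less_Least[of i "\<lambda>m'. l \<le> m' \<and> p m' \<notin> cube r (p l)"] that by (auto simp: m'_def)
    have "m' \<noteq> l" using m' \<open>0 \<le> r\<close> by (metis cube_refl)
    then obtain n where n: "m' = Suc n" "l \<le> n" using m' by (cases m') auto
    have "p m' \<in> cube (1 + r) (p l)"
      unfolding n using cube_trans[OF Suc.prems(1) before[of n]] n by simp
    moreover have "p i \<in> cube (r + 1) (p l)" if "l \<le> i" "i < m'" for i
      using before[OF that] cube_mono[of r "r + 1"] by auto
    ultimately show ?thesis using m' \<open>m' \<le> m\<close> by (metis add.commute le_neq_implies_less)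
  qed
  \<comment> \<open>The two alternatives for the stretch up to the first exit. In the second, the
    bad site is \<open>2 * scale k\<close> from the path, which is within \<open>scale k + 1\<close>
    of \<open>p l\<close>; this makes less than \<open>4 * scale k\<close>.\<close>
  have find: "\<exists>z. bad c k z \<and> z \<in> cube (4 * scale k) (p l)"
    if l: "l \<le> m" "p m \<notin> cube (scale k) (p l)" for l
  proof -
    obtain m' where m': "l \<le> m'" "m' \<le> m" "p m' \<notin> cube (scale k) (p l)"
      "\<And>i. l \<le> i \<Longrightarrow> i \<le> m' \<Longrightarrow> p i \<in> cube (scale k + 1) (p l)"
      using first_exit[OF l] by auto
    show ?thesis
    proof (cases "\<forall>i. l \<le> i \<longrightarrow> i \<le> m' \<longrightarrow> (\<exists>j<k. \<not> clear c j (p i))")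
      case True
      have "bad c k ((\<lambda>i. p (l + i)) 0)"
        by (rule Suc.IH[where m="m' - l"]) (use Suc.prems(1) m' True in auto)
      then show ?thesis by (intro exI[of _ "p l"]) simp
    next
      case False
      then obtain i where i: "l \<le> i" "i \<le> m'" "\<And>j. j < k \<Longrightarrow> clear c j (p i)" by auto
      obtain j where j: "j < Suc k" "\<not> clear c j (p i)" using Suc.prems(3)[of i] i m' by auto
      then have "j = k" using i(3) by (metis less_Suc_eq)
      then obtain z where z: "z \<in> cube (2 * scale k) (p i)" "bad c k z" using j by (auto simp: clear_def)
      have "z \<in> cube (2 * scale k + (scale k + 1)) (p l)" using cube_trans[OF z(1) m'(4)[OF i(1,2)]] .
      moreover have "2 * scale k + (scale k + 1) \<le> 4 * scale k" using scale_ge_1[of k] by linarith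
      ultimately show ?thesis using z(2) cube_mono by blast
    qed
  qed
  have S1: "1 \<le> scale k" by (rule scale_ge_1)
  have far: "p m \<notin> cube (16 * scale k) (p 0)" using Suc.prems(2) by simp
  have le: "scale k \<le> 16 * scale k" "10 * scale k \<le> 16 * scale k" using S1 by linarith+
  from far have far': "p m \<notin> cube (10 * scale k) (p 0)" "p m \<notin> cube (scale k) (p 0)"
    using cube_mono[OF le(1)] cube_mono[OF le(2)] by blast+
  \<comment> \<open>The radius 10 is 4 + 2 + 4: bad sites within \<open>4 * scale k\<close> of
    \<open>p 0\<close> and of \<open>p m1\<close> are then more than \<open>2 * scale k\<close>
    apart. As 4 + 10 plus one step is at most 15, both are seen from \<open>p 0\<close>.\<close>
  then obtain m1 where m1: "m1 \<le> m" "p m1 \<notin> cube (10 * scale k) (p 0)" "p m1 \<in> cube (10 * scale k + 1) (p 0)"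
    using first_exit[of 0 "10 * scale k"] far'(1) by auto
  have "p m \<notin> cube (scale k) (p m1)"
  proof
    assume "p m \<in> cube (scale k) (p m1)"
    from cube_trans[OF this m1(3)] have "p m \<in> cube (scale k + (10 * scale k + 1)) (p 0)" .
    moreover have "scale k + (10 * scale k + 1) \<le> 16 * scale k" using S1 by linarith
    ultimately show False using far cube_mono by blast
  qed
  then obtain z' where z': "bad c k z'" "z' \<in> cube (4 * scale k) (p m1)" using find[OF m1(1)] by blast
  obtain z where z: "bad c k z" "z \<in> cube (4 * scale k) (p 0)"
    using find[of 0] far'(2) by blast
  have "z' \<notin> cube (2 * scale k) z"
  proof
    assume "z' \<in> cube (2 * scale k) z"
    from cube_trans[OF cube_trans[OF cube_sym[OF z'(2)] this] z(2)]
    have "p m1 \<in> cube (4 * scale k + 2 * scale k + 4 * scale k) (p 0)" .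
    then show False using m1(2) by simp
  qed
  moreover have "z \<in> cube (15 * scale k) (p 0)" using z(2) cube_mono[of "4 * scale k" "15 * scale k"] S1 by fastforce
  moreover have "z' \<in> cube (15 * scale k) (p 0)"
  proof -
    have "z' \<in> cube (4 * scale k + (10 * scale k + 1)) (p 0)" using cube_trans[OF z'(2) m1(3)] .
    moreover have "4 * scale k + (10 * scale k + 1) \<le> 15 * scale k" using S1 by linarith
    ultimately show ?thesis using cube_mono by blast
  qed
  ultimately show ?case using z(1) z'(1) by auto
qed

section \<open>Sparse closed sites\<close>

abbreviation closed_at :: "real \<Rightarrow> (int ^ 'd \<Rightarrow> real) \<Rightarrow> int ^ 'd \<Rightarrow> bool" where
  "closed_at K w \<equiv> (\<lambda>z. K < \<bar>w z\<bar>)"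

text \<open>The smallness condition is the case k = 0 of the induction in
  \<open>q_bound\<close>.\<close>

locale sparse_env = iid_env \<nu> P for \<nu> and P :: "(int ^ 'd::finite \<Rightarrow> real) measure" +
  fixes K :: real
  assumes dim: "2 \<le> CARD('d)" and K_nonneg: "0 \<le> K"
    and sparse: "(31 * 16) ^ (2 * CARD('d)) * prob {w. K < \<bar>w 0\<bar>} \<le> 1 / 2"
begin

definition bad_at :: "(int ^ 'd \<Rightarrow> real) \<Rightarrow> nat \<Rightarrow> int ^ 'd \<Rightarrow> bool" where
  "bad_at w k y = bad (closed_at K w) k y"
definition clear_at :: "(int ^ 'd \<Rightarrow> real) \<Rightarrow> nat \<Rightarrow> int ^ 'd \<Rightarrow> bool" where
  "clear_at w k y = clear (closed_at K w) k y"
definition hub_at :: "(int ^ 'd \<Rightarrow> real) \<Rightarrow> nat \<Rightarrow> int ^ 'd \<Rightarrow> (int ^ 'd) set" where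
  "hub_at w k y = hub (closed_at K w) k y"
text \<open>The least scale from which the origin is clear at every larger scale. It is meaningful
  for \<open>regular\<close> environments, which are almost all.\<close>

definition level :: "(int ^ 'd \<Rightarrow> real) \<Rightarrow> nat" where
  "level w = (LEAST n. \<forall>j\<ge>n. clear_at w j 0)"
definition regular :: "(int ^ 'd \<Rightarrow> real) \<Rightarrow> bool" where
  "regular w \<longleftrightarrow> (\<exists>n. \<forall>j\<ge>n. clear_at w j 0)"
text \<open>Taking the first hub site in an enumeration of the lattice makes the choice measurable.
  It is made at the origin and carried to other sites by translation, as Kingman's theorem needs
  covariance.\<close>

definition anchor0 :: "(int ^ 'd \<Rightarrow> real) \<Rightarrow> int ^ 'd" where
  "anchor0 w = from_nat (LEAST n. (from_nat n :: int ^ 'd) \<in> hub_at w (level w) 0)"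
definition anchor :: "(int ^ 'd \<Rightarrow> real) \<Rightarrow> int ^ 'd \<Rightarrow> int ^ 'd" where
  "anchor w y = y + anchor0 (translate y w)"

lemma bad_at_translate: "bad_at (translate t w) k y = bad_at w k (y + t)"
  using bad_add[of "closed_at K w" t k y] by (simp add: bad_at_def translate_def)

lemma clear_at_translate: "clear_at (translate t w) k y = clear_at w k (y + t)"
  using clear_add[of "closed_at K w" t k y] by (simp add: clear_at_def translate_def)

lemma hub_at_translate: "u \<in> hub_at (translate t w) k y \<longleftrightarrow> u + t \<in> hub_at w k (y + t)"
  using hub_add[of u "closed_at K w" t k y] by (simp add: hub_at_def translate_def)

lemma anchor_translate: "anchor (translate t w) y + t = anchor w (y + t)"
  by (simp add: anchor_def translate_translate algebra_simps)

lemma measurable_bad_at [measurable]: "Measurable.pred P (\<lambda>w. bad_at w k y)"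
  unfolding bad_at_def by (induction k arbitrary: y) (simp_all; measurable)+

lemma measurable_clear_at [measurable]: "Measurable.pred P (\<lambda>w. clear_at w k y)"
  unfolding clear_at_def clear_def bad_at_def[symmetric] by measurable

lemma measurable_hub_at [measurable]: "Measurable.pred P (\<lambda>w. u \<in> hub_at w k y)"
  unfolding hub_at_def
proof (induction k arbitrary: y)
  case (Suc k)
  note [measurable] = Suc
  have "(\<lambda>w. u \<in> hub (closed_at K w) (Suc k) y) = (\<lambda>w. \<exists>z. z \<in> cube (15 * scale k) y \<and>
    (\<exists>i. \<forall>z' \<in> cube (15 * scale k) y. bad_at w k z' \<longrightarrow> z' $ i \<noteq> z $ i) \<and> u \<in> hub (closed_at K w) k z)"
    by (auto simp: spine_def unobstructed_def bad_at_def)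
  then show ?case by simp
qed simp

lemma measurable_level [measurable]: "level \<in> measurable P (count_space UNIV)"
  unfolding level_def by measurable

lemma measurable_regular [measurable]: "Measurable.pred P regular"
  unfolding regular_def by measurable

lemma measurable_anchor0 [measurable]: "anchor0 \<in> measurable P (count_space UNIV)"
proof -
  have [measurable]: "Measurable.pred P (\<lambda>w. u \<in> hub_at w (level w) 0)" for u
    by (rule measurable_compose_countable[OF measurable_hub_at measurable_level])
  show ?thesis unfolding anchor0_def by measurable
qed

lemma measurable_anchor [measurable]: "(\<lambda>w. anchor w y) \<in> measurable P (count_space UNIV)"
  unfolding anchor_def by measurable

lemma measurable_cost_at [measurable]:
  assumes [measurable]: "f \<in> measurable P (count_space UNIV)" "g \<in> measurable P (count_space UNIV)"
  shows "(\<lambda>w. cost w (f w) (g w)) \<in> borel_measurable P"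
  by (rule measurable_compose_countable[OF _ assms(1), where f="\<lambda>u w. cost w u (g w)"],
      rule measurable_compose_countable[OF _ assms(2), where f="\<lambda>v w. cost w u v" for u]) measurable

section \<open>Decay of the probability of bad boxes\<close>

definition q :: "nat \<Rightarrow> real" where
  "q k = prob {w. bad_at w k 0}"

lemma prob_bad_at: "prob {w. bad_at w k y} = q k"
  using prob_translate[of "\<lambda>w. bad_at w k 0" y] by (simp add: q_def bad_at_translate)

lemma depends_bad_at: "depends_on (cube (scale k) y) (\<lambda>w. bad_at w k y)"
  unfolding depends_on_def bad_at_def by (auto intro!: bad_cong)

text \<open>A union bound over pairs of sites: bad events more than \<open>2 * scale k\<close> apart
  depend on disjoint cubes, and there are at most \<open>(31 * 16^k)^d\<close> candidates for each
  site.\<close>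

lemma q_Suc: "q (Suc k) \<le> (31 * 16 ^ k) ^ (2 * CARD('d)) * (q k)\<^sup>2"
proof -
  let ?B = "cube (15 * scale k) (0 :: int ^ 'd)"
  let ?I = "{(z, z') \<in> ?B \<times> ?B. z' \<notin> cube (2 * scale k) z}"
  have fin: "finite ?I" by (rule finite_subset[of _ "?B \<times> ?B"]) (auto simp: finite_cube)
  have [measurable]: "{w. bad_at w k z \<and> bad_at w k z'} \<in> sets P" for z z'
    by (rule sets_Collect_P) measurable
  have pair: "prob {w. bad_at w k z \<and> bad_at w k z'} = (q k)\<^sup>2" if z: "z' \<notin> cube (2 * scale k) z" for z z'
  proof -
    have "cube (scale k) z \<inter> cube (scale k) z' = {}"
    proof (rule ccontr)
      assume "cube (scale k) z \<inter> cube (scale k) z' \<noteq> {}"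
      then obtain u where "u \<in> cube (scale k) z" "u \<in> cube (scale k) z'" by auto
      from cube_trans[OF cube_sym[OF this(2)] this(1)] z show False by simp
    qed
    from prob_indep[OF _ _ depends_bad_at depends_bad_at this]
    show ?thesis by (simp add: prob_bad_at power2_eq_square)
  qed
  have "q (Suc k) \<le> prob (\<Union>p\<in>?I. {w. bad_at w k (fst p) \<and> bad_at w k (snd p)})"
    unfolding q_def
  proof (intro finite_measure_mono)
    show "(\<Union>p\<in>?I. {w. bad_at w k (fst p) \<and> bad_at w k (snd p)}) \<in> sets P"
      by (intro sets.finite_UN fin) measurable
    show "{w. bad_at w (Suc k) 0} \<subseteq> (\<Union>p\<in>?I. {w. bad_at w k (fst p) \<and> bad_at w k (snd p)})"
      by (auto simp: bad_at_def)
  qed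
  also have "\<dots> \<le> (\<Sum>p\<in>?I. prob {w. bad_at w k (fst p) \<and> bad_at w k (snd p)})"
    by (intro finite_measure_subadditive_finite fin) auto
  also have "\<dots> = (\<Sum>p\<in>?I. (q k)\<^sup>2)" by (intro sum.cong) (auto simp: pair)
  also have "\<dots> = card ?I * (q k)\<^sup>2" by simp
  also have "\<dots> \<le> (31 * 16 ^ k) ^ (2 * CARD('d)) * (q k)\<^sup>2"
  proof (rule mult_right_mono)
    have "nat (30 * scale k + 1) \<le> nat (31 * scale k)"
      using scale_ge_1[of k] by (intro nat_mono) linarith
    also have "\<dots> = 31 * 16 ^ k" by (simp add: nat_mult_distrib nat_power_eq)
    finally have n: "nat (30 * scale k + 1) \<le> 31 * 16 ^ k" .
    have "card ?B \<le> nat (30 * scale k + 1) ^ CARD('d)"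
      using card_cube[of "15 * scale k" "0 :: int ^ 'd"] by simp
    also have "\<dots> \<le> (31 * 16 ^ k) ^ CARD('d)" by (rule power_mono[OF n]) simp
    finally have cB: "card ?B \<le> (31 * 16 ^ k) ^ CARD('d)" .
    have "card ?I \<le> card (?B \<times> ?B)" by (intro card_mono) (auto simp: finite_cube)
    also have "\<dots> = card ?B * card ?B" by (rule card_cartesian_product)
    also have "\<dots> \<le> (31 * 16 ^ k) ^ CARD('d) * (31 * 16 ^ k) ^ CARD('d)"
      using mult_mono[OF cB cB] by simp
    finally have "card ?I \<le> (31 * 16 ^ k) ^ (2 * CARD('d))" by (simp only: mult_2 power_add power_Suc)
    then have "real (card ?I) \<le> real ((31 * 16 ^ k) ^ (2 * CARD('d)))" by (simp only: of_nat_le_iff)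
    then show "real (card ?I) \<le> (31 * 16 ^ k) ^ (2 * CARD('d))" by simp
  qed simp
  finally show ?thesis .
qed

lemma q_bound: "q k \<le> (1 / 2) ^ (2 ^ k)"
proof -
  \<comment> \<open>Chosen to satisfy \<open>M (Suc k) * (31 * 16^k)^(2d) = M k * M k\<close>, so
    that the bound on \<open>M k * q k\<close> is squared at each level.\<close>
  define M :: "nat \<Rightarrow> real" where "M k = (31 * 16 * 16 ^ k) ^ (2 * CARD('d))" for k
  have q0: "0 \<le> q k" for k by (simp add: q_def)
  have M1: "1 \<le> M k" for k
    unfolding M_def by (rule one_le_power) (smt (verit) one_le_power mult_le_cancel_left1)
  have "M k * q k \<le> (1 / 2) ^ (2 ^ k)"
  proof (induction k)
    case 0
    then show ?case using sparse by (simp add: M_def q_def bad_at_def)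
  next
    case (Suc k)
    have "M (Suc k) * q (Suc k) \<le> M (Suc k) * ((31 * 16 ^ k) ^ (2 * CARD('d)) * (q k)\<^sup>2)"
      using M1[of "Suc k"] by (intro mult_left_mono q_Suc) auto
    also have "\<dots> = (M (Suc k) * (31 * 16 ^ k) ^ (2 * CARD('d))) * (q k)\<^sup>2" by simp
    also have "M (Suc k) * (31 * 16 ^ k) ^ (2 * CARD('d)) = M k * M k"
      unfolding M_def power_mult_distrib[symmetric] by (rule arg_cong[where f="\<lambda>x. x ^ (2 * CARD('d))"]) simp
    also have "M k * M k * (q k)\<^sup>2 = (M k * q k)\<^sup>2" by (simp add: power2_eq_square)
    also have "\<dots> \<le> ((1 / 2) ^ (2 ^ k))\<^sup>2"
      using M1[of k] q0[of k] by (intro power_mono Suc) auto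
    finally show ?case by (simp add: power_mult[symmetric] mult.commute)
  qed
  moreover have "1 * q k \<le> M k * q k" using M1 q0 by (intro mult_right_mono)
  ultimately show ?thesis by simp
qed

definition h :: "nat \<Rightarrow> real" where
  "h k = (5 * 16 ^ k) ^ CARD('d) * (1 / 2 :: real) ^ (2 ^ k)"

lemma prob_not_clear: "prob {w. \<not> clear_at w k 0} \<le> h k"
proof -
  let ?B = "cube (2 * scale k) (0 :: int ^ 'd)"
  have "{w. \<not> clear_at w k 0} = (\<Union>z\<in>?B. {w. bad_at w k z})"
    by (auto simp: clear_at_def clear_def bad_at_def)
  then have "prob {w. \<not> clear_at w k 0} \<le> (\<Sum>z\<in>?B. prob {w. bad_at w k z})"
    by (simp only:) (intro finite_measure_subadditive_finite, auto simp: finite_cube intro!: sets_Collect_P)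
  also have "\<dots> = card ?B * q k" by (simp add: prob_bad_at)
  also have "\<dots> \<le> (5 * 16 ^ k) ^ CARD('d) * (1 / 2) ^ (2 ^ k)"
  proof (rule mult_mono)
    have "nat (4 * scale k + 1) \<le> nat (5 * scale k)"
      using scale_ge_1[of k] by (intro nat_mono) linarith
    also have "\<dots> = 5 * 16 ^ k" by (simp add: nat_mult_distrib nat_power_eq)
    finally have n: "nat (4 * scale k + 1) \<le> 5 * 16 ^ k" .
    have "card ?B \<le> nat (4 * scale k + 1) ^ CARD('d)"
      using card_cube[of "2 * scale k" "0 :: int ^ 'd"] by simp
    also have "\<dots> \<le> (5 * 16 ^ k) ^ CARD('d)" by (rule power_mono[OF n]) simp
    finally have "card ?B \<le> (5 * 16 ^ k) ^ CARD('d)" .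
    then have "real (card ?B) \<le> real ((5 * 16 ^ k) ^ CARD('d))" by (simp only: of_nat_le_iff)
    then show "real (card ?B) \<le> (5 * 16 ^ k) ^ CARD('d)" by simp
  qed (use q_bound in \<open>auto simp: q_def\<close>)
  finally show ?thesis by (simp add: h_def)
qed

text \<open>The ratio of consecutive terms is a constant times \<open>16^k * 2^(-2^k)\<close>, so
  the decay beats the detour factors and every power of the side. The factors are taken at
  \<open>Suc k\<close> because level \<open>Suc k\<close> forces the origin not to be clear at
  k.\<close>

lemma summable_h: "summable (\<lambda>k. detour CARD('d) (Suc k) * 16 ^ (m * Suc k) * h k)"
proof -
  define t where "t k = detour CARD('d) (Suc k) * 16 ^ (m * Suc k) * h k" for k
  define C where "C = 66 * real CARD('d) * 16 * 16 ^ m * 16 ^ CARD('d)"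
  have ratio: "t (Suc k) = C * 16 ^ k * (1 / 2) ^ (2 ^ k) * t k" for k
  proof -
    have 1: "(5 * 16 ^ Suc k) ^ CARD('d) = (16 :: real) ^ CARD('d) * (5 * 16 ^ k) ^ CARD('d)"
      by (subst power_mult_distrib[symmetric]) simp
    have 2: "(1 / 2 :: real) ^ (2 ^ Suc k) = (1 / 2) ^ (2 ^ k) * (1 / 2) ^ (2 ^ k)"
      by (simp only: mult_2 power_add power_Suc)
    have 3: "(16 :: real) ^ (m * Suc (Suc k)) = 16 ^ m * 16 ^ (m * Suc k)"
      by (simp add: power_add)
    have 4: "detour CARD('d) (Suc (Suc k)) = 66 * real CARD('d) * 16 * 16 ^ k * detour CARD('d) (Suc k)" by simp
    show ?thesis unfolding t_def h_def C_def 1 2 3 4 by (simp only: mult_ac)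
  qed
  have t0: "0 \<le> t k" for k by (simp add: t_def h_def detour_nonneg del: detour.simps)
  have "(\<lambda>k::nat. C * 16 ^ k * (1 / 2) ^ (2 ^ k)) \<longlonglongrightarrow> 0"
  proof -
    have "(\<lambda>k::nat. C * 16 ^ k * (1 / 2) ^ (2 ^ k)) = (\<lambda>k. C * exp (real k * ln 16 - 2 ^ k * ln 2))"
    proof
      fix k :: nat
      have "(16::real) ^ k = exp (real k * ln 16)" by (simp add: exp_of_nat_mult)
      moreover have "(1 / 2 :: real) ^ (2 ^ k) = exp (- (2 ^ k * ln 2))"
        using exp_of_nat_mult[of "2 ^ k" "ln (2::real)"] by (simp add: exp_minus power_divide inverse_eq_divide)
      ultimately show "C * 16 ^ k * (1 / 2) ^ (2 ^ k) = C * exp (real k * ln 16 - 2 ^ k * ln 2)"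
        by (simp add: exp_diff exp_minus field_simps)
    qed
    moreover have "(\<lambda>k::nat. exp (real k * ln 16 - 2 ^ k * ln 2)) \<longlonglongrightarrow> 0"
      by real_asymp
    ultimately show ?thesis by (simp add: tendsto_mult_right_zero)
  qed
  then have "eventually (\<lambda>k. C * 16 ^ k * (1 / 2) ^ (2 ^ k) < 1 / 2) sequentially"
    by (intro order_tendstoD(2)) auto
  then obtain N where N: "\<And>k. N \<le> k \<Longrightarrow> C * 16 ^ k * (1 / 2) ^ (2 ^ k) < 1 / 2"
    by (auto simp: eventually_sequentially)
  have "summable t"
  proof (rule summable_ratio_test[of "1 / 2" N])
    fix k assume "N \<le> k"
    then show "norm (t (Suc k)) \<le> 1 / 2 * norm (t k)"
      using t0[of k] t0[of "Suc k"] mult_right_mono[OF less_imp_le[OF N[of k]] t0[of k]] unfolding ratio by simp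
  qed simp
  then show ?thesis by (simp add: t_def[abs_def])
qed

lemma detour_ge_1: "1 \<le> detour CARD('d) k"
proof (induction k)
  case (Suc k)
  have "1 * 1 * 1 \<le> (66 * real CARD('d)) * 16 ^ k * detour CARD('d) k"
    using Suc dim by (intro mult_mono) auto
  then show ?case by simp
qed simp

lemma AE_regular: "AE w in P. regular w"
proof -
  have "summable (\<lambda>k. prob {w. \<not> clear_at w k 0})"
  proof (rule summable_comparison_test)
    show "summable (\<lambda>k. detour CARD('d) (Suc k) * 16 ^ (0 * Suc k) * h k)" by (rule summable_h)
    have "norm (prob {w. \<not> clear_at w k 0}) \<le> detour CARD('d) (Suc k) * 16 ^ (0 * Suc k) * h k" for k
    proof -
      have "1 * h k \<le> detour CARD('d) (Suc k) * h k"
        by (intro mult_right_mono detour_ge_1) (simp_all add: h_def del: detour.simps)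
      then show ?thesis using prob_not_clear[of k] by (simp del: detour.simps)
    qed
    then show "\<exists>N. \<forall>k\<ge>N. norm (prob {w. \<not> clear_at w k 0}) \<le> detour CARD('d) (Suc k) * 16 ^ (0 * Suc k) * h k" by blast
  qed
  then have "AE w in P. eventually (\<lambda>k. w \<in> space P - {w. \<not> clear_at w k 0}) sequentially"
    by (intro borel_cantelli_AE1) (auto simp: emeasure_eq_measure intro!: sets_Collect_P)
  then show ?thesis
    by eventually_elim (auto simp: regular_def eventually_sequentially)
qed

lemma AE_translate:
  assumes "AE w in P. E w" "Measurable.pred P E"
  shows "AE w in P. E (translate t w)"
  using assms AE_distrD[OF measurable_translate[of t], of E] unfolding distr_translate by blast

lemma level_clear:
  assumes "regular w" "level w \<le> j"
  shows "clear_at w j 0"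
proof -
  have "\<forall>j\<ge>level w. clear_at w j 0"
    using assms(1) unfolding level_def regular_def by (rule LeastI_ex)
  with assms(2) show ?thesis by blast
qed

lemma level_Suc_not_clear:
  assumes "regular w" "level w = Suc k"
  shows "\<not> clear_at w k 0"
proof
  assume c: "clear_at w k 0"
  have "\<forall>j\<ge>k. clear_at w j 0"
    using c level_clear[OF assms(1)] assms(2) by (metis le_antisym not_less_eq_eq)
  then have "level w \<le> k" unfolding level_def by (rule Least_le)
  with assms(2) show False by simp
qed

text \<open>Summation over the values of \<open>level\<close>; the value \<open>Suc k\<close> is
  charged to the event of not being clear at k, of probability at most \<open>h k\<close>.\<close>

lemma integrable_level: "integrable P (\<lambda>w. detour CARD('d) (level w) * 16 ^ (m * level w))"
proof (rule integrableI_nonneg)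
  define F where "F k = detour CARD('d) k * 16 ^ (m * k)" for k
  have F0: "0 \<le> F k" for k by (simp add: F_def detour_nonneg)
  have meas: "(\<lambda>w. F (level w)) \<in> borel_measurable P"
    by (rule measurable_compose[OF measurable_level]) simp
  have ind: "(\<lambda>w. indicator {w. \<not> clear_at w k 0} w :: ennreal) \<in> borel_measurable P" for k
    by measurable
  have "(\<integral>\<^sup>+w. ennreal (F (level w)) \<partial>P) \<le>
    (\<integral>\<^sup>+w. ennreal (F 0) + (\<Sum>k. ennreal (F (Suc k)) * indicator {w. \<not> clear_at w k 0} w) \<partial>P)"
  proof (rule nn_integral_mono_AE)
    show "AE w in P. ennreal (F (level w)) \<le>
      ennreal (F 0) + (\<Sum>k. ennreal (F (Suc k)) * indicator {w. \<not> clear_at w k 0} w)"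
      using AE_regular
    proof eventually_elim
      case (elim w)
      show ?case
      proof (cases "level w")
        case (Suc k)
        have "ennreal (F (level w)) = (\<Sum>i\<in>{k}. ennreal (F (Suc i)) * indicator {w. \<not> clear_at w i 0} w)"
          using level_Suc_not_clear[OF elim Suc] Suc by simp
        also have "\<dots> \<le> (\<Sum>i. ennreal (F (Suc i)) * indicator {w. \<not> clear_at w i 0} w)"
          by (intro sum_le_suminf) auto
        finally show ?thesis by (simp add: add_increasing)
      qed simp
    qed
  qed
  also have "\<dots> = ennreal (F 0) + (\<Sum>k. ennreal (F (Suc k)) * emeasure P {w. \<not> clear_at w k 0})"
    using ind by (subst nn_integral_add)
      (auto simp: nn_integral_suminf nn_integral_cmult nn_integral_indicator[OF sets_Collect_P] emeasure_space_1[unfolded space_P])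
  also have "\<dots> \<le> ennreal (F 0) + (\<Sum>k. ennreal (F (Suc k) * h k))"
    by (intro add_mono suminf_le)
       (auto simp: emeasure_eq_measure ennreal_mult'[symmetric] F0 intro!: ennreal_leI mult_left_mono prob_not_clear)
  also have "\<dots> = ennreal (F 0) + ennreal (\<Sum>k. F (Suc k) * h k)"
    using summable_h[of m] detour_nonneg[of "CARD('d)"]
    by (subst suminf_ennreal2) (auto simp: F_def h_def simp del: detour.simps)
  also have "\<dots> < \<infinity>" by simp
  finally show "(\<integral>\<^sup>+w. ennreal (detour CARD('d) (level w) * 16 ^ (m * level w)) \<partial>P) < \<infinity>" by (simp add: F_def)
  show "(\<lambda>w. detour CARD('d) (level w) * 16 ^ (m * level w)) \<in> borel_measurable P"
    using meas by (simp add: F_def)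
qed (simp add: detour_nonneg)

end

section \<open>Anchors\<close>

context sparse_env
begin

definition "\<kappa> = K + ln (card (nbrs :: (int ^ 'd) set))"

lemma ln_card_nbrs_nonneg: "0 \<le> ln (card (nbrs :: (int ^ 'd) set))"
  using card_nbrs_pos[where 'd='d] by (simp add: Suc_le_eq)

lemma \<kappa>_nonneg: "0 \<le> \<kappa>"
  using K_nonneg ln_card_nbrs_nonneg by (simp add: \<kappa>_def)

lemma cost_axis_near:
  fixes w :: "int ^ 'd \<Rightarrow> real"
  assumes "\<not> closed_at K w y" "axis_near i y y'"
  shows "cost w y y' \<le> \<kappa>"
proof (cases "y' = y")
  case True
  then show ?thesis using \<kappa>_nonneg by simp
next
  case False
  then have "y' $ i \<noteq> y $ i" using assms(2) by (auto simp: axis_near_def vec_eq_iff)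
  then have "y' $ i - y $ i = 1 \<or> y' $ i - y $ i = -1" using assms(2) by (auto simp: axis_near_def)
  then have "y' - y = axis i 1 \<or> y' - y = axis i (-1)"
    using assms(2) by (auto simp: axis_near_def vec_eq_iff axis_def)
  then have "y' - y \<in> nbrs" by (auto simp: axis_in_nbrs)
  from cost_adjacent[OF this, of w y] assms(1) show ?thesis by (simp add: \<kappa>_def)
qed

lemma hub_at_linked:
  assumes "\<not> bad_at w k y" "\<not> bad_at w k y'" "axis_near i y y'"
  shows "hub_at w k y \<noteq> {} \<and> linked (cost w) (hub_at w k y) (hub_at w k y') (\<kappa> * detour CARD('d) k)"
  unfolding hub_at_def
proof (rule hub_linked[where a="cost w", OF dim])
  show "cost w y y' \<le> \<kappa>" if "\<not> closed_at K w y" "axis_near i y y'" for y y' i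
    using that by (rule cost_axis_near)
qed (use assms cost_triangle \<kappa>_nonneg in \<open>simp_all add: bad_at_def\<close>)

lemma hub_at_nonempty: "\<not> bad_at w k y \<Longrightarrow> hub_at w k y \<noteq> {}"
  using hub_at_linked[of w k y y undefined] by (simp add: axis_near_def)

lemma clear_at_not_bad: "clear_at w k y \<Longrightarrow> \<not> bad_at w k y"
  by (simp add: clear_at_def bad_at_def clear_not_bad)

definition "hop k = 6 * real CARD('d) * 16 ^ k * (\<kappa> * detour CARD('d) k)"

lemma hop_nonneg: "0 \<le> hop k"
  by (simp add: hop_def \<kappa>_nonneg detour_nonneg)

text \<open>All sites within \<open>scale k + 1\<close> of a clear site are good at level k, so all
  coordinates may be moved freely; \<open>hop\<close> absorbs the constants of
  \<open>linked_override\<close>.\<close>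

lemma hub_at_cube_linked:
  assumes "clear_at w k y" "u \<in> cube (scale k + 1) y"
  shows "linked (cost w) (hub_at w k y) (hub_at w k u) (hop k)"
proof -
  define D where "D = \<kappa> * detour CARD('d) k"
  have D: "0 \<le> D" by (simp add: D_def \<kappa>_nonneg detour_nonneg)
  have "linked (cost w) (hub (closed_at K w) k y) (hub (closed_at K w) k (override UNIV y u))
    (D + card (UNIV :: 'd set) * (1 + 2 * real_of_int (scale k + 1)) * D)"
  proof (rule linked_override[where a="cost w", OF cost_triangle _ D])
    fix p assume "\<And>j. j \<in> UNIV \<Longrightarrow> \<bar>p $ j - y $ j\<bar> \<le> scale k + 1"
    then have "p \<in> cube (scale k + 1) y" by (simp add: cube_def)
    moreover have "scale k + 1 \<le> 2 * scale k" using scale_ge_1[of k] by linarith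
    ultimately have "p \<in> cube (2 * scale k) y" using cube_mono by blast
    then show "\<not> bad (closed_at K w) k p" using assms(1) by (auto simp: clear_at_def clear_def)
  qed (use assms(2) hub_at_linked[unfolded hub_at_def bad_at_def, of w k, folded D_def] in \<open>auto simp: cube_def\<close>)
  moreover have "override UNIV y u = u" by (simp add: override_def vec_eq_iff)
  moreover have "D + card (UNIV :: 'd set) * (1 + 2 * real_of_int (scale k + 1)) * D \<le> hop k"
  proof -
    have 1: "1 * D \<le> 16 ^ k * D" using D by (intro mult_right_mono) auto
    have d: "1 \<le> real CARD('d)" using dim by simp
    have 2: "1 * (16 ^ k * D) \<le> CARD('d) * (16 ^ k * D)" using D d by (intro mult_right_mono) auto
    have 3: "CARD('d) * D \<le> CARD('d) * (16 ^ k * D)" using 1 by (intro mult_left_mono) auto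
    have "D + card (UNIV :: 'd set) * (1 + 2 * real_of_int (scale k + 1)) * D =
      D + 3 * (CARD('d) * D) + 2 * (CARD('d) * (16 ^ k * D))" by (simp add: algebra_simps)
    moreover have "hop k = 6 * (CARD('d) * (16 ^ k * D))" by (simp add: hop_def D_def)
    ultimately show ?thesis using 1 2 3 by linarith
  qed
  ultimately show ?thesis unfolding hub_at_def by (simp only:) (erule linked_mono)
qed

lemma translate_clear: "regular (translate y w) \<Longrightarrow> level (translate y w) \<le> k \<Longrightarrow> clear_at w k y"
  using level_clear[of "translate y w" k] by (simp add: clear_at_translate)

lemma anchor_in_hub:
  assumes "regular (translate y w)" "level (translate y w) \<le> k"
  shows "anchor w y \<in> hub_at w k y"
proof -
  let ?w = "translate y w"
  have "hub_at ?w (level ?w) 0 \<noteq> {}"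
    by (intro hub_at_nonempty clear_at_not_bad level_clear assms(1)) simp
  then obtain u where "u \<in> hub_at ?w (level ?w) 0" by blast
  then have "\<exists>n. (from_nat n :: int ^ 'd) \<in> hub_at ?w (level ?w) 0"
    by (intro exI[of _ "to_nat u"]) simp
  then have "anchor0 ?w \<in> hub_at ?w (level ?w) 0" unfolding anchor0_def by (rule LeastI_ex)
  also have "\<dots> \<subseteq> hub_at ?w k 0"
    unfolding hub_at_def
    by (rule hub_mono[OF _ assms(2)]) (use level_clear[OF assms(1)] in \<open>simp add: clear_at_def\<close>)
  finally show ?thesis by (simp add: anchor_def hub_at_translate add.commute)
qed

text \<open>Both anchors lie in the hubs at the larger of the two levels, and those hubs are linked.
  No value of the potential at a closed site enters.\<close>

lemma anchor_step:
  assumes "regular (translate y w)" "regular (translate y' w)" "axis_near i y y'"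
  shows "cost w (anchor w y) (anchor w y') \<le>
    \<kappa> * (detour CARD('d) (level (translate y w)) + detour CARD('d) (level (translate y' w)))"
proof -
  define k where "k = max (level (translate y w)) (level (translate y' w))"
  have "linked (cost w) (hub_at w k y) (hub_at w k y') (\<kappa> * detour CARD('d) k)"
    using hub_at_linked[OF _ _ assms(3), of w k] translate_clear assms clear_at_not_bad k_def
    by (metis max.cobounded1 max.cobounded2)
  moreover have "anchor w y \<in> hub_at w k y" "anchor w y' \<in> hub_at w k y'"
    using assms by (auto intro!: anchor_in_hub simp: k_def)
  ultimately have "cost w (anchor w y) (anchor w y') \<le> \<kappa> * detour CARD('d) k"
    by (auto simp: linked_def)
  also have "detour CARD('d) k \<le> detour CARD('d) (level (translate y w)) + detour CARD('d) (level (translate y' w))"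
    using detour_nonneg by (simp add: k_def max_def)
  finally show ?thesis using \<kappa>_nonneg by (simp add: mult_left_mono)
qed

section \<open>Integrability of the costs between anchors\<close>

lemma integrable_translate:
  fixes g :: "(int ^ 'd \<Rightarrow> real) \<Rightarrow> real"
  assumes "integrable P g"
  shows "integrable P (\<lambda>w. g (translate t w))"
  using integrable_distr[OF measurable_translate[of t], of g] assms by (simp add: distr_translate)

lemma AE_regular_translate: "AE w in P. regular (translate y w)"
  by (rule AE_translate[OF AE_regular measurable_regular])

lemma integrable_anchor_cost: "integrable P (\<lambda>w. cost w (anchor w y) (anchor w y'))"
proof (induction "l1_dist y y'" arbitrary: y)
  case 0
  have "y = y'"
  proof (rule ccontr)
    assume "y \<noteq> y'"
    then obtain z i where "z = axis i 1 \<or> z = axis i (-1)" "l1_dist y y' = Suc (l1_dist (y + z) y')"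
      by (rule l1_dist_step)
    with 0 show False by simp
  qed
  then show ?case by simp
next
  case (Suc n)
  then have "y \<noteq> y'" by (auto simp: l1_dist_def)
  then obtain z i where z: "z = axis i 1 \<or> z = axis i (-1)" "l1_dist y y' = Suc (l1_dist (y + z) y')"
    by (rule l1_dist_step)
  have IH: "integrable P (\<lambda>w. cost w (anchor w (y + z)) (anchor w y'))" using Suc z(2) by simp
  have near: "axis_near i y (y + z)" using z(1) by (auto simp: axis_near_def axis_def)
  have det: "integrable P (\<lambda>w. detour CARD('d) (level (translate t w)))" for t
    using integrable_translate[OF integrable_level[of 0], of t] by simp
  show ?case
  proof (rule Bochner_Integration.integrable_bound)
    show "integrable P (\<lambda>w. \<kappa> * (detour CARD('d) (level (translate y w)) + detour CARD('d) (level (translate (y + z) w)))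
      + cost w (anchor w (y + z)) (anchor w y'))"
      using det IH by auto
    show "AE w in P. norm (cost w (anchor w y) (anchor w y')) \<le> norm (\<kappa> * (detour CARD('d) (level (translate y w))
      + detour CARD('d) (level (translate (y + z) w))) + cost w (anchor w (y + z)) (anchor w y'))"
      using AE_regular_translate[of y] AE_regular_translate[of "y + z"]
    proof eventually_elim
      case (elim w)
      have "cost w (anchor w y) (anchor w y') \<le> \<kappa> * (detour CARD('d) (level (translate y w))
      + detour CARD('d) (level (translate (y + z) w))) + cost w (anchor w (y + z)) (anchor w y')"
        using anchor_step[OF elim near] cost_triangle[of w "anchor w y" "anchor w y'" "anchor w (y + z)"] by simp
      then show ?case using cost_nonneg[of w "anchor w y" "anchor w y'"] by simp
    qed
  qed simp
qed

definition "anchor_cost x n w = cost w (anchor w 0) (anchor w (int n *s x))"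

definition "time_constant x = (INF n\<in>{0<..}. (\<integral>w. anchor_cost x n w \<partial>P) / real n)"

lemma cost_translate: "cost (translate t w) x y = cost w (x + t) (y + t)"
  unfolding translate_def by (rule cost_shift)

theorem anchor_cost_tendsto:
  assumes "x \<noteq> 0"
  shows "AE w in P. (\<lambda>n. anchor_cost x n w / real n) \<longlonglongrightarrow> time_constant x"
proof -
  interpret ergodic_map P "translate x" by (rule ergodic_translate[OF assms])
  show ?thesis unfolding time_constant_def
  proof (rule kingman(1))
    fix n show "anchor_cost x n \<in> borel_measurable P" unfolding anchor_cost_def by measurable
  next
    fix n w show "0 \<le> anchor_cost x n w" by (simp add: anchor_cost_def cost_nonneg)
  next
    show "anchor_cost x 0 = (\<lambda>_. 0)"
      by (auto simp: anchor_cost_def fun_eq_iff vector_scalar_mult_def vec_eq_iff zero_vec_def[symmetric])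
  next
    show "integrable P (anchor_cost x 1)"
      unfolding anchor_cost_def by (rule integrable_anchor_cost)
  next
    fix m n w
    let ?t = "int m *s x"
    have "anchor_cost x n ((translate x ^^ m) w) = cost w (anchor w ?t) (anchor w (int n *s x + ?t))"
      by (simp add: anchor_cost_def translate_funpow cost_translate anchor_translate)
    moreover have "int n *s x + ?t = int (m + n) *s x" by (simp add: vec_eq_iff algebra_simps)
    ultimately show "anchor_cost x (m + n) w \<le> anchor_cost x m w + anchor_cost x n ((translate x ^^ m) w)"
      using cost_triangle[of w "anchor w 0" "anchor w (int (m + n) *s x)" "anchor w ?t"]
      by (simp add: anchor_cost_def)
  qed
qed

section \<open>Favourable sites around a target\<close>

lemma self_in_hub_at:
  assumes "\<And>j. j < k \<Longrightarrow> clear_at w j u" "\<not> bad_at w k u"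
  shows "u \<in> hub_at w k u"
  using assms unfolding hub_at_def clear_at_def bad_at_def by (rule self_in_hub)

text \<open>A site that is clear at all levels below k and good at level k belongs to its own hub at
  level k, hence is itself cheaply linked to the hub of y.\<close>

lemma favourable_cost:
  assumes "clear_at w k y" "u \<in> cube (scale k + 1) y" "\<And>j. j < k \<Longrightarrow> clear_at w j u"
    and "v \<in> hub_at w k y"
  shows "cost w u v \<le> hop k" "cost w v u \<le> hop k"
proof -
  have "scale k + 1 \<le> 2 * scale k" using scale_ge_1[of k] by linarith
  then have "u \<in> cube (2 * scale k) y" using assms(2) cube_mono by blast
  then have "\<not> bad_at w k u" using assms(1) by (auto simp: clear_at_def clear_def bad_at_def)
  then have "u \<in> hub_at w k u" by (intro self_in_hub_at assms(3))
  then show "cost w u v \<le> hop k" "cost w v u \<le> hop k"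
    using hub_at_cube_linked[OF assms(1,2)] assms(4) by (auto simp: linked_def)
qed

text \<open>The contrapositive of \<open>escape_obstructed\<close>, applied to the path up to its
  first exit: without such a site, \<open>p 0\<close> would be bad at level k.\<close>

lemma path_meets_favourable:
  assumes clear: "clear_at w k (p 0)" and steps: "\<And>i. p (Suc i) \<in> cube 1 (p i)"
    and exit: "p m \<notin> cube (scale k) (p 0)"
  obtains i where "i \<le> m" "p i \<in> cube (scale k + 1) (p 0)" "\<And>j. j < k \<Longrightarrow> clear_at w j (p i)"
proof -
  define n where "n = (LEAST n. p n \<notin> cube (scale k) (p 0))"
  have n: "p n \<notin> cube (scale k) (p 0)" unfolding n_def using exit by (rule LeastI)
  have nm: "n \<le> m" unfolding n_def using exit by (rule Least_le)
  have inside: "p i \<in> cube (scale k) (p 0)" if "i < n" for i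
    using not_less_Least[of i "\<lambda>n. p n \<notin> cube (scale k) (p 0)"] that by (auto simp: n_def)
  have inside': "p i \<in> cube (scale k + 1) (p 0)" if "i \<le> n" for i
  proof (cases i)
    case (Suc i')
    then have "p i \<in> cube (1 + scale k) (p 0)"
      using cube_trans[OF steps inside[of i']] that by simp
    then show ?thesis by (simp add: add.commute)
  qed (use scale_ge_1[of k] in simp)
  have "\<exists>i\<le>n. \<forall>j<k. clear_at w j (p i)"
  proof (rule ccontr)
    assume "\<not> ?thesis"
    then have "bad (closed_at K w) k (p 0)"
      by (intro escape_obstructed[where p=p, OF steps n]) (auto simp: clear_at_def)
    with clear_at_not_bad[OF clear] show False by (simp add: bad_at_def)
  qed
  then show ?thesis using that inside' nm by (meson order_trans)
qed

text \<open>The favourable sites near y separate y from x. The walk therefore hits one of them, and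
  from there the anchor is reached at cost \<open>hop k\<close>. The other error term is the
  logarithm of the number of sites in the union bound.\<close>

theorem cost_ge_anchor:
  assumes reg: "regular (translate y w)" and far: "x \<notin> cube (scale (level (translate y w))) y"
  defines "k \<equiv> level (translate y w)"
  shows "cost w x (anchor w y) - (hop k + 5 * real CARD('d) * 16 ^ k) \<le> cost w x y"
proof -
  have clear: "clear_at w k y" using reg unfolding k_def by (intro translate_clear) auto
  define U where "U = {u \<in> cube (scale k + 1) y. \<forall>j<k. clear_at w j u}"
  have finU: "finite U" unfolding U_def by (rule finite_subset[OF _ finite_cube]) auto
  \<comment> \<open>The sites that x can reach by a path meeting U at its last site at most.\<close>
  define Q where "Q = {u. (\<lambda>a b. a \<notin> U \<and> b - a \<in> nbrs)\<^sup>*\<^sup>* x u}"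
  have "y \<notin> Q - U"
  proof
    assume "y \<in> Q - U"
    then have "(\<lambda>a b. a \<notin> U \<and> b - a \<in> nbrs)\<^sup>*\<^sup>* x y" "y \<notin> U" by (auto simp: Q_def)
    then obtain n where "((\<lambda>a b. a \<notin> U \<and> b - a \<in> nbrs) ^^ n) x y" by (auto simp: rtranclp_power)
    then obtain f where f: "f 0 = x" "f n = y" "\<And>i. i < n \<Longrightarrow> f i \<notin> U \<and> f (Suc i) - f i \<in> nbrs"
      by (auto simp: relpowp_fun_conv)
    \<comment> \<open>The path is reversed, since the escape argument runs outwards from y.\<close>
    define p where "p i = f (n - i)" for i
    have "p (Suc i) \<in> cube 1 (p i)" for i
    proof (cases "i < n")
      case True
      then have "p i - p (Suc i) \<in> nbrs" using f(3)[of "n - Suc i"] by (simp add: p_def Suc_diff_Suc)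
      then show ?thesis using nbrs_component[of "p i - p (Suc i)"] by (simp add: cube_def abs_minus_commute)
    qed (simp add: p_def)
    moreover have p0: "p 0 = y" by (simp add: p_def f)
    moreover have "p n \<notin> cube (scale k) (p 0)" using far f p0 by (simp add: p_def k_def)
    ultimately obtain i where i: "i \<le> n" "p i \<in> cube (scale k + 1) (p 0)" "\<And>j. j < k \<Longrightarrow> clear_at w j (p i)"
      using path_meets_favourable[of w k p n] clear by metis
    then have "p i \<in> U" by (simp add: U_def p0)
    moreover have "p i \<notin> U" using f \<open>y \<notin> U\<close> p0 i(1) by (cases "i = 0") (auto simp: p_def)
    ultimately show False by simp
  qed
  moreover have "x \<in> Q" by (simp add: Q_def)
  moreover have "u + z \<in> Q" if "u \<in> Q" "u \<notin> U" "z \<in> nbrs" for u z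
    using that unfolding Q_def by (auto intro: rtranclp.rtrancl_into_rtrancl)
  ultimately have "exp (- cost w x y) \<le> (\<Sum>u\<in>U. exp (- cost w x u))"
    unfolding exp_minus_cost by (intro green_e_separation[OF finU])
  also have "\<dots> \<le> (\<Sum>u\<in>U. exp (- (cost w x (anchor w y) - hop k)))"
  proof (rule sum_mono)
    fix u assume "u \<in> U"
    then have "cost w u (anchor w y) \<le> hop k"
      using anchor_in_hub[OF reg, of k] by (intro favourable_cost[OF clear]) (auto simp: U_def k_def)
    then show "exp (- cost w x u) \<le> exp (- (cost w x (anchor w y) - hop k))"
      using cost_triangle[of w x "anchor w y" u] by simp
  qed
  also have "\<dots> = card U * exp (- (cost w x (anchor w y) - hop k))" by simp
  \<comment> \<open>Crude, from \<open>card U <= (5 * 16^k)^d\<close> and \<open>t <= exp t\<close>;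
    it suffices because \<open>16 ^ level\<close> is integrable.\<close>
  also have "\<dots> \<le> exp (5 * real CARD('d) * 16 ^ k) * exp (- (cost w x (anchor w y) - hop k))"
  proof (rule mult_right_mono)
    have "card U \<le> card (cube (scale k + 1) y)" unfolding U_def by (intro card_mono) (auto simp: finite_cube)
    also have "\<dots> \<le> nat (2 * (scale k + 1) + 1) ^ CARD('d)" using scale_ge_1[of k] by (intro card_cube) simp
    also have "\<dots> \<le> (5 * 16 ^ k) ^ CARD('d)"
    proof (rule power_mono)
      have "2 * (s + 1) + 1 \<le> 5 * s" if "1 \<le> s" for s :: int using that by presburger
      from nat_mono[OF this[OF scale_ge_1[of k]]]
      have "nat (2 * (scale k + 1) + 1) \<le> nat (5 * scale k)" .
      then show "nat (2 * (scale k + 1) + 1) \<le> 5 * 16 ^ k" by (simp add: nat_mult_distrib nat_power_eq)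
    qed simp
    finally have "real (card U) \<le> real ((5 * 16 ^ k) ^ CARD('d))" by (simp only: of_nat_le_iff)
    also have "\<dots> = (5 * 16 ^ k) ^ CARD('d)" by simp
    also have "\<dots> \<le> exp (5 * 16 ^ k) ^ CARD('d)"
      by (intro power_mono order_trans[OF _ exp_ge_add_one_self]) simp_all
    also have "\<dots> = exp (real CARD('d) * (5 * 16 ^ k))" by (rule exp_of_nat_mult[symmetric])
    finally show "real (card U) \<le> exp (5 * real CARD('d) * 16 ^ k)" by (simp add: mult_ac)
  qed simp
  also have "\<dots> = exp (- (cost w x (anchor w y) - hop k - 5 * real CARD('d) * 16 ^ k))"
    by (simp add: exp_add[symmetric])
  finally show ?thesis by simp
qed

text \<open>The sum starts at s = 1 because the endpoint 0 is not charged.\<close>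

lemma cost_ray:
  fixes w :: "int ^ 'd \<Rightarrow> real"
  assumes "z \<in> nbrs"
  shows "cost w (int t *s z) 0 \<le> (\<Sum>s=1..t. \<bar>w (int s *s z)\<bar> + ln (card (nbrs :: (int ^ 'd) set)))"
proof (induction t)
  case 0
  have "int 0 *s z = 0" by (simp add: vec_eq_iff)
  then show ?case by simp
next
  case (Suc t)
  have "int (Suc t) *s z + - z = int t *s z" by (simp add: vec_eq_iff algebra_simps)
  then have "cost w (int (Suc t) *s z) (int t *s z) \<le> \<bar>w (int (Suc t) *s z)\<bar> + ln (card (nbrs :: (int ^ 'd) set))"
    using cost_adjacent[OF uminus_nbrs[OF assms], of w "int (Suc t) *s z"] by simp
  then show ?case using Suc cost_triangle[of w "int (Suc t) *s z" 0 "int t *s z"] by simp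
qed

text \<open>Going outwards from 0 along the ray in direction z, one leaves the cube within
  \<open>2 * 16^k\<close> steps and so meets a favourable site. Reach it from the anchor, then
  follow the ray inwards. As z is arbitrary, the cheapest of the disjoint rays may be used.\<close>

theorem cost_from_anchor:
  assumes reg: "regular w" and z: "z \<in> nbrs"
  shows "cost w (anchor w 0) 0 \<le> hop (level w) +
    (\<Sum>s=1..2 * 16 ^ level w. \<bar>w (int s *s z)\<bar> + ln (card (nbrs :: (int ^ 'd) set)))"
proof -
  define k where "k = level w"
  have clear: "clear_at w k 0" using level_clear[OF reg] by (simp add: k_def)
  define p where "p i = int i *s z" for i
  have p0: "p 0 = 0" by (simp add: p_def vec_eq_iff)
  have "p (Suc i) \<in> cube 1 (p i)" for i
    using nbrs_component[OF z] by (simp add: p_def cube_def algebra_simps)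
  moreover have "p (2 * 16 ^ k) \<notin> cube (scale k) (p 0)"
  proof -
    obtain i where "z $ i \<noteq> 0" using nbrs_neq_0[OF z] by (auto simp: vec_eq_iff)
    then have zi: "1 \<le> \<bar>z $ i\<bar>" by simp
    have "scale k < int (2 * 16 ^ k) * 1" using scale_ge_1[of k] by simp
    also have "\<dots> \<le> int (2 * 16 ^ k) * \<bar>z $ i\<bar>" using zi by (intro mult_left_mono) auto
    finally have "scale k < \<bar>p (2 * 16 ^ k) $ i - p 0 $ i\<bar>" by (simp add: p_def abs_mult)
    then show ?thesis by (auto simp: cube_def not_le)
  qed
  ultimately obtain i where i: "i \<le> 2 * 16 ^ k" "p i \<in> cube (scale k + 1) (p 0)" "\<And>j. j < k \<Longrightarrow> clear_at w j (p i)"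
    using path_meets_favourable[of w k p "2 * 16 ^ k"] clear p0 by metis
  have "anchor w 0 \<in> hub_at w k 0"
    using anchor_in_hub[of 0 w k] reg by (simp add: k_def)
  then have "cost w (anchor w 0) (p i) \<le> hop k"
    using i p0 by (intro favourable_cost[OF clear]) auto
  moreover have "cost w (p i) 0 \<le> (\<Sum>s=1..2 * 16 ^ k. \<bar>w (int s *s z)\<bar> + ln (card (nbrs :: (int ^ 'd) set)))"
    unfolding p_def by (rule order_trans[OF cost_ray[OF z]], rule sum_mono2) (use i ln_card_nbrs_nonneg in auto)
  ultimately show ?thesis using cost_triangle[of w "anchor w 0" 0 "p i"] by (simp add: k_def)
qed

end

section \<open>Limits of the costs between sites\<close>

lemma null_sandwich:
  fixes f g :: "nat \<Rightarrow> real"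
  assumes "\<And>n. 0 \<le> f n" "\<And>n. f n \<le> g n" "g \<longlonglongrightarrow> 0"
  shows "f \<longlonglongrightarrow> 0"
  by (rule tendsto_sandwich[OF always_eventually always_eventually tendsto_const assms(3)])
     (use assms in auto)

context prob_space
begin

section \<open>Convergence in probability to a constant\<close>

definition conv_prob :: "(nat \<Rightarrow> 'a \<Rightarrow> real) \<Rightarrow> real \<Rightarrow> bool" where
  "conv_prob X c \<longleftrightarrow> (\<forall>n. X n \<in> borel_measurable M) \<and>
     (\<forall>\<epsilon>>0. (\<lambda>n. prob {w \<in> space M. \<epsilon> < \<bar>X n w - c\<bar>}) \<longlonglongrightarrow> 0)"

lemma conv_probD: "conv_prob X c \<Longrightarrow> 0 < \<epsilon> \<Longrightarrow> (\<lambda>n. prob {w \<in> space M. \<epsilon> < \<bar>X n w - c\<bar>}) \<longlonglongrightarrow> 0"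
  by (simp add: conv_prob_def)

lemma conv_prob_measurable: "conv_prob X c \<Longrightarrow> X n \<in> borel_measurable M"
  by (simp add: conv_prob_def)

lemma conv_prob_AE:
  assumes [measurable]: "\<And>n. X n \<in> borel_measurable M"
    and "AE w in M. (\<lambda>n. X n w) \<longlonglongrightarrow> c"
  shows "conv_prob X c"
  unfolding conv_prob_def
proof (intro conjI allI impI)
  fix \<epsilon> :: real assume \<epsilon>: "0 < \<epsilon>"
  have "(\<lambda>n. \<integral>w. indicator {w \<in> space M. \<epsilon> < \<bar>X n w - c\<bar>} w \<partial>M) \<longlonglongrightarrow> (\<integral>w. (0::real) \<partial>M)"
  proof (rule integral_dominated_convergence[where w="\<lambda>_. 1"])
    show "AE w in M. (\<lambda>n. indicat_real {w \<in> space M. \<epsilon> < \<bar>X n w - c\<bar>} w) \<longlonglongrightarrow> 0"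
      using assms(2)
    proof eventually_elim
      case (elim w)
      have "eventually (\<lambda>n. dist (X n w) c < \<epsilon>) sequentially" using elim \<epsilon> by (rule tendstoD)
      then have "eventually (\<lambda>n. indicat_real {w \<in> space M. \<epsilon> < \<bar>X n w - c\<bar>} w = 0) sequentially"
        by eventually_elim (auto simp: dist_real_def)
      then show ?case by (rule tendsto_eventually)
    qed
  qed (auto simp: indicator_def)
  then show "(\<lambda>n. prob {w \<in> space M. \<epsilon> < \<bar>X n w - c\<bar>}) \<longlonglongrightarrow> 0" by simp
qed simp

lemma conv_prob_add:
  assumes X: "conv_prob X a" and Y: "conv_prob Y b"
  shows "conv_prob (\<lambda>n w. X n w + Y n w) (a + b)"
  unfolding conv_prob_def
proof (intro conjI allI impI)
  note [measurable] = conv_prob_measurable[OF X] conv_prob_measurable[OF Y]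
  show "(\<lambda>w. X n w + Y n w) \<in> borel_measurable M" for n by measurable
  fix \<epsilon> :: real assume \<epsilon>: "0 < \<epsilon>"
  have "(\<lambda>n. prob {w \<in> space M. \<epsilon> / 2 < \<bar>X n w - a\<bar>} + prob {w \<in> space M. \<epsilon> / 2 < \<bar>Y n w - b\<bar>}) \<longlonglongrightarrow> 0 + 0"
    using \<epsilon> by (intro tendsto_add conv_probD X Y) auto
  moreover have "prob {w \<in> space M. \<epsilon> < \<bar>X n w + Y n w - (a + b)\<bar>} \<le>
    prob {w \<in> space M. \<epsilon> / 2 < \<bar>X n w - a\<bar>} + prob {w \<in> space M. \<epsilon> / 2 < \<bar>Y n w - b\<bar>}" for n
  proof -
    have "prob {w \<in> space M. \<epsilon> < \<bar>X n w + Y n w - (a + b)\<bar>} \<le>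
      prob ({w \<in> space M. \<epsilon> / 2 < \<bar>X n w - a\<bar>} \<union> {w \<in> space M. \<epsilon> / 2 < \<bar>Y n w - b\<bar>})"
      by (intro finite_measure_mono) (auto simp: abs_if field_simps split: if_splits)
    also have "\<dots> \<le> prob {w \<in> space M. \<epsilon> / 2 < \<bar>X n w - a\<bar>} + prob {w \<in> space M. \<epsilon> / 2 < \<bar>Y n w - b\<bar>}"
      by (intro measure_Un_le) auto
    finally show ?thesis .
  qed
  ultimately show "(\<lambda>n. prob {w \<in> space M. \<epsilon> < \<bar>X n w + Y n w - (a + b)\<bar>}) \<longlonglongrightarrow> 0"
    by (intro null_sandwich[OF measure_nonneg]) simp_all
qed

lemma conv_prob_le:
  assumes X: "conv_prob X a" and Y: "conv_prob Y b"
    and le: "\<And>n. 0 < n \<Longrightarrow> AE w in M. X n w \<le> Y n w"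
  shows "a \<le> b"
proof (rule ccontr)
  assume "\<not> a \<le> b"
  define \<epsilon> where "\<epsilon> = (a - b) / 4"
  have \<epsilon>: "0 < \<epsilon>" using \<open>\<not> a \<le> b\<close> by (simp add: \<epsilon>_def)
  note [measurable] = conv_prob_measurable[OF X] conv_prob_measurable[OF Y]
  have "eventually (\<lambda>n. prob {w \<in> space M. \<epsilon> < \<bar>X n w - a\<bar>} < 1 / 2) sequentially"
    "eventually (\<lambda>n. prob {w \<in> space M. \<epsilon> < \<bar>Y n w - b\<bar>} < 1 / 2) sequentially"
    by (rule order_tendstoD(2)[OF conv_probD[OF X \<epsilon>]], simp) (rule order_tendstoD(2)[OF conv_probD[OF Y \<epsilon>]], simp)
  from eventually_conj[OF this] eventually_gt_at_top[of 0]
  have "eventually (\<lambda>n. 0 < n \<and> prob {w \<in> space M. \<epsilon> < \<bar>X n w - a\<bar>} < 1 / 2 \<and>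
    prob {w \<in> space M. \<epsilon> < \<bar>Y n w - b\<bar>} < 1 / 2) sequentially"
    by eventually_elim auto
  then obtain n where n: "0 < n" "prob {w \<in> space M. \<epsilon> < \<bar>X n w - a\<bar>} < 1 / 2"
    "prob {w \<in> space M. \<epsilon> < \<bar>Y n w - b\<bar>} < 1 / 2" by (auto simp: eventually_sequentially)
  have "1 = prob (space M)" by (simp add: prob_space)
  also have "\<dots> \<le> prob ({w \<in> space M. \<epsilon> < \<bar>X n w - a\<bar>} \<union> {w \<in> space M. \<epsilon> < \<bar>Y n w - b\<bar>})"
  proof (rule finite_measure_mono_AE)
    show "AE w in M. w \<in> space M \<longrightarrow> w \<in> {w \<in> space M. \<epsilon> < \<bar>X n w - a\<bar>} \<union> {w \<in> space M. \<epsilon> < \<bar>Y n w - b\<bar>}"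
      using le[OF n(1)]
    proof eventually_elim
      case (elim w)
      have "\<epsilon> < \<bar>X n w - a\<bar> \<or> \<epsilon> < \<bar>Y n w - b\<bar>"
      proof (rule ccontr)
        assume "\<not> ?thesis"
        then have "a - \<epsilon> \<le> X n w" "Y n w \<le> b + \<epsilon>" by linarith+
        moreover have "a - b = 4 * \<epsilon>" by (simp add: \<epsilon>_def)
        ultimately show False using elim \<epsilon> by linarith
      qed
      then show ?case by auto
    qed
  qed measurable
  also have "\<dots> \<le> prob {w \<in> space M. \<epsilon> < \<bar>X n w - a\<bar>} + prob {w \<in> space M. \<epsilon> < \<bar>Y n w - b\<bar>}"
    by (intro measure_Un_le) auto
  finally show False using n by simp
qed

lemma conv_prob_unique:
  assumes "conv_prob X a" "conv_prob X b"
  shows "a = b"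
proof (rule antisym)
  show "a \<le> b" by (rule conv_prob_le[OF assms]) simp
  show "b \<le> a" by (rule conv_prob_le[OF assms(2,1)]) simp
qed

lemma conv_prob_subseq:
  assumes "conv_prob X c" "filterlim f sequentially sequentially"
  shows "conv_prob (\<lambda>n. X (f n)) c"
  unfolding conv_prob_def
proof (intro conjI allI impI)
  fix \<epsilon> :: real assume "0 < \<epsilon>"
  then show "(\<lambda>n. prob {w \<in> space M. \<epsilon> < \<bar>X (f n) w - c\<bar>}) \<longlonglongrightarrow> 0"
    by (rule filterlim_compose[OF conv_probD[OF assms(1)] assms(2)])
qed (rule conv_prob_measurable[OF assms(1)])

lemma conv_prob_cmult:
  assumes X: "conv_prob X c" and r: "0 < r"
  shows "conv_prob (\<lambda>n w. r * X n w) (r * c)"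
  unfolding conv_prob_def
proof (intro conjI allI impI)
  note [measurable] = conv_prob_measurable[OF X]
  show "(\<lambda>w. r * X n w) \<in> borel_measurable M" for n by measurable
  fix \<epsilon> :: real assume \<epsilon>: "0 < \<epsilon>"
  have "\<epsilon> < \<bar>r * X n w - r * c\<bar> \<longleftrightarrow> \<epsilon> / r < \<bar>X n w - c\<bar>" for n w
  proof -
    have "\<bar>r * X n w - r * c\<bar> = r * \<bar>X n w - c\<bar>"
      using r by (simp add: right_diff_distrib[symmetric] abs_mult)
    then show ?thesis using r by (simp add: field_simps)
  qed
  then show "(\<lambda>n. prob {w \<in> space M. \<epsilon> < \<bar>r * X n w - r * c\<bar>}) \<longlonglongrightarrow> 0"
    using conv_probD[OF X, of "\<epsilon> / r"] \<epsilon> r by simp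
qed

end

text \<open>Scheffe's argument: \<open>\<bar>X - c\<bar>\<close> equals \<open>X - c\<close> plus
  twice the positive part of \<open>c - X\<close>, which is dominated by c since X is
  nonnegative.\<close>

lemma (in prob_space) tendsto_L1_of_mean:
  fixes X :: "nat \<Rightarrow> 'a \<Rightarrow> real"
  assumes int: "\<And>n. integrable M (X n)" and nonneg: "\<And>n w. 0 \<le> X n w" and c: "0 \<le> c"
    and ae: "AE w in M. (\<lambda>n. X n w) \<longlonglongrightarrow> c"
    and mean: "(\<lambda>n. \<integral>w. X n w \<partial>M) \<longlonglongrightarrow> c"
  shows "(\<lambda>n. \<integral>w. \<bar>X n w - c\<bar> \<partial>M) \<longlonglongrightarrow> 0"
proof -
  note [measurable] = borel_measurable_integrable[OF int]
  have "(\<lambda>n. \<integral>w. max 0 (c - X n w) \<partial>M) \<longlonglongrightarrow> (\<integral>w. 0 \<partial>M)"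
  proof (rule integral_dominated_convergence[where w="\<lambda>_. c"])
    show "AE w in M. (\<lambda>n. max 0 (c - X n w)) \<longlonglongrightarrow> 0"
      using ae
    proof eventually_elim
      case (elim w)
      have "(\<lambda>n. max 0 (c - X n w)) \<longlonglongrightarrow> max 0 (c - c)"
        by (intro tendsto_intros elim)
      then show ?case by simp
    qed
  qed (use nonneg c in auto)
  then have "(\<lambda>n. (\<integral>w. X n w \<partial>M) - c + 2 * (\<integral>w. max 0 (c - X n w) \<partial>M)) \<longlonglongrightarrow> c - c + 2 * 0"
    by (intro tendsto_intros mean) simp
  moreover have "(\<integral>w. \<bar>X n w - c\<bar> \<partial>M) = (\<integral>w. X n w \<partial>M) - c + 2 * (\<integral>w. max 0 (c - X n w) \<partial>M)" for n
  proof -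
    have imax: "integrable M (\<lambda>w. max 0 (c - X n w))"
      by (rule integrable_const_bound[of _ c]) (use nonneg[of n] c in auto)
    have "(\<integral>w. \<bar>X n w - c\<bar> \<partial>M) = (\<integral>w. (X n w - c) + 2 * max 0 (c - X n w) \<partial>M)"
      by (intro Bochner_Integration.integral_cong refl) (simp add: max_def)
    also have "\<dots> = (\<integral>w. X n w - c \<partial>M) + (\<integral>w. 2 * max 0 (c - X n w) \<partial>M)"
      using int imax by (intro Bochner_Integration.integral_add) auto
    finally show ?thesis using int by (simp add: prob_space)
  qed
  ultimately show ?thesis by simp
qed

context sparse_env
begin

definition "hop_bound w = hop (level w) + 5 * real CARD('d) * 16 ^ level w"

lemma integrable_power_level: "integrable P (\<lambda>w. 16 ^ (m * level w) :: real)"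
proof (rule Bochner_Integration.integrable_bound[OF integrable_level[of m]])
  show "AE w in P. norm (16 ^ (m * level w) :: real) \<le> norm (detour CARD('d) (level w) * 16 ^ (m * level w))"
  proof (rule AE_I2)
    fix w
    show "norm (16 ^ (m * level w) :: real) \<le> norm (detour CARD('d) (level w) * 16 ^ (m * level w))"
      using mult_right_mono[OF detour_ge_1, of "16 ^ (m * level w)" "level w"] detour_nonneg[of "CARD('d)" "level w"]
      by (simp add: abs_mult)
  qed
  show "(\<lambda>w. 16 ^ (m * level w) :: real) \<in> borel_measurable P"
    by (rule measurable_compose[OF measurable_level]) simp
qed

lemma integrable_hop: "integrable P (\<lambda>w. hop (level w))"
proof -
  have "hop k = 6 * real CARD('d) * \<kappa> * (detour CARD('d) k * 16 ^ (1 * k))" for k by (simp add: hop_def)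
  then show ?thesis using integrable_level[of 1] by (simp only:) (intro integrable_mult_right)
qed

lemma integrable_hop_bound: "integrable P hop_bound"
  unfolding hop_bound_def using integrable_hop integrable_power_level[of 1] by auto

lemma hop_bound_nonneg: "0 \<le> hop_bound w"
  by (simp add: hop_bound_def hop_nonneg)

definition "to_anchor w = cost w 0 (anchor w 0)"
definition "from_anchor w = cost w (anchor w 0) 0"

lemma to_anchor_translate: "to_anchor (translate y w) = cost w y (anchor w y)"
  and from_anchor_translate: "from_anchor (translate y w) = cost w (anchor w y) y"
  by (simp_all add: to_anchor_def from_anchor_def cost_translate anchor_translate)

lemma measurable_to_anchor [measurable]: "to_anchor \<in> borel_measurable P"
  and measurable_from_anchor [measurable]: "from_anchor \<in> borel_measurable P"
  unfolding to_anchor_def from_anchor_def by measurable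

lemma cost_upper:
  "cost w 0 (int n *s x) \<le> to_anchor w + anchor_cost x n w + from_anchor (translate (int n *s x) w)"
  using cost_triangle[of w 0 "int n *s x" "anchor w 0"]
    cost_triangle[of w "anchor w 0" "int n *s x" "anchor w (int n *s x)"]
  unfolding from_anchor_translate by (simp add: to_anchor_def anchor_cost_def)

lemma cost_lower:
  "anchor_cost x n w \<le> from_anchor w + cost w 0 (int n *s x) + to_anchor (translate (int n *s x) w)"
  using cost_triangle[of w "anchor w 0" "anchor w (int n *s x)" 0]
    cost_triangle[of w 0 "anchor w (int n *s x)" "int n *s x"]
  unfolding to_anchor_translate by (simp add: from_anchor_def anchor_cost_def)

text \<open>Convergence in probability to a constant depends only on the law of each term, so the
  shift may vary with n.\<close>

lemma conv_prob_translate: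
  assumes X: "conv_prob X c"
  shows "conv_prob (\<lambda>n w. X n (translate (t n) w)) c"
  unfolding conv_prob_def
proof (intro conjI allI impI)
  note [measurable] = conv_prob_measurable[OF X]
  show "(\<lambda>w. X n (translate (t n) w)) \<in> borel_measurable P" for n by measurable
  fix \<epsilon> :: real assume \<epsilon>: "0 < \<epsilon>"
  have "prob {w \<in> space P. \<epsilon> < \<bar>X n (translate (t n) w) - c\<bar>} = prob {w \<in> space P. \<epsilon> < \<bar>X n w - c\<bar>}" for n
    using prob_translate[of "\<lambda>w. \<epsilon> < \<bar>X n w - c\<bar>" "t n"] by simp
  then show "(\<lambda>n. prob {w \<in> space P. \<epsilon> < \<bar>X n (translate (t n) w) - c\<bar>}) \<longlonglongrightarrow> 0"
    using conv_probD[OF X \<epsilon>] by simp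
qed

lemma conv_prob_div:
  assumes [measurable]: "g \<in> borel_measurable P"
  shows "conv_prob (\<lambda>n w. g w / real n) 0"
proof (rule conv_prob_AE)
  show "AE w in P. (\<lambda>n. g w / real n) \<longlonglongrightarrow> 0"
    by (intro AE_I2 lim_const_over_n)
qed measurable

text \<open>The difference to the cost between anchors is bounded by end costs at 0 and at nx. Those
  at nx have the same law as those at 0, so divided by n they vanish in probability, whatever their
  moments.\<close>

theorem cost_conv_prob:
  assumes "x \<noteq> 0"
  shows "conv_prob (\<lambda>n w. cost w 0 (int n *s x) / real n) (time_constant x)"
proof -
  have main: "conv_prob (\<lambda>n w. anchor_cost x n w / real n) (time_constant x)"
    by (rule conv_prob_AE[OF _ anchor_cost_tendsto[OF assms]]) (simp add: anchor_cost_def)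
  have err: "conv_prob (\<lambda>n w. (to_anchor w + from_anchor w) / real n) 0"
    by (rule conv_prob_div) measurable
  have err2: "conv_prob (\<lambda>n w. (to_anchor w + from_anchor w) / real n +
    (to_anchor (translate (int n *s x) w) + from_anchor (translate (int n *s x) w)) / real n) (0 + 0)"
    by (rule conv_prob_add[OF err conv_prob_translate[OF err, where t="\<lambda>n. int n *s x"]])
  show ?thesis unfolding conv_prob_def
  proof (intro conjI allI impI)
    show "(\<lambda>w. cost w 0 (int n *s x) / real n) \<in> borel_measurable P" for n by measurable
    fix \<epsilon> :: real assume \<epsilon>: "0 < \<epsilon>"
    define E where "E n w = (to_anchor w + from_anchor w) / real n +
      (to_anchor (translate (int n *s x) w) + from_anchor (translate (int n *s x) w)) / real n" for n w
    have E: "conv_prob E 0" using err2 by (simp add: E_def[abs_def])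
    note [measurable] = conv_prob_measurable[OF main] conv_prob_measurable[OF E]
    have "(\<lambda>n. prob {w \<in> space P. \<epsilon> / 2 < \<bar>anchor_cost x n w / real n - time_constant x\<bar>} +
      prob {w \<in> space P. \<epsilon> / 2 < \<bar>E n w - 0\<bar>}) \<longlonglongrightarrow> 0 + 0"
      using \<epsilon> by (intro tendsto_add conv_probD main E) auto
    moreover have "prob {w \<in> space P. \<epsilon> < \<bar>cost w 0 (int n *s x) / real n - time_constant x\<bar>} \<le>
      prob {w \<in> space P. \<epsilon> / 2 < \<bar>anchor_cost x n w / real n - time_constant x\<bar>} +
      prob {w \<in> space P. \<epsilon> / 2 < \<bar>E n w - 0\<bar>}" for n
    proof -
      have "\<bar>cost w 0 (int n *s x) / real n - anchor_cost x n w / real n\<bar> \<le> \<bar>E n w\<bar>" for w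
      proof -
        have "\<bar>cost w 0 (int n *s x) - anchor_cost x n w\<bar> \<le> (to_anchor w + from_anchor w) +
          (to_anchor (translate (int n *s x) w) + from_anchor (translate (int n *s x) w))"
          using cost_upper[of w n x] cost_lower[of x n w] cost_nonneg
          by (simp add: abs_le_iff to_anchor_def from_anchor_def) (smt (verit) cost_nonneg)
        then have "\<bar>cost w 0 (int n *s x) - anchor_cost x n w\<bar> / real n \<le> E n w"
          unfolding E_def add_divide_distrib[symmetric] by (intro divide_right_mono) auto
        then show ?thesis by (simp add: diff_divide_distrib[symmetric] abs_divide)
      qed
      then have "prob {w \<in> space P. \<epsilon> < \<bar>cost w 0 (int n *s x) / real n - time_constant x\<bar>} \<le>
        prob ({w \<in> space P. \<epsilon> / 2 < \<bar>anchor_cost x n w / real n - time_constant x\<bar>} \<union>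
        {w \<in> space P. \<epsilon> / 2 < \<bar>E n w - 0\<bar>})"
      proof (intro finite_measure_mono subsetI)
        fix w assume "w \<in> {w \<in> space P. \<epsilon> < \<bar>cost w 0 (int n *s x) / real n - time_constant x\<bar>}"
        then have "\<epsilon> < \<bar>cost w 0 (int n *s x) / real n - time_constant x\<bar>" by simp
        with \<open>\<And>w. \<bar>cost w 0 (int n *s x) / real n - anchor_cost x n w / real n\<bar> \<le> \<bar>E n w\<bar>\<close>[of w]
        have "\<epsilon> / 2 < \<bar>anchor_cost x n w / real n - time_constant x\<bar> \<or> \<epsilon> / 2 < \<bar>E n w\<bar>" by linarith
        then show "w \<in> {w \<in> space P. \<epsilon> / 2 < \<bar>anchor_cost x n w / real n - time_constant x\<bar>} \<union>
          {w \<in> space P. \<epsilon> / 2 < \<bar>E n w - 0\<bar>}" by auto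
      qed measurable
      also have "\<dots> \<le> prob {w \<in> space P. \<epsilon> / 2 < \<bar>anchor_cost x n w / real n - time_constant x\<bar>} +
        prob {w \<in> space P. \<epsilon> / 2 < \<bar>E n w - 0\<bar>}"
        by (intro measure_Un_le) measurable
      finally show ?thesis .
    qed
    ultimately show "(\<lambda>n. prob {w \<in> space P. \<epsilon> < \<bar>cost w 0 (int n *s x) / real n - time_constant x\<bar>}) \<longlonglongrightarrow> 0"
      by (intro null_sandwich[OF measure_nonneg]) simp_all
  qed
qed

lemma translate_sublinear:
  fixes g :: "(int ^ 'd \<Rightarrow> real) \<Rightarrow> real"
  assumes "x \<noteq> 0" "integrable P g" "\<And>w. 0 \<le> g w"
  shows "AE w in P. (\<lambda>n. g (translate (int n *s x) w) / real n) \<longlonglongrightarrow> 0"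
proof -
  interpret ergodic_map P "translate x" by (rule ergodic_translate[OF assms(1)])
  show ?thesis using orbit_sublinear[OF assms(2,3)] by (simp add: translate_funpow)
qed

text \<open>Using \<open>cost_lower\<close> would require \<open>to_anchor\<close> at nx to be
  sublinear almost surely, which may fail without moments. Instead \<open>cost_ge_anchor\<close>
  gives the integrable error \<open>hop_bound\<close> at nx, and \<open>from_anchor w\<close> is a
  single finite number.\<close>

theorem cost_eventually_ge:
  assumes x: "x \<noteq> 0"
  shows "AE w in P. \<forall>c<time_constant x. \<forall>\<^sub>F n in sequentially. c < cost w 0 (int n *s x) / real n"
proof -
  obtain i where i: "x $ i \<noteq> 0" using x by (auto simp: vec_eq_iff)
  have "AE w in P. \<forall>n. regular (translate (int n *s x) w)"
    unfolding AE_all_countable using AE_regular_translate by blast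
  then show ?thesis
    using anchor_cost_tendsto[OF x] translate_sublinear[OF x integrable_hop_bound hop_bound_nonneg]
  proof eventually_elim
    case (elim w)
    define H where "H n = hop_bound (translate (int n *s x) w)" for n
    have H: "(\<lambda>n. H n / real n) \<longlonglongrightarrow> 0" using elim(3) by (simp add: H_def)
    have "(\<lambda>n. anchor_cost x n w / real n - from_anchor w / real n - H n / real n) \<longlonglongrightarrow> time_constant x - 0 - 0"
      by (intro tendsto_diff elim(2) H lim_const_over_n)
    then have lim: "(\<lambda>n. anchor_cost x n w / real n - from_anchor w / real n - H n / real n) \<longlonglongrightarrow> time_constant x" by simp
    have "eventually (\<lambda>n. H n / real n < 1) sequentially" using H by (rule order_tendstoD(2)) simp
    then have ev: "eventually (\<lambda>n. anchor_cost x n w / real n - from_anchor w / real n - H n / real n \<le> cost w 0 (int n *s x) / real n) sequentially"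
      using eventually_gt_at_top[of 0]
    proof eventually_elim
      case (elim n)
      let ?y = "int n *s x"
      let ?l = "level (translate ?y w)"
      \<comment> \<open>A sublinear error also bounds the side of the box around nx, so 0 lies
        outside it as \<open>cost_ge_anchor\<close> requires.\<close>
      have "H n < real n" using elim by (simp add: field_simps)
      moreover have "(16::real) ^ ?l \<le> 5 * real CARD('d) * 16 ^ ?l"
        using mult_right_mono[of 1 "5 * real CARD('d)" "16 ^ ?l"] dim by (simp del: mult_le_cancel_right1)
      moreover have "5 * real CARD('d) * 16 ^ ?l \<le> H n" by (simp add: H_def hop_bound_def hop_nonneg)
      ultimately have "(16::real) ^ ?l < real n" by linarith
      then have "real_of_int (16 ^ ?l) < real_of_int (int n)" by simp
      then have "16 ^ ?l < int n" by (simp only: of_int_less_iff)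
      also have "int n * 1 \<le> int n * \<bar>x $ i\<bar>" using i by (intro mult_left_mono) auto
      finally have "16 ^ ?l < \<bar>0 $ i - ?y $ i\<bar>" by (simp add: abs_mult)
      then have "0 \<notin> cube (scale ?l) ?y" unfolding cube_def by (auto simp: not_le)
      then have "cost w 0 (anchor w ?y) - H n \<le> cost w 0 ?y"
        using cost_ge_anchor[of ?y w 0] \<open>\<forall>n. regular (translate (int n *s x) w)\<close>
        by (simp add: H_def hop_bound_def)
      moreover have "anchor_cost x n w \<le> from_anchor w + cost w 0 (anchor w ?y)"
        unfolding anchor_cost_def from_anchor_def by (rule cost_triangle)
      ultimately have "anchor_cost x n w - from_anchor w - H n \<le> cost w 0 ?y" by simp
      then have "(anchor_cost x n w - from_anchor w - H n) / real n \<le> cost w 0 ?y / real n"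
        by (intro divide_right_mono) auto
      then show ?case by (simp add: diff_divide_distrib)
    qed
    show ?case
    proof (intro allI impI)
      fix c assume "c < time_constant x"
      from order_tendstoD(1)[OF lim this] ev
      show "\<forall>\<^sub>F n in sequentially. c < cost w 0 (int n *s x) / real n" by eventually_elim simp
    qed
  qed
qed

theorem cost_tendsto_AE:
  assumes x: "x \<noteq> 0" and int: "integrable P from_anchor"
  shows "AE w in P. (\<lambda>n. cost w 0 (int n *s x) / real n) \<longlonglongrightarrow> time_constant x"
proof -
  have "0 \<le> from_anchor w" for w by (simp add: from_anchor_def cost_nonneg)
  from cost_eventually_ge[OF x] anchor_cost_tendsto[OF x] translate_sublinear[OF x int this]
  show ?thesis
  proof eventually_elim
    case (elim w)
    define F where "F n = from_anchor (translate (int n *s x) w)" for n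
    have "(\<lambda>n. to_anchor w / real n + anchor_cost x n w / real n + F n / real n) \<longlonglongrightarrow> 0 + time_constant x + 0"
      using elim by (intro tendsto_add lim_const_over_n) (auto simp: F_def)
    then have up: "(\<lambda>n. to_anchor w / real n + anchor_cost x n w / real n + F n / real n) \<longlonglongrightarrow> time_constant x" by simp
    have le: "cost w 0 (int n *s x) / real n \<le> to_anchor w / real n + anchor_cost x n w / real n + F n / real n" for n
      unfolding F_def add_divide_distrib[symmetric] by (intro divide_right_mono cost_upper) auto
    show ?case
    proof (rule order_tendstoI)
      fix c assume "c < time_constant x"
      then show "\<forall>\<^sub>F n in sequentially. c < cost w 0 (int n *s x) / real n" using elim by blast
    next
      fix c assume "time_constant x < c"
      from order_tendstoD(2)[OF up this]
      show "\<forall>\<^sub>F n in sequentially. cost w 0 (int n *s x) / real n < c"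
        by eventually_elim (rule le_less_trans[OF le])
    qed
  qed
qed

section \<open>Convergence in mean\<close>

lemma integrable_coord:
  assumes "integrable P (\<lambda>w. \<bar>w 0\<bar>)"
  shows "integrable P (\<lambda>w. \<bar>w z\<bar>)"
  using integrable_translate[OF assms, of z] by (simp add: translate_def)

lemma integrable_cost:
  assumes "integrable P (\<lambda>w. \<bar>w 0\<bar>)"
  shows "integrable P (\<lambda>w. cost w y y')"
proof (induction "l1_dist y y'" arbitrary: y)
  case 0
  have "y = y'"
  proof (rule ccontr)
    assume "y \<noteq> y'"
    then obtain z i where "z = axis i 1 \<or> z = axis i (-1)" "l1_dist y y' = Suc (l1_dist (y + z) y')"
      by (rule l1_dist_step)
    with 0 show False by simp
  qed
  then show ?case by simp
next
  case (Suc n)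
  then have "y \<noteq> y'" by (auto simp: l1_dist_def)
  then obtain z i where z: "z = axis i 1 \<or> z = axis i (-1)" "l1_dist y y' = Suc (l1_dist (y + z) y')"
    by (rule l1_dist_step)
  then have zn: "z \<in> nbrs" by (auto simp: axis_in_nbrs)
  have IH: "integrable P (\<lambda>w. cost w (y + z) y')" using Suc z(2) by simp
  show ?case
  proof (rule Bochner_Integration.integrable_bound)
    show "integrable P (\<lambda>w. \<bar>w y\<bar> + ln (card (nbrs :: (int ^ 'd) set)) + cost w (y + z) y')"
      using integrable_coord[OF assms, of y] IH by auto
    show "AE w in P. norm (cost w y y') \<le> norm (\<bar>w y\<bar> + ln (card (nbrs :: (int ^ 'd) set)) + cost w (y + z) y')"
    proof (rule AE_I2)
      fix w
      have "cost w y y' \<le> \<bar>w y\<bar> + ln (card (nbrs :: (int ^ 'd) set)) + cost w (y + z) y'"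
        using cost_adjacent[OF zn, of w y] cost_triangle[of w y y' "y + z"] by simp
      then show "norm (cost w y y') \<le> norm (\<bar>w y\<bar> + ln (card (nbrs :: (int ^ 'd) set)) + cost w (y + z) y')"
        using cost_nonneg[of w y y'] by simp
    qed
  qed measurable
qed

text \<open>With integrable potential, Kingman's theorem applies to the costs between sites
  themselves. Convergence in probability identifies its limit with \<open>time_constant x\<close>,
  and convergence of the means upgrades the almost sure limit.\<close>

theorem cost_tendsto_L1:
  assumes x: "x \<noteq> 0" and int: "integrable P (\<lambda>w. \<bar>w 0\<bar>)"
  shows "(\<lambda>n. \<integral>w. \<bar>cost w 0 (int n *s x) / real n - time_constant x\<bar> \<partial>P) \<longlonglongrightarrow> 0"
proof -
  interpret ergodic_map P "translate x" by (rule ergodic_translate[OF x])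
  define f where "f n w = cost w 0 (int n *s x)" for n w
  define \<gamma> where "\<gamma> = (INF n\<in>{0<..}. (\<integral>w. f n w \<partial>P) / real n)"
  have f_meas: "f n \<in> borel_measurable P" for n unfolding f_def by measurable
  have f0: "f 0 = (\<lambda>_. 0)"
    by (auto simp: f_def fun_eq_iff vector_scalar_mult_def vec_eq_iff zero_vec_def[symmetric])
  have f_nonneg: "0 \<le> f n w" for n w by (simp add: f_def cost_nonneg)
  have f_sub: "f (m + n) w \<le> f m w + f n ((translate x ^^ m) w)" for m n w
  proof -
    have 1: "int n *s x + int m *s x = int (m + n) *s x" by (simp add: vec_eq_iff algebra_simps)
    have "f n ((translate x ^^ m) w) = cost w (int m *s x) (int (m + n) *s x)"
      unfolding f_def translate_funpow cost_translate 1 by simp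
    then show ?thesis using cost_triangle[of w 0 "int (m + n) *s x" "int m *s x"]
      by (simp only: f_def)
  qed
  have f1: "integrable P (f 1)" unfolding f_def by (rule integrable_cost[OF int])
  note K = kingman[OF f_meas f_nonneg f0 f_sub f1, folded \<gamma>_def]
  have "conv_prob (\<lambda>n w. f n w / real n) \<gamma>"
    by (rule conv_prob_AE[OF _ K(1)]) (use f_meas in measurable)
  then have \<gamma>: "\<gamma> = time_constant x"
    using cost_conv_prob[OF x] by (intro conv_prob_unique) (simp_all add: f_def[abs_def])
  have "0 \<le> \<gamma>"
    by (rule LIMSEQ_le_const[OF K(2)]) (auto intro!: exI[of _ 0] divide_nonneg_nonneg integral_nonneg_AE simp: f_nonneg)
  then have "(\<lambda>n. \<integral>w. \<bar>f n w / real n - \<gamma>\<bar> \<partial>P) \<longlonglongrightarrow> 0"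
    using K f_nonneg by (intro tendsto_L1_of_mean) auto
  then show ?thesis by (simp add: f_def \<gamma>)
qed

end

section \<open>Reaching a site from its anchor\<close>

context sparse_env
begin

definition "\<epsilon> = prob {w. K < \<bar>w 0\<bar>}"

lemma emeasure_all_closed:
  assumes "finite F"
  shows "emeasure P {w. \<forall>z\<in>F. K < \<bar>w z\<bar>} = ennreal \<epsilon> ^ card F"
proof -
  have sp: "space (Pi\<^sub>M UNIV (\<lambda>_::int ^ 'd. \<nu>)) = UNIV" using space_P unfolding P_eq .
  have eps: "emeasure P {w. K < \<bar>w 0\<bar>} = ennreal \<epsilon>" by (simp add: \<epsilon>_def emeasure_eq_measure)
  interpret product_prob_space "\<lambda>_::int ^ 'd. \<nu>" UNIV
    by (intro product_prob_spaceI prob_space_\<nu>)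
  have S: "{t. K < \<bar>t\<bar>} \<in> sets \<nu>" unfolding sets_\<nu> by measurable
  have 1: "emeasure P {w. \<forall>z\<in>F. w z \<in> {t. K < \<bar>t\<bar>}} = (\<Prod>z\<in>F. emeasure \<nu> {t. K < \<bar>t\<bar>})"
    if "finite F" for F :: "(int ^ 'd) set"
    unfolding P_eq using emeasure_PiM_Collect[of F "\<lambda>_. {t. K < \<bar>t\<bar>}"] that S by (simp add: sp)
  have "emeasure \<nu> {t. K < \<bar>t\<bar>} = ennreal \<epsilon>"
    using 1[of "{0}"] eps by simp
  then show ?thesis using 1[OF assms] by simp
qed

text \<open>On the event that all sites of \<open>F\<close> are closed, an event expressed through the closed sites
  coincides with one that ignores the potential on \<open>F\<close>.\<close>

lemma closed_indep:
  fixes g :: "(int ^ 'd \<Rightarrow> real) \<Rightarrow> ennreal"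
  assumes F: "finite F" and g [measurable]: "g \<in> borel_measurable P" and dep: "depends_on F g"
    and zero: "\<And>w. g w \<noteq> 0 \<Longrightarrow> \<forall>z\<in>F. K < \<bar>w z\<bar>"
    and E [measurable]: "Measurable.pred P E"
    and cl: "\<And>w w'. closed_at K w = closed_at K w' \<Longrightarrow> E w = E w'"
  shows "(\<integral>\<^sup>+w. g w * indicator {w. E w} w \<partial>P) * ennreal \<epsilon> ^ card F \<le> emeasure P {w. E w} * (\<integral>\<^sup>+w. g w \<partial>P)"
proof -
  \<comment> \<open>\<open>K + 1\<close> is a closed value. After resetting F to it, an event about
    closed sites no longer depends on F, and where F was closed the event is unchanged.\<close>
  define r where "r w = (\<lambda>z. if z \<in> F then K + 1 else w z)" for w :: "int ^ 'd \<Rightarrow> real"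
  have r_meas [measurable]: "r \<in> measurable P P"
  proof (rule measurable_into_P)
    fix z show "(\<lambda>w. r w z) \<in> borel_measurable P" by (cases "z \<in> F") (simp_all add: r_def)
  qed
  have rE: "E (r w) = E w" if "\<forall>z\<in>F. K < \<bar>w z\<bar>" for w
    using that K_nonneg by (intro cl) (auto simp: r_def fun_eq_iff)
  have Er [measurable]: "Measurable.pred P (\<lambda>w. E (r w))" by measurable
  have depE: "depends_on (- F) (\<lambda>w. E (r w))"
  proof -
    have "r w = r w'" if "\<forall>z\<in>-F. w z = w' z" for w w' using that by (auto simp: r_def fun_eq_iff)
    then show ?thesis unfolding depends_on_def by metis
  qed
  have [measurable]: "{w. E (r w)} \<in> sets P" "{w. E w} \<in> sets P"
    "{w. \<forall>z\<in>F. K < \<bar>w z\<bar>} \<in> sets P"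
    using F by (auto intro!: sets_Collect_P)
  have "(\<integral>\<^sup>+w. g w * indicator {w. E w} w \<partial>P) = (\<integral>\<^sup>+w. g w * indicator {w. E (r w)} w \<partial>P)"
  proof (rule nn_integral_cong)
    fix w show "g w * indicator {w. E w} w = g w * indicator {w. E (r w)} w"
      using zero[of w] rE[of w] by (cases "g w = 0") (auto simp: indicator_def)
  qed
  also have "\<dots> = (\<integral>\<^sup>+w. g w \<partial>P) * (\<integral>\<^sup>+w. indicator {w. E (r w)} w \<partial>P)"
    using depE by (intro nn_integral_indep[OF _ _ dep, where B="- F"]) (auto simp: depends_on_def indicator_def)
  also have "\<dots> = (\<integral>\<^sup>+w. g w \<partial>P) * emeasure P {w. E (r w)}" by simp
  finally have 1: "(\<integral>\<^sup>+w. g w * indicator {w. E w} w \<partial>P) = (\<integral>\<^sup>+w. g w \<partial>P) * emeasure P {w. E (r w)}" .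
  \<comment> \<open>Intersecting with the independent event that F is closed turns the reset event
    back into E, at the price of a power of \<open>\<epsilon>\<close>.\<close>
  have "emeasure P {w. E (r w)} * ennreal \<epsilon> ^ card F =
    (\<integral>\<^sup>+w. indicator {w. E (r w)} w \<partial>P) * (\<integral>\<^sup>+w. indicator {w. \<forall>z\<in>F. K < \<bar>w z\<bar>} w \<partial>P)"
    by (simp add: emeasure_all_closed[OF F])
  also have "\<dots> = (\<integral>\<^sup>+w. indicator {w. E (r w)} w * indicator {w. \<forall>z\<in>F. K < \<bar>w z\<bar>} w \<partial>P)"
    using depE by (intro nn_integral_indep[symmetric, where A="- F" and B=F]) (auto simp: depends_on_def indicator_def)
  also have "\<dots> \<le> (\<integral>\<^sup>+w. indicator {w. E w} w \<partial>P)"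
    by (intro nn_integral_mono) (auto simp: indicator_def rE)
  finally have 2: "emeasure P {w. E (r w)} * ennreal \<epsilon> ^ card F \<le> emeasure P {w. E w}" by simp
  show ?thesis unfolding 1 mult.assoc
    using mult_left_mono[OF 2, of "\<integral>\<^sup>+w. g w \<partial>P"] by (simp add: mult.commute)
qed

lemma nn_integral_reindex:
  fixes f :: "int ^ 'd \<Rightarrow> int ^ 'd"
  assumes inj: "inj_on f I" and \<Phi>: "\<Phi> \<in> borel_measurable (Pi\<^sub>M I (\<lambda>_. \<nu>))"
  shows "(\<integral>\<^sup>+w. \<Phi> (\<lambda>z\<in>I. w (f z)) \<partial>P) = (\<integral>\<^sup>+u. \<Phi> u \<partial>Pi\<^sub>M I (\<lambda>_. \<nu>))"
proof -
  have "distr P (Pi\<^sub>M I (\<lambda>_. \<nu>)) (\<lambda>w. \<lambda>z\<in>I. w (f z)) = Pi\<^sub>M I (\<lambda>_. \<nu>)"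
    unfolding P_eq by (rule distr_PiM_reindex) (use inj prob_space_\<nu> in auto)
  moreover have "(\<lambda>w. \<lambda>z\<in>I. w (f z)) \<in> measurable P (Pi\<^sub>M I (\<lambda>_. \<nu>))"
    unfolding P_eq by (intro measurable_restrict measurable_component_singleton) auto
  ultimately show ?thesis using nn_integral_distr[of "\<lambda>w. \<lambda>z\<in>I. w (f z)" P "Pi\<^sub>M I (\<lambda>_. \<nu>)" \<Phi>] \<Phi>
    by simp
qed

lemma nbrs_multiple_inj:
  fixes z z' :: "int ^ 'd"
  assumes "z \<in> nbrs" "z' \<in> nbrs" "0 < s" "0 < s'" "int s *s z = int s' *s z'"
  shows "z = z'"
proof -
  have norm: "norm (to_real_vec (int s *s z)) = real s" if "z \<in> nbrs" for s and z :: "int ^ 'd"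
  proof -
    have "to_real_vec (int s *s z) = real s *\<^sub>R to_real_vec z"
      by (simp add: to_real_vec_def vec_eq_iff)
    then show ?thesis using norm_nbrs[OF that] by simp
  qed
  from norm[OF assms(1), of s] norm[OF assms(2), of s'] assms(5) have "s = s'" by simp
  with assms show ?thesis by (auto simp: vec_eq_iff)
qed

lemma inj_on_rays:
  fixes t :: "int ^ 'd \<Rightarrow> nat"
  assumes "\<And>z. z \<in> nbrs \<Longrightarrow> 0 < t z"
  shows "inj_on (\<lambda>z. int (t z) *s z) nbrs"
proof (rule inj_onI)
  fix x y :: "int ^ 'd" assume "x \<in> nbrs" "y \<in> nbrs" "int (t x) *s x = int (t y) *s y"
  then show "x = y" using assms by (intro nbrs_multiple_inj[of x y "t x" "t y"])
qed

text \<open>Only closed sites are charged, so a nonzero minimum over a set of sites forces all of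
  them to be closed, as \<open>closed_indep\<close> requires.\<close>

definition excess :: "real \<Rightarrow> ennreal" where
  "excess t = (if K < \<bar>t\<bar> then ennreal \<bar>t\<bar> else 0)"

lemma measurable_excess [measurable]: "excess \<in> borel_measurable borel"
  unfolding excess_def by measurable

lemma abs_le_excess: "ennreal \<bar>t\<bar> \<le> ennreal K + excess t"
  using K_nonneg by (auto simp: excess_def intro: ennreal_leI)

text \<open>One site is selected on every ray, at distance \<open>t z\<close>; the minimum reflects
  the freedom to choose the direction.\<close>

definition "ray_min t w = Min ((\<lambda>z. excess (w (int (t z) *s z))) ` (nbrs :: (int ^ 'd) set))"

lemma measurable_Min_nbrs:
  assumes "\<And>z. z \<in> (nbrs :: (int ^ 'd) set) \<Longrightarrow> (\<lambda>w. f z w) \<in> borel_measurable N"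
  shows "(\<lambda>w. Min ((\<lambda>z. f z w) ` (nbrs :: (int ^ 'd) set)) :: ennreal) \<in> borel_measurable N"
  using assms by (intro borel_measurable_Min) auto

lemma measurable_ray_min [measurable]: "ray_min t \<in> borel_measurable P"
  unfolding ray_min_def by (intro measurable_Min_nbrs) measurable

text \<open>Sites on different rays are distinct, so the selected values have the joint law of the
  values at the neighbours of 0.\<close>

lemma ray_min_integral:
  assumes "\<And>z. z \<in> nbrs \<Longrightarrow> 0 < t z"
  shows "(\<integral>\<^sup>+w. ray_min t w \<partial>P) \<le> (\<integral>\<^sup>+w. Min ((\<lambda>z. ennreal \<bar>w z\<bar>) ` (nbrs :: (int ^ 'd) set)) \<partial>P)"
proof -
  let ?N = "nbrs :: (int ^ 'd) set"
  define \<Phi> where "\<Phi> u = Min ((\<lambda>z. excess (u z)) ` ?N)" for u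
  have c: "(\<lambda>u. u z) \<in> borel_measurable (Pi\<^sub>M ?N (\<lambda>_. \<nu>))" if "z \<in> ?N" for z
    using measurable_component_singleton[OF that, of "\<lambda>_. \<nu>"] by (simp cong: measurable_cong_sets add: sets_\<nu>)
  have \<Phi>: "\<Phi> \<in> borel_measurable (Pi\<^sub>M ?N (\<lambda>_. \<nu>))"
    unfolding \<Phi>_def by (intro measurable_Min_nbrs measurable_compose[OF c measurable_excess])
  have "inj_on (\<lambda>z. int (t z) *s z) ?N"
    using assms by (rule inj_on_rays)
  from nn_integral_reindex[OF this \<Phi>] nn_integral_reindex[OF inj_on_id2 \<Phi>]
  have "(\<integral>\<^sup>+w. \<Phi> (\<lambda>z\<in>?N. w (int (t z) *s z)) \<partial>P) = (\<integral>\<^sup>+w. \<Phi> (\<lambda>z\<in>?N. w z) \<partial>P)" by simp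
  then have "(\<integral>\<^sup>+w. ray_min t w \<partial>P) = (\<integral>\<^sup>+w. Min ((\<lambda>z. excess (w z)) ` ?N) \<partial>P)"
    by (simp add: \<Phi>_def ray_min_def cong: image_cong)
  also have "\<dots> \<le> (\<integral>\<^sup>+w. Min ((\<lambda>z. ennreal \<bar>w z\<bar>) ` ?N) \<partial>P)"
  proof (rule nn_integral_mono)
    fix w :: "int ^ 'd \<Rightarrow> real"
    have "Min ((\<lambda>z. excess (w z)) ` ?N) \<le> ennreal \<bar>w z\<bar>" if "z \<in> ?N" for z
      using that by (intro order_trans[OF Min_le[of _ "excess (w z)"]]) (auto simp: excess_def)
    then show "Min ((\<lambda>z. excess (w z)) ` ?N) \<le> Min ((\<lambda>z. ennreal \<bar>w z\<bar>) ` ?N)"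
      by (intro Min.boundedI) auto
  qed
  finally show ?thesis .
qed

lemma level_cong: "closed_at K w = closed_at K w' \<Longrightarrow> level w = level w'"
  unfolding level_def clear_at_def by simp

text \<open>\<open>level\<close> is a function of the set of closed sites. By
  \<open>closed_indep\<close>, conditioning on it changes the mean of \<open>ray_min\<close> by at
  most the factor \<open>\<epsilon>^(- card nbrs)\<close>, uniformly in the level.\<close>

lemma ray_min_level:
  assumes fin: "(\<integral>\<^sup>+w. Min ((\<lambda>z. ennreal \<bar>w z\<bar>) ` (nbrs :: (int ^ 'd) set)) \<partial>P) < \<infinity>"
  shows "\<exists>B\<ge>0. \<forall>t l. (\<forall>z \<in> (nbrs :: (int ^ 'd) set). 0 < t z) \<longrightarrow>
    (\<integral>\<^sup>+w. ray_min t w * indicator {w. level w = l} w \<partial>P) \<le> emeasure P {w. level w = l} * ennreal B"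
proof -
  let ?N = "nbrs :: (int ^ 'd) set"
  define I where "I = (\<integral>\<^sup>+w. Min ((\<lambda>z. ennreal \<bar>w z\<bar>) ` ?N) \<partial>P)"
  obtain J where J: "I = ennreal J" "0 \<le> J" using fin unfolding I_def[symmetric] by (cases I) auto
  have zero: "\<forall>u \<in> (\<lambda>z. int (t z) *s z) ` ?N. K < \<bar>w u\<bar>" if "ray_min t w \<noteq> 0" for t w
  proof (rule ccontr)
    assume "\<not> ?thesis"
    then obtain z where z: "z \<in> ?N" "excess (w (int (t z) *s z)) = 0" by (auto simp: excess_def)
    then have "ray_min t w \<le> excess (w (int (t z) *s z))" unfolding ray_min_def by (intro Min_le) auto
    with z that show False by simp
  qed
  show ?thesis
  proof (cases "\<epsilon> = 0")
    \<comment> \<open>Without closed sites the excess vanishes almost surely; this case is apart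
      because the general bound divides by a power of \<open>\<epsilon>\<close>.\<close>
    case True
    have "AE w in P. \<not> K < \<bar>w z\<bar>" for z
    proof -
      have "emeasure P {w. \<forall>z\<in>{z}. K < \<bar>w z\<bar>} = 0" using emeasure_all_closed[of "{z}"] True by simp
      then have "{w. K < \<bar>w z\<bar>} \<in> null_sets P" by (auto intro!: null_setsI sets_Collect_P)
      then show ?thesis by (rule AE_I') auto
    qed
    then have "AE w in P. \<forall>z. \<not> K < \<bar>w z\<bar>" unfolding AE_all_countable by blast
    then have ae: "AE w in P. ray_min t w = 0" for t
    proof eventually_elim
      case (elim w)
      obtain z where "z \<in> ?N" using nbrs_nonempty by blast
      then show ?case using zero[of t w] elim by blast
    qed
    have "AE w in P. ray_min t w * indicator {w. level w = l} w = 0" for t l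
      using ae[of t] by (rule eventually_mono) simp
    then have "(\<integral>\<^sup>+w. ray_min t w * indicator {w. level w = l} w \<partial>P) = (\<integral>\<^sup>+w. 0 \<partial>P)" for t l
      by (rule nn_integral_cong_AE)
    then show ?thesis by (intro exI[of _ 0]) auto
  next
    case False
    then have eps: "0 < \<epsilon>" using measure_nonneg[of P "{w. K < \<bar>w 0\<bar>}"] unfolding \<epsilon>_def by linarith
    show ?thesis
    proof (intro exI[of _ "J / \<epsilon> ^ card ?N"] conjI allI impI)
      show "0 \<le> J / \<epsilon> ^ card ?N" using J eps by simp
      fix t :: "int ^ 'd \<Rightarrow> nat" and l assume "\<forall>z\<in>?N. 0 < t z"
      then have t: "\<And>z. z \<in> ?N \<Longrightarrow> 0 < t z" by blast
      let ?F = "(\<lambda>z. int (t z) *s z) ` ?N"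
      have "inj_on (\<lambda>z. int (t z) *s z) ?N" using t by (rule inj_on_rays)
      then have card: "card ?F = card ?N" by (rule card_image)
      have dep: "depends_on ?F (ray_min t)"
        unfolding depends_on_def ray_min_def by (auto intro!: arg_cong[where f=Min] image_cong)
      have "(\<integral>\<^sup>+w. ray_min t w * indicator {w. level w = l} w \<partial>P) * ennreal \<epsilon> ^ card ?F
        \<le> emeasure P {w. level w = l} * (\<integral>\<^sup>+w. ray_min t w \<partial>P)"
      proof (rule closed_indep[OF _ _ dep])
        show "Measurable.pred P (\<lambda>w. level w = l)" by measurable
        show "(level w = l) = (level w' = l)" if "closed_at K w = closed_at K w'" for w w'
          using level_cong[OF that] by simp
      qed (use zero in auto)
      also have "\<dots> \<le> emeasure P {w. level w = l} * ennreal J"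
        using ray_min_integral[OF t] J by (intro mult_left_mono) (auto simp: I_def)
      finally have le: "(\<integral>\<^sup>+w. ray_min t w * indicator {w. level w = l} w \<partial>P) * ennreal (\<epsilon> ^ card ?N)
        \<le> emeasure P {w. level w = l} * ennreal J"
        using eps by (simp add: card ennreal_power)
      have pos: "0 < \<epsilon> ^ card ?N" using eps by simp
      have "(\<integral>\<^sup>+w. ray_min t w * indicator {w. level w = l} w \<partial>P) =
        (\<integral>\<^sup>+w. ray_min t w * indicator {w. level w = l} w \<partial>P) * ennreal (\<epsilon> ^ card ?N) * ennreal (1 / \<epsilon> ^ card ?N)"
        using pos eps by (simp add: mult.assoc ennreal_mult[symmetric])
      also have "\<dots> \<le> emeasure P {w. level w = l} * ennreal J * ennreal (1 / \<epsilon> ^ card ?N)"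
        by (intro mult_right_mono le) simp
      also have "\<dots> = emeasure P {w. level w = l} * ennreal (J / \<epsilon> ^ card ?N)"
        using pos J by (simp add: mult.assoc ennreal_mult[symmetric])
      finally show "(\<integral>\<^sup>+w. ray_min t w * indicator {w. level w = l} w \<partial>P) \<le> emeasure P {w. level w = l} * ennreal (J / \<epsilon> ^ card ?N)" .
    qed
  qed
qed

abbreviation rays :: "nat \<Rightarrow> (int ^ 'd \<Rightarrow> nat) set" where
  "rays m \<equiv> PiE nbrs (\<lambda>_. {1..m})"

text \<open>On each ray the sum is at most m times its largest value. Where this is attained depends
  on w, so the bound sums over all selections t, which are deterministic and fit
  \<open>ray_min_level\<close>.\<close>

lemma from_anchor_le:
  assumes reg: "regular w"
  defines "m \<equiv> 2 * 16 ^ level w"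
  shows "ennreal (from_anchor w) \<le> ennreal (hop (level w) + real m * (ln (card (nbrs :: (int ^ 'd) set)) + K)) +
    of_nat m * (\<Sum>t\<in>rays m. ray_min t w)"
proof -
  let ?N = "nbrs :: (int ^ 'd) set"
  let ?c = "ln (card ?N)"
  have m: "1 \<le> m" by (simp add: m_def)
  have "\<exists>s\<in>{1..m}. \<forall>s'\<in>{1..m}. \<bar>w (int s' *s z)\<bar> \<le> \<bar>w (int s *s z)\<bar>" for z
  proof -
    have "Max ((\<lambda>s. \<bar>w (int s *s z)\<bar>) ` {1..m}) \<in> (\<lambda>s. \<bar>w (int s *s z)\<bar>) ` {1..m}"
      using m by (intro Max_in) auto
    then obtain s where s: "s \<in> {1..m}" "Max ((\<lambda>s. \<bar>w (int s *s z)\<bar>) ` {1..m}) = \<bar>w (int s *s z)\<bar>" by auto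
    moreover have "\<bar>w (int s' *s z)\<bar> \<le> Max ((\<lambda>s. \<bar>w (int s *s z)\<bar>) ` {1..m})" if "s' \<in> {1..m}" for s'
      using that by (intro Max_ge) auto
    ultimately show ?thesis using s by (intro bexI[of _ s]) simp_all
  qed
  then obtain s where s: "\<And>z. s z \<in> {1..m}" "\<And>z s'. s' \<in> {1..m} \<Longrightarrow> \<bar>w (int s' *s z)\<bar> \<le> \<bar>w (int (s z) *s z)\<bar>" by metis
  define t where "t = restrict s ?N"
  have t: "t \<in> rays m" using s(1) by (auto simp: t_def)
  have bound: "ennreal (from_anchor w) \<le> ennreal (hop (level w) + real m * (?c + K)) + of_nat m * excess (w (int (t z) *s z))"
    if z: "z \<in> ?N" for z
  proof -
    have tz: "t z = s z" using z by (simp add: t_def)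
    have "from_anchor w \<le> hop (level w) + (\<Sum>i=1..m. \<bar>w (int i *s z)\<bar> + ?c)"
      unfolding from_anchor_def m_def by (rule cost_from_anchor[OF reg z])
    also have "(\<Sum>i=1..m. \<bar>w (int i *s z)\<bar> + ?c) \<le> (\<Sum>i=1..m. \<bar>w (int (t z) *s z)\<bar> + ?c)"
      using s(2) by (intro sum_mono) (simp add: tz)
    also have "\<dots> = real m * ?c + real m * \<bar>w (int (t z) *s z)\<bar>" by (simp add: algebra_simps)
    finally have "ennreal (from_anchor w) \<le> ennreal ((hop (level w) + real m * ?c) + real m * \<bar>w (int (t z) *s z)\<bar>)"
      by (intro ennreal_leI) simp
    also have "\<dots> = ennreal (hop (level w) + real m * ?c) + of_nat m * ennreal \<bar>w (int (t z) *s z)\<bar>"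
      using hop_nonneg ln_card_nbrs_nonneg by (simp add: ennreal_plus[symmetric] ennreal_mult ennreal_of_nat_eq_real_of_nat del: ennreal_plus)
         (subst ennreal_plus, auto simp: ennreal_mult)
    also have "\<dots> \<le> ennreal (hop (level w) + real m * ?c) + of_nat m * (ennreal K + excess (w (int (t z) *s z)))"
      by (intro add_left_mono mult_left_mono abs_le_excess) simp
    also have "\<dots> = ennreal (hop (level w) + real m * (?c + K)) + of_nat m * excess (w (int (t z) *s z))"
    proof -
      have "of_nat m * ennreal K = ennreal (real m * K)"
        using K_nonneg by (simp add: ennreal_of_nat_eq_real_of_nat ennreal_mult)
      moreover have "ennreal (hop (level w) + real m * ?c) + ennreal (real m * K) = ennreal (hop (level w) + real m * (?c + K))"
        using hop_nonneg ln_card_nbrs_nonneg K_nonneg by (subst ennreal_plus[symmetric]) (auto simp: algebra_simps)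
      ultimately show ?thesis by (simp add: distrib_left add.assoc[symmetric])
    qed
    finally show ?thesis .
  qed
  have "ray_min t w \<in> (\<lambda>z. excess (w (int (t z) *s z))) ` ?N"
    unfolding ray_min_def by (intro Min_in) auto
  then obtain z where "z \<in> ?N" "ray_min t w = excess (w (int (t z) *s z))" by auto
  with bound have "ennreal (from_anchor w) \<le> ennreal (hop (level w) + real m * (?c + K)) + of_nat m * ray_min t w" by simp
  also have "ray_min t w \<le> (\<Sum>t\<in>rays m. ray_min t w)"
    using t by (intro member_le_sum) (auto intro!: finite_PiE)
  finally show ?thesis by (simp add: mult_left_mono)
qed

text \<open>At level l there are \<open>m^(card nbrs)\<close> selections with m =
  \<open>2 * 16^l\<close>, each carrying a factor m and a conditional mean at most B. The total is a
  moment of \<open>16 ^ level\<close>, and all of these are finite.\<close>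

theorem integrable_from_anchor:
  assumes fin: "(\<integral>\<^sup>+w. Min ((\<lambda>z. ennreal \<bar>w z\<bar>) ` (nbrs :: (int ^ 'd) set)) \<partial>P) < \<infinity>"
  shows "integrable P from_anchor"
proof (rule integrableI_nonneg)
  show "from_anchor \<in> borel_measurable P" by measurable
  show "AE w in P. 0 \<le> from_anchor w" by (simp add: from_anchor_def cost_nonneg)
  let ?N = "nbrs :: (int ^ 'd) set"
  obtain B where "0 \<le> B" and B': "\<forall>t l. (\<forall>z\<in>?N. 0 < t z) \<longrightarrow>
    (\<integral>\<^sup>+w. ray_min t w * indicator {w. level w = l} w \<partial>P) \<le> emeasure P {w. level w = l} * ennreal B"
    using ray_min_level[OF fin] by (elim exE conjE)
  define m :: "nat \<Rightarrow> nat" where "m l = 2 * 16 ^ l" for l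
  define A where "A w = hop (level w) + real (m (level w)) * (ln (card ?N) + K)" for w
  have A_int: "integrable P A"
    unfolding A_def m_def using integrable_hop integrable_power_level[of 1] by auto
  have A0: "0 \<le> A w" for w
    unfolding A_def using hop_nonneg ln_card_nbrs_nonneg K_nonneg by simp
  define S where "S l w = of_nat (m l) * (\<Sum>t\<in>rays (m l). ray_min t w * indicator {w. level w = l} w)" for l w
  have S_meas [measurable]: "S l \<in> borel_measurable P" for l
    unfolding S_def by measurable
  have S_int: "(\<integral>\<^sup>+w. S l w \<partial>P) \<le> ennreal B * (\<integral>\<^sup>+w. ennreal (real (m l) ^ (card ?N + 1)) * indicator {w. level w = l} w \<partial>P)" for l
  proof -
    have "(\<integral>\<^sup>+w. S l w \<partial>P) = of_nat (m l) * (\<Sum>t\<in>rays (m l). (\<integral>\<^sup>+w. ray_min t w * indicator {w. level w = l} w \<partial>P))"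
      unfolding S_def by (subst nn_integral_cmult) (auto simp: nn_integral_sum)
    also have "\<dots> \<le> of_nat (m l) * (\<Sum>t\<in>rays (m l). emeasure P {w. level w = l} * ennreal B)"
      by (intro mult_left_mono sum_mono B'[rule_format]) (auto simp: PiE_iff Suc_le_eq)
    also have "\<dots> = of_nat (m l) * (of_nat (m l ^ card ?N) * (emeasure P {w. level w = l} * ennreal B))"
      by (simp add: card_PiE)
    also have "\<dots> = ennreal B * (ennreal (real (m l) ^ (card ?N + 1)) * emeasure P {w. level w = l})"
      by (simp add: ennreal_of_nat_eq_real_of_nat ennreal_mult ennreal_power[symmetric] mult_ac)
    also have "\<dots> = ennreal B * (\<integral>\<^sup>+w. ennreal (real (m l) ^ (card ?N + 1)) * indicator {w. level w = l} w \<partial>P)"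
      by (subst nn_integral_cmult_indicator) (auto intro!: sets_Collect_P)
    finally show ?thesis .
  qed
  have "(\<integral>\<^sup>+w. ennreal (from_anchor w) \<partial>P) \<le> (\<integral>\<^sup>+w. ennreal (A w) + (\<Sum>l. S l w) \<partial>P)"
  proof (rule nn_integral_mono_AE)
    show "AE w in P. ennreal (from_anchor w) \<le> ennreal (A w) + (\<Sum>l. S l w)"
      using AE_regular
    proof eventually_elim
      case (elim w)
      have "ennreal (from_anchor w) \<le> ennreal (A w) + S (level w) w"
        using from_anchor_le[OF elim] by (simp add: A_def S_def m_def)
      also have "S (level w) w = (\<Sum>l\<in>{level w}. S l w)" by simp
      also have "\<dots> \<le> (\<Sum>l. S l w)" by (intro sum_le_suminf) auto
      finally show ?case by (simp add: add_left_mono)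
    qed
  qed
  also have "\<dots> = (\<integral>\<^sup>+w. ennreal (A w) \<partial>P) + (\<Sum>l. \<integral>\<^sup>+w. S l w \<partial>P)"
    using borel_measurable_integrable[OF A_int] by (subst nn_integral_add) (auto simp: nn_integral_suminf)
  also have "(\<Sum>l. \<integral>\<^sup>+w. S l w \<partial>P) \<le> (\<Sum>l. ennreal B * (\<integral>\<^sup>+w. ennreal (real (m l) ^ (card ?N + 1)) * indicator {w. level w = l} w \<partial>P))"
    by (intro suminf_le S_int) auto
  also have "\<dots> = ennreal B * (\<integral>\<^sup>+w. (\<Sum>l. ennreal (real (m l) ^ (card ?N + 1)) * indicator {w. level w = l} w) \<partial>P)"
    by (subst nn_integral_suminf) (auto intro!: sets_Collect_P)
  also have "\<dots> = ennreal B * (\<integral>\<^sup>+w. ennreal (real (m (level w)) ^ (card ?N + 1)) \<partial>P)"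
  proof -
    have "(\<Sum>l. ennreal (real (m l) ^ (card ?N + 1)) * indicator {w. level w = l} w) = ennreal (real (m (level w)) ^ (card ?N + 1))" for w
      by (subst suminf_finite[of "{level w}"]) (auto simp: indicator_def)
    then show ?thesis by simp
  qed
  finally have le: "(\<integral>\<^sup>+w. ennreal (from_anchor w) \<partial>P) \<le> (\<integral>\<^sup>+w. ennreal (A w) \<partial>P) +
    ennreal B * (\<integral>\<^sup>+w. ennreal (real (m (level w)) ^ (card ?N + 1)) \<partial>P)"
    by (simp add: add_left_mono)
  have "real (m l) ^ (card ?N + 1) = 2 ^ (card ?N + 1) * 16 ^ ((card ?N + 1) * l)" for l
    unfolding m_def of_nat_mult of_nat_power power_mult_distrib power_mult[symmetric]
    by (simp only: mult.commute[of l] of_nat_numeral)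
  then have "integrable P (\<lambda>w. real (m (level w)) ^ (card ?N + 1))"
    using integrable_power_level[of "card ?N + 1"] by (simp only:) (intro integrable_mult_right)
  then have "(\<integral>\<^sup>+w. ennreal (real (m (level w)) ^ (card ?N + 1)) \<partial>P) < \<infinity>"
    by (subst nn_integral_eq_integral) auto
  moreover have "(\<integral>\<^sup>+w. ennreal (A w) \<partial>P) < \<infinity>"
    using A_int A0 by (subst nn_integral_eq_integral) auto
  ultimately show "(\<integral>\<^sup>+w. ennreal (from_anchor w) \<partial>P) < \<infinity>"
    using le by (auto simp: ennreal_mult_less_top intro: le_less_trans)
qed

end

section \<open>Annealed bound and positivity\<close>

lemma nn_integral_avg_le:
  fixes f :: "int ^ 'd::finite \<Rightarrow> 'a \<Rightarrow> real"
  assumes [measurable]: "\<And>z. f z \<in> borel_measurable N" and "\<And>z w. 0 \<le> f z w"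
    and "\<And>z. z \<in> nbrs \<Longrightarrow> (\<integral>\<^sup>+w. ennreal (f z w) \<partial>N) \<le> B"
  shows "(\<integral>\<^sup>+w. ennreal ((\<Sum>z\<in>nbrs. f z w) / card (nbrs :: (int ^ 'd) set)) \<partial>N) \<le> B"
proof -
  let ?c = "card (nbrs :: (int ^ 'd) set)"
  have c: "0 < ?c" by simp
  have "(\<integral>\<^sup>+w. ennreal ((\<Sum>z\<in>nbrs. f z w) / ?c) \<partial>N) = (\<integral>\<^sup>+w. ennreal (1 / ?c) * (\<Sum>z\<in>nbrs. ennreal (f z w)) \<partial>N)"
    using assms(2) by (intro nn_integral_cong) (simp add: sum_ennreal ennreal_mult[symmetric] sum_nonneg)
  also have "\<dots> = ennreal (1 / ?c) * (\<Sum>z\<in>nbrs. \<integral>\<^sup>+w. ennreal (f z w) \<partial>N)"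
    by (subst nn_integral_cmult) (auto simp: nn_integral_sum)
  also have "\<dots> \<le> ennreal (1 / ?c) * (\<Sum>z\<in>(nbrs :: (int ^ 'd) set). B)"
    by (intro mult_left_mono sum_mono assms(3)) auto
  also have "\<dots> = (ennreal (1 / ?c) * ennreal (real ?c)) * B"
    by (simp add: ennreal_of_nat_eq_real_of_nat mult.assoc)
  also have "ennreal (1 / ?c) * ennreal (real ?c) = 1"
    using c by (simp add: ennreal_mult[symmetric] del: card_nbrs_pos)
  finally show ?thesis by simp
qed

definition zero_on :: "'i set \<Rightarrow> ('i \<Rightarrow> real) \<Rightarrow> 'i \<Rightarrow> real" where
  "zero_on A w = (\<lambda>z. if z \<in> A then 0 else w z)"

context iid_env
begin

definition "\<phi> = (\<integral>w. exp (- \<bar>w 0\<bar>) \<partial>P)"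

lemma measurable_zero_on [measurable]: "(\<lambda>w. zero_on A w z) \<in> borel_measurable P"
  by (cases "z \<in> A") (simp_all add: zero_on_def)

lemma exp_coord: "(\<integral>\<^sup>+w. ennreal (exp (- \<bar>w z\<bar>)) \<partial>P) = ennreal \<phi>"
proof -
  have int: "integrable P (\<lambda>w. exp (- \<bar>w 0\<bar>))" by (rule integrable_const_bound[of _ 1]) auto
  have "(\<integral>\<^sup>+w. ennreal (exp (- \<bar>w z\<bar>)) \<partial>P) = (\<integral>\<^sup>+w. ennreal (exp (- \<bar>w 0\<bar>)) \<partial>distr P P (translate z))"
    by (subst nn_integral_distr) (auto simp: translate_def)
  then show ?thesis using int by (simp add: distr_translate \<phi>_def nn_integral_eq_integral)
qed

lemma \<phi>_nonneg: "0 \<le> \<phi>" and \<phi>_le_1: "\<phi> \<le> 1"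
proof -
  have int: "integrable P (\<lambda>w. exp (- \<bar>w 0\<bar>))" by (rule integrable_const_bound[of _ 1]) auto
  show "0 \<le> \<phi>" unfolding \<phi>_def by (intro integral_nonneg_AE) auto
  show "\<phi> \<le> 1" unfolding \<phi>_def by (intro integral_le_const int) auto
qed

lemma \<phi>_pos: "0 < \<phi>"
proof (rule ccontr)
  assume "\<not> 0 < \<phi>"
  then have 0: "\<phi> = 0" using \<phi>_nonneg by simp
  have int: "integrable P (\<lambda>w. exp (- \<bar>w 0\<bar>))" by (rule integrable_const_bound[of _ 1]) auto
  have "AE w in P. exp (- \<bar>w 0\<bar>) = 0"
    using 0 int by (subst integral_nonneg_eq_0_iff_AE[symmetric]) (auto simp: \<phi>_def)
  then have "AE w in P. False" by simp
  then show False by simp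
qed

lemma \<phi>_less_1:
  assumes "\<not> (AE w in P. w 0 = 0)"
  shows "\<phi> < 1"
proof (rule ccontr)
  assume "\<not> \<phi> < 1"
  then have 1: "\<phi> = 1" using \<phi>_le_1 by simp
  have int: "integrable P (\<lambda>w. exp (- \<bar>w 0\<bar>))" by (rule integrable_const_bound[of _ 1]) auto
  then have "(\<integral>w. 1 - exp (- \<bar>w 0\<bar>) \<partial>P) = 0" using 1 by (simp add: \<phi>_def prob_space[unfolded space_P])
  then have "AE w in P. 1 - exp (- \<bar>w 0\<bar>) = 0"
    using int by (subst integral_nonneg_eq_0_iff_AE[symmetric]) auto
  then have "AE w in P. w 0 = 0" by eventually_elim simp
  with assms show False by simp
qed

text \<open>A walk towards \<open>y\<close> pays at least once on every hyperplane it has to cross; \<open>A\<close> collects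
  the sites already visited, where the potential is switched off.\<close>

lemma annealed_green_upto:
  fixes \<sigma> :: int
  assumes \<sigma>: "\<bar>\<sigma>\<bar> = 1" and "\<And>z. z \<in> A \<Longrightarrow> \<sigma> * z $ i \<le> t" "\<sigma> * x $ i \<le> t + 1" "t + 1 \<le> \<sigma> * y $ i"
  shows "(\<integral>\<^sup>+w. ennreal (green_upto (\<lambda>z. ennreal \<bar>zero_on A w z\<bar>) y n x) \<partial>P) \<le> ennreal (\<phi> ^ nat (\<sigma> * y $ i - (t + 1)))"
  using assms(2-)
proof (induction n arbitrary: A x t)
  case 0
  show ?case
  proof (cases "x = y")
    case True
    then have "\<sigma> * y $ i - (t + 1) = 0" using 0 by simp
    then show ?thesis using True emeasure_space_1 by simp
  qed simp
next
  case (Suc n)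
  let ?g = "\<lambda>A w x. green_upto (\<lambda>z. ennreal \<bar>zero_on A w z\<bar>) y n x"
  have le_one: "(\<integral>\<^sup>+w. ennreal (green_upto (\<lambda>z. ennreal \<bar>zero_on A w z\<bar>) y (Suc n) x) \<partial>P) \<le> 1"
  proof -
    have "(\<integral>\<^sup>+w. ennreal (green_upto (\<lambda>z. ennreal \<bar>zero_on A w z\<bar>) y (Suc n) x) \<partial>P) \<le> (\<integral>\<^sup>+w. 1 \<partial>P)"
      by (intro nn_integral_mono) (use green_upto_bounds(2) in \<open>simp del: green_upto.simps\<close>)
    then show ?thesis using emeasure_space_1 by simp
  qed
  show ?case
  proof (cases "t + 1 = \<sigma> * y $ i")
    case True
    then show ?thesis using le_one by simp
  next
    case ne: False
    show ?thesis
    proof (cases "x = y")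
      case True
      then show ?thesis using ne Suc.prems by simp
    next
      case xy: False
      \<comment> \<open>Switching off the potential at x in the continuation only increases the
        Green function, and makes the continuation independent of \<open>w x\<close>.\<close>
      have step: "green_upto (\<lambda>z. ennreal \<bar>zero_on A w z\<bar>) y (Suc n) x \<le>
        exp_minus (ennreal \<bar>zero_on A w x\<bar>) * ((\<Sum>z\<in>nbrs. ?g (insert x A) w (x + z)) / card (nbrs :: (int ^ 'd) set))" for w
        using xy by (auto intro!: mult_left_mono divide_right_mono sum_mono green_upto_antimono simp: exp_minus_bounds zero_on_def)
      have nbr: "\<sigma> * (x + z) $ i \<le> \<sigma> * x $ i + 1" if "z \<in> nbrs" for z
      proof -
        have "\<sigma> * z $ i \<le> \<bar>\<sigma> * z $ i\<bar>" by simp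
        also have "\<dots> \<le> 1" using nbrs_component[OF that, of i] \<sigma> by (simp add: abs_mult)
        finally show ?thesis by (simp add: distrib_left)
      qed
      have g_meas: "(\<lambda>w. ?g (insert x A) w (x + z)) \<in> borel_measurable P" for z by measurable
      have avg: "(\<integral>\<^sup>+w. ennreal ((\<Sum>z\<in>nbrs. ?g (insert x A) w (x + z)) / card (nbrs :: (int ^ 'd) set)) \<partial>P)
        \<le> ennreal (\<phi> ^ nat (\<sigma> * y $ i - (t' + 1)))"
        if t': "\<And>z. z \<in> insert x A \<Longrightarrow> \<sigma> * z $ i \<le> t'" "t' + 1 \<le> \<sigma> * y $ i" for t'
      proof (rule nn_integral_avg_le[OF g_meas])
        fix z :: "int ^ 'd" assume "z \<in> nbrs"
        then have "\<sigma> * (x + z) $ i \<le> t' + 1" using nbr[of z] t'(1)[of x] by simp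
        then show "(\<integral>\<^sup>+w. ennreal (?g (insert x A) w (x + z)) \<partial>P) \<le> ennreal (\<phi> ^ nat (\<sigma> * y $ i - (t' + 1)))"
          using t' by (intro Suc.IH) auto
      qed (rule green_upto_bounds)
      \<comment> \<open>Up to level t nothing is gained and the killing factor is dropped. At level
        t + 1 the site is fresh: its factor is independent of the continuation, contributes \<phi>,
        and the front advances by one.\<close>
      show ?thesis
      proof (cases "\<sigma> * x $ i \<le> t")
        case True
        have "(\<integral>\<^sup>+w. ennreal (green_upto (\<lambda>z. ennreal \<bar>zero_on A w z\<bar>) y (Suc n) x) \<partial>P) \<le>
          (\<integral>\<^sup>+w. ennreal ((\<Sum>z\<in>nbrs. ?g (insert x A) w (x + z)) / card (nbrs :: (int ^ 'd) set)) \<partial>P)"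
        proof (intro nn_integral_mono ennreal_leI order_trans[OF step])
          fix w
          have "0 \<le> (\<Sum>z\<in>nbrs. ?g (insert x A) w (x + z)) / card (nbrs :: (int ^ 'd) set)"
            by (intro divide_nonneg_nonneg sum_nonneg green_upto_bounds) simp
          then show "exp_minus (ennreal \<bar>zero_on A w x\<bar>) * ((\<Sum>z\<in>nbrs. ?g (insert x A) w (x + z)) / card (nbrs :: (int ^ 'd) set))
            \<le> (\<Sum>z\<in>nbrs. ?g (insert x A) w (x + z)) / card (nbrs :: (int ^ 'd) set)"
            by (rule mult_left_le_one_le) (rule exp_minus_bounds)+
        qed
        also have "\<dots> \<le> ennreal (\<phi> ^ nat (\<sigma> * y $ i - (t + 1)))"
          using True Suc.prems by (intro avg) auto
        finally show ?thesis .
      next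
        case False
        then have xt: "\<sigma> * x $ i = t + 1" using Suc.prems by simp
        then have "x \<notin> A" using Suc.prems(1)[of x] by auto
        then have zx: "zero_on A w x = w x" for w by (simp add: zero_on_def)
        let ?a = "\<lambda>w. (\<Sum>z\<in>nbrs. ?g (insert x A) w (x + z)) / card (nbrs :: (int ^ 'd) set)"
        have dep: "depends_on (- {x}) (\<lambda>w. ennreal (?a w))"
        proof -
          have "zero_on (insert x A) w = zero_on (insert x A) w'" if "\<forall>z\<in>-{x}. w z = w' z" for w w'
            using that by (auto simp: zero_on_def fun_eq_iff)
          then show ?thesis unfolding depends_on_def by metis
        qed
        have "(\<integral>\<^sup>+w. ennreal (green_upto (\<lambda>z. ennreal \<bar>zero_on A w z\<bar>) y (Suc n) x) \<partial>P) \<le>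
          (\<integral>\<^sup>+w. ennreal (exp (- \<bar>w x\<bar>)) * ennreal (?a w) \<partial>P)"
        proof (rule nn_integral_mono)
          fix w
          have "green_upto (\<lambda>z. ennreal \<bar>zero_on A w z\<bar>) y (Suc n) x \<le> exp (- \<bar>w x\<bar>) * ?a w"
            using step[of w] unfolding zx by (simp only: exp_minus_ennreal abs_ge_zero)
          then show "ennreal (green_upto (\<lambda>z. ennreal \<bar>zero_on A w z\<bar>) y (Suc n) x) \<le> ennreal (exp (- \<bar>w x\<bar>)) * ennreal (?a w)"
            by (subst ennreal_mult'[symmetric]) (auto intro: ennreal_leI)
        qed
        also have "\<dots> = (\<integral>\<^sup>+w. ennreal (exp (- \<bar>w x\<bar>)) \<partial>P) * (\<integral>\<^sup>+w. ennreal (?a w) \<partial>P)"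
          using g_meas dep by (intro nn_integral_indep[where A="{x}" and B="- {x}"]) (auto simp: depends_on_def)
        also have "\<dots> \<le> ennreal \<phi> * ennreal (\<phi> ^ nat (\<sigma> * y $ i - ((t + 1) + 1)))"
          unfolding exp_coord using xt Suc.prems ne by (intro mult_left_mono avg) (force simp: order_trans)+
        also have "\<dots> = ennreal (\<phi> ^ Suc (nat (\<sigma> * y $ i - ((t + 1) + 1))))"
          using \<phi>_nonneg by (simp add: ennreal_mult)
        also have "Suc (nat (\<sigma> * y $ i - ((t + 1) + 1))) = nat (\<sigma> * y $ i - (t + 1))"
          using ne Suc.prems by simp
        finally show ?thesis .
      qed
    qed
  qed
qed

lemma annealed_cost:
  fixes y :: "int ^ 'd"
  shows "(\<integral>\<^sup>+w. ennreal (exp (- cost w 0 y)) \<partial>P) \<le> ennreal (\<phi> ^ nat \<bar>y $ i\<bar>)"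
proof -
  define \<sigma> :: int where "\<sigma> = (if 0 \<le> y $ i then 1 else - 1)"
  have \<sigma>: "\<bar>\<sigma>\<bar> = 1" "\<sigma> * y $ i = \<bar>y $ i\<bar>" by (auto simp: \<sigma>_def)
  \<comment> \<open>No site has been visited and the front stands just behind the origin, hence t =
    -1.\<close>
  have upto: "(\<integral>\<^sup>+w. ennreal (green_upto (\<lambda>z. ennreal \<bar>w z\<bar>) y n 0) \<partial>P) \<le> ennreal (\<phi> ^ nat \<bar>y $ i\<bar>)" for n
    using annealed_green_upto[OF \<sigma>(1), of "{}" i "-1" 0 y n] by (simp add: \<sigma>(2) zero_on_def)
  have "(\<integral>\<^sup>+w. ennreal (exp (- cost w 0 y)) \<partial>P) = (\<integral>\<^sup>+w. liminf (\<lambda>n. ennreal (green_upto (\<lambda>z. ennreal \<bar>w z\<bar>) y n 0)) \<partial>P)"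
    unfolding exp_minus_cost
    by (intro nn_integral_cong lim_imp_Liminf[symmetric]) (auto intro!: tendsto_ennrealI green_upto_tendsto)
  also have "\<dots> \<le> liminf (\<lambda>n. \<integral>\<^sup>+w. ennreal (green_upto (\<lambda>z. ennreal \<bar>w z\<bar>) y n 0) \<partial>P)"
    by (rule nn_integral_liminf) measurable
  also have "\<dots> \<le> ennreal (\<phi> ^ nat \<bar>y $ i\<bar>)"
    by (rule Liminf_le) (use upto in auto)
  finally show ?thesis .
qed

end

context sparse_env
begin

section \<open>Norm properties of the time constant\<close>

lemma time_constant_0 [simp]: "time_constant 0 = 0"
proof -
  have "anchor_cost 0 n = (\<lambda>_. 0)" for n by (auto simp: anchor_cost_def fun_eq_iff)
  then show ?thesis by (simp add: time_constant_def)
qed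

lemma cost_conv_prob': "conv_prob (\<lambda>n w. cost w 0 (int n *s x) / real n) (time_constant x)"
proof (cases "x = 0")
  case True
  then show ?thesis using conv_prob_div[of "\<lambda>w. 0"] by simp
qed (rule cost_conv_prob)

lemma time_constant_nonneg: "0 \<le> time_constant x"
proof (rule conv_prob_le[OF _ cost_conv_prob'[of x]])
  show "conv_prob (\<lambda>n w. 0 / real n) 0" by (rule conv_prob_div) simp
qed (simp add: cost_nonneg)

text \<open>The second leg starts at nx, but its cost has the law of the cost from 0 to ny, so it
  has the same limit in probability.\<close>

lemma time_constant_triangle: "time_constant (x + y) \<le> time_constant x + time_constant y"
proof (rule conv_prob_le[OF cost_conv_prob'])
  show "conv_prob (\<lambda>n w. cost w 0 (int n *s x) / real n + cost (translate (int n *s x) w) 0 (int n *s y) / real n)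
    (time_constant x + time_constant y)"
    by (intro conv_prob_add cost_conv_prob' conv_prob_translate[where t="\<lambda>n. int n *s x"])
  fix n
  have 1: "int n *s y + int n *s x = int n *s (x + y)" by (simp add: vec_eq_iff algebra_simps)
  have "cost w 0 (int n *s (x + y)) \<le> cost w 0 (int n *s x) + cost (translate (int n *s x) w) 0 (int n *s y)" for w
    using cost_triangle[of w 0 "int n *s (x + y)" "int n *s x"] by (simp add: cost_translate 1)
  then show "AE w in P. cost w 0 (int n *s (x + y)) / real n \<le>
    cost w 0 (int n *s x) / real n + cost (translate (int n *s x) w) 0 (int n *s y) / real n"
    unfolding add_divide_distrib[symmetric] by (intro AE_I2 divide_right_mono) auto
qed

text \<open>Both sides are limits in probability of one sequence, as the multiples nk form a
  subsequence.\<close>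

lemma time_constant_scale: "time_constant (int k *s x) = real k * time_constant x"
proof (cases "k = 0")
  case True
  have "int 0 *s x = 0" by (simp add: vec_eq_iff)
  with True show ?thesis by simp
next
  case False
  have "filterlim (\<lambda>n. n * k) sequentially sequentially"
    by (rule filterlim_subseq) (use False in \<open>simp add: strict_mono_def\<close>)
  from conv_prob_subseq[OF cost_conv_prob'[of x] this]
  have "conv_prob (\<lambda>n w. real k * (cost w 0 (int (n * k) *s x) / real (n * k))) (real k * time_constant x)"
    using False by (intro conv_prob_cmult) auto
  moreover have "real k * (cost w 0 (int (n * k) *s x) / real (n * k)) = cost w 0 (int n *s (int k *s x)) / real n" for n w
  proof -
    have "int (n * k) *s x = int n *s (int k *s x)" by (simp add: vec_eq_iff algebra_simps)
    then show ?thesis using False by simp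
  qed
  ultimately show ?thesis using cost_conv_prob'[of "int k *s x"] by (intro conv_prob_unique) simp_all
qed

text \<open>The product law is invariant under reflection of the lattice, and so is the simple
  random walk.\<close>

lemma time_constant_uminus: "time_constant (- x) = time_constant x"
proof -
  have r: "(\<lambda>w z. w (- z)) \<in> measurable P P" by (rule measurable_into_P) simp
  have "conv_prob (\<lambda>n w. cost w 0 (int n *s (- x)) / real n) (time_constant x)"
    unfolding conv_prob_def
  proof (intro conjI allI impI)
    show "(\<lambda>w. cost w 0 (int n *s (- x)) / real n) \<in> borel_measurable P" for n by measurable
    fix e :: real assume e: "0 < e"
    have "prob {w \<in> space P. e < \<bar>cost w 0 (int n *s (- x)) / real n - time_constant x\<bar>} =
      prob {w \<in> space P. e < \<bar>cost w 0 (int n *s x) / real n - time_constant x\<bar>}" for n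
    proof -
      have S: "{w \<in> space P. e < \<bar>cost w 0 (int n *s x) / real n - time_constant x\<bar>} \<in> sets P" by measurable
      have u: "- (int n *s x) = int n *s (- x)" by (simp add: vec_eq_iff)
      have "prob {w \<in> space P. e < \<bar>cost w 0 (int n *s x) / real n - time_constant x\<bar>} =
        measure (distr P P (\<lambda>w z. w (- z))) {w \<in> space P. e < \<bar>cost w 0 (int n *s x) / real n - time_constant x\<bar>}"
        by (simp add: distr_reflect)
      also have "\<dots> = prob {w \<in> space P. e < \<bar>cost w 0 (int n *s (- x)) / real n - time_constant x\<bar>}"
        by (subst measure_distr[OF r S]) (simp only: vimage_def cost_uminus u minus_zero space_P Int_UNIV_right mem_Collect_eq UNIV_I simp_thms)
      finally show ?thesis by (rule sym)
    qed
    then show "(\<lambda>n. prob {w \<in> space P. e < \<bar>cost w 0 (int n *s (- x)) / real n - time_constant x\<bar>}) \<longlonglongrightarrow> 0"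
      using conv_probD[OF cost_conv_prob'[of x] e] by (simp only:)
  qed
  with cost_conv_prob'[of "- x"] show ?thesis by (rule conv_prob_unique)
qed

text \<open>By Markov's inequality and the annealed bound, the cost to nx is at most cn with
  probability at most \<open>exp (c * n) * \<phi>^(n * \<bar>x $ i\<bar>)\<close>. This decays for c
  below the left-hand side, so the limit in probability cannot lie there.\<close>

theorem time_constant_lower:
  "real_of_int \<bar>x $ i\<bar> * (- ln \<phi>) \<le> time_constant x"
proof (rule ccontr)
  assume less: "\<not> ?thesis"
  define a where "a = real_of_int \<bar>x $ i\<bar> * (- ln \<phi>)"
  \<comment> \<open>A third of the gap keeps \<open>c\<close>, the upper end of the deviation
    window, at distance \<open>2 * e\<close> below \<open>a\<close>.\<close>
  define e where "e = (a - time_constant x) / 3"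
  have e: "0 < e" using less by (simp add: e_def a_def)
  define c where "c = time_constant x + e"
  have ca: "c < a" and c_eq: "c - a = - (2 * e)" using e by (auto simp: c_def e_def field_simps)
  have "prob {w \<in> space P. \<not> e < \<bar>cost w 0 (int n *s x) / real n - time_constant x\<bar>} \<le> exp (- (2 * e)) ^ n" if n: "0 < n" for n
  proof -
    have "emeasure P {w \<in> space P. \<not> e < \<bar>cost w 0 (int n *s x) / real n - time_constant x\<bar>} =
      (\<integral>\<^sup>+w. indicator {w \<in> space P. \<not> e < \<bar>cost w 0 (int n *s x) / real n - time_constant x\<bar>} w \<partial>P)"
      by (rule nn_integral_indicator[symmetric]) measurable
    also have "\<dots> \<le> (\<integral>\<^sup>+w. ennreal (exp (c * n)) * ennreal (exp (- cost w 0 (int n *s x))) \<partial>P)"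
    proof (rule nn_integral_mono)
      fix w
      have "1 \<le> exp (c * n) * exp (- cost w 0 (int n *s x))"
        if "\<not> e < \<bar>cost w 0 (int n *s x) / real n - time_constant x\<bar>"
      proof -
        have "cost w 0 (int n *s x) / real n \<le> c" using that by (simp add: c_def)
        then have "cost w 0 (int n *s x) \<le> c * n" using n by (simp add: field_simps)
        then show ?thesis by (simp add: exp_add[symmetric])
      qed
      then show "indicator {w \<in> space P. \<not> e < \<bar>cost w 0 (int n *s x) / real n - time_constant x\<bar>} w \<le>
        ennreal (exp (c * n)) * ennreal (exp (- cost w 0 (int n *s x)))"
        by (auto simp: indicator_def ennreal_mult[symmetric])
    qed
    also have "\<dots> = ennreal (exp (c * n)) * (\<integral>\<^sup>+w. ennreal (exp (- cost w 0 (int n *s x))) \<partial>P)"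
      by (rule nn_integral_cmult) measurable
    also have "\<dots> \<le> ennreal (exp (c * n)) * ennreal (\<phi> ^ nat \<bar>(int n *s x) $ i\<bar>)"
      by (intro mult_left_mono annealed_cost) simp
    also have "\<dots> = ennreal (exp (c * n) * \<phi> ^ nat \<bar>(int n *s x) $ i\<bar>)"
      by (rule ennreal_mult[symmetric]) (use \<phi>_nonneg in auto)
    also have "exp (c * n) * \<phi> ^ nat \<bar>(int n *s x) $ i\<bar> = exp (- (2 * e)) ^ n"
    proof -
      have "\<phi> ^ nat \<bar>(int n *s x) $ i\<bar> = exp (real (nat \<bar>(int n *s x) $ i\<bar>) * ln \<phi>)"
        by (simp only: exp_of_nat_mult exp_ln[OF \<phi>_pos])
      also have "real (nat \<bar>(int n *s x) $ i\<bar>) * ln \<phi> = - (a * n)"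
        by (simp add: a_def abs_mult)
      finally have "exp (c * n) * \<phi> ^ nat \<bar>(int n *s x) $ i\<bar> = exp (real n * (c - a))"
        by (simp add: exp_add[symmetric] algebra_simps)
      then show ?thesis unfolding c_eq exp_of_nat_mult .
    qed
    finally show ?thesis by (simp add: emeasure_eq_measure)
  qed
  then have bound: "1 - prob {w \<in> space P. e < \<bar>cost w 0 (int n *s x) / real n - time_constant x\<bar>} \<le> exp (- (2 * e)) ^ n" if "0 < n" for n
  proof -
    have "prob {w \<in> space P. \<not> e < \<bar>cost w 0 (int n *s x) / real n - time_constant x\<bar>} =
      1 - prob {w \<in> space P. e < \<bar>cost w 0 (int n *s x) / real n - time_constant x\<bar>}"
      by (rule prob_neg) measurable
    with \<open>\<And>n. 0 < n \<Longrightarrow> prob {w \<in> space P. \<not> e < \<bar>cost w 0 (int n *s x) / real n - time_constant x\<bar>} \<le> exp (- (2 * e)) ^ n\<close>[OF that]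
    show ?thesis by simp
  qed
  have "(\<lambda>n. 1 - prob {w \<in> space P. e < \<bar>cost w 0 (int n *s x) / real n - time_constant x\<bar>}) \<longlonglongrightarrow> 1 - 0"
    by (intro tendsto_diff tendsto_const conv_probD[OF cost_conv_prob' e])
  moreover have "(\<lambda>n. exp (- (2 * e)) ^ n) \<longlonglongrightarrow> 0"
    using e by (intro LIMSEQ_realpow_zero) auto
  ultimately have "(1::real) - 0 \<le> 0"
    by (rule LIMSEQ_le) (use bound in \<open>auto intro!: exI[of _ 1]\<close>)
  then show False by simp
qed

end

section \<open>Extension of lattice norms\<close>

lemma to_real_vec_nth [simp]: "to_real_vec x $ i = real_of_int (x $ i)"
  by (simp add: to_real_vec_def)

lemma le_of_linear_bound:
  fixes s t B :: real
  assumes "\<And>n::nat. 0 < n \<Longrightarrow> real n * s \<le> real n * t + B"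
  shows "s \<le> t"
proof (rule ccontr)
  assume "\<not> s \<le> t"
  then have st: "0 < s - t" by simp
  obtain n :: nat where n: "B / (s - t) < n" using reals_Archimedean2 by blast
  define m where "m = max 1 n"
  have "B < real n * (s - t)" using n st by (simp add: field_simps)
  also have "\<dots> \<le> real m * (s - t)" using st by (intro mult_right_mono) (auto simp: m_def)
  finally have "B < real m * s - real m * t" by (simp add: right_diff_distrib)
  moreover have "0 < m" by (simp add: m_def)
  ultimately show False using assms[of m] by linarith
qed

lemma eq_of_linear_bound:
  fixes s t B :: real
  assumes "\<And>n::nat. 0 < n \<Longrightarrow> \<bar>real n * s - real n * t\<bar> \<le> B"
  shows "s = t"
proof (rule antisym)
  have "real n * s \<le> real n * t + B" "real n * t \<le> real n * s + B" if "0 < n" for n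
    using assms[OF that] by linarith+
  then show "s \<le> t" "t \<le> s" by (blast intro: le_of_linear_bound)+
qed

text \<open>The norm of u is the limit of \<open>a\<close> at the rounded point nu, divided by n.
  Since \<open>a\<close> is Lipschitz on the lattice, rounding errors stay bounded, and each norm
  axiom follows from an inequality with bounded error after division by n.\<close>

lemma lattice_norm_extension:
  fixes a :: "int ^ 'd::finite \<Rightarrow> real"
  assumes tri: "\<And>x y. a (x + y) \<le> a x + a y" and nonneg: "\<And>x. 0 \<le> a x"
    and scale: "\<And>k x. a (int k *s x) = real k * a x" and sym: "\<And>x. a (- x) = a x"
    and c: "0 < c" "\<And>x i. c * real_of_int \<bar>x $ i\<bar> \<le> a x"
  shows "\<exists>N. is_norm N \<and> (\<forall>x. N (to_real_vec x) = a x)"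
proof -
  define C where "C = (\<Sum>z\<in>nbrs. a z)"
  have C: "0 \<le> C" unfolding C_def by (simp add: sum_nonneg nonneg)
  have a0: "a 0 = 0" using scale[of 0 0] by (simp add: vec_eq_iff vector_scalar_mult_def zero_vec_def)
  have l1: "a x \<le> C * real (l1_dist x 0)" for x
  proof (induction "l1_dist x 0" arbitrary: x)
    case 0
    have "x = 0"
    proof (rule ccontr)
      assume "x \<noteq> 0"
      then obtain z i where "z = axis i 1 \<or> z = axis i (-1)" "l1_dist x 0 = Suc (l1_dist (x + z) 0)"
        by (rule l1_dist_step)
      with 0 show False by simp
    qed
    then show ?case using a0 C by simp
  next
    case (Suc n)
    then have "x \<noteq> 0" by (auto simp: l1_dist_def)
    then obtain z i where z: "z = axis i 1 \<or> z = axis i (-1)" "l1_dist x 0 = Suc (l1_dist (x + z) 0)"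
      by (rule l1_dist_step)
    then have "z \<in> nbrs" by (auto simp: axis_in_nbrs)
    then have "a z \<le> C" unfolding C_def by (intro member_le_sum) (auto simp: nonneg)
    moreover have "a (x + z) \<le> C * real (l1_dist (x + z) 0)" using Suc z(2) by simp
    moreover have "a x \<le> a (x + z) + a z" using tri[of "x + z" "- z"] by (simp add: sym)
    ultimately show ?case unfolding z(2) by (simp add: algebra_simps)
  qed
  define D where "D = C * CARD('d)"
  have D: "0 \<le> D" by (simp add: D_def C)
  have lip: "\<bar>a x - a y\<bar> \<le> D * r" if "\<And>i. real_of_int \<bar>x $ i - y $ i\<bar> \<le> r" for x y r
  proof -
    have "real (l1_dist (x - y) 0) = (\<Sum>i\<in>UNIV. real_of_int \<bar>x $ i - y $ i\<bar>)"
      by (simp add: l1_dist_def)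
    also have "\<dots> \<le> CARD('d) * r" by (rule sum_bounded_above) (rule that)
    finally have "C * real (l1_dist (x - y) 0) \<le> C * (CARD('d) * r)" using C by (intro mult_left_mono)
    then have "a (x - y) \<le> D * r" using l1[of "x - y"] by (simp add: D_def)
    moreover have "a (y - x) = a (x - y)" using sym[of "x - y"] by simp
    ultimately show ?thesis using tri[of "x - y" y] tri[of "y - x" x] by (simp add: abs_le_iff)
  qed
  define fl :: "real ^ 'd \<Rightarrow> int ^ 'd" where "fl u = (\<chi> i. \<lfloor>u $ i\<rfloor>)" for u
  have fl: "\<bar>real_of_int (fl u $ i) - u $ i\<bar> \<le> 1" for u i
    by (simp add: fl_def) linarith
  \<comment> \<open>The m-fold of the rounding of nu and the n-fold of the rounding of mu are both
    close to nmu, where \<open>a\<close> is compared.\<close>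
  have cauchy: "\<bar>a (fl (real n *\<^sub>R u)) / n - a (fl (real m *\<^sub>R u)) / m\<bar> \<le> D / m + D / n" if "0 < n" "0 < m" for n m u
  proof -
    let ?x = "int m *s fl (real n *\<^sub>R u)" and ?y = "int n *s fl (real m *\<^sub>R u)"
    have "real_of_int \<bar>?x $ i - ?y $ i\<bar> \<le> real m + real n" for i
    proof -
      have "\<bar>real m * (real_of_int (fl (real n *\<^sub>R u) $ i) - real n * u $ i)\<bar> \<le> real m * 1"
        unfolding abs_mult using fl[of "real n *\<^sub>R u" i] by (intro mult_mono) auto
      moreover have "\<bar>real n * (real_of_int (fl (real m *\<^sub>R u) $ i) - real m * u $ i)\<bar> \<le> real n * 1"
        unfolding abs_mult using fl[of "real m *\<^sub>R u" i] by (intro mult_mono) auto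
      ultimately show ?thesis by (simp add: algebra_simps abs_le_iff)
    qed
    then have "\<bar>a ?x - a ?y\<bar> \<le> D * (real m + real n)" by (rule lip)
    then have "\<bar>real m * a (fl (real n *\<^sub>R u)) - real n * a (fl (real m *\<^sub>R u))\<bar> / (real n * real m) \<le> D * (real m + real n) / (real n * real m)"
      unfolding scale by (intro divide_right_mono) auto
    moreover have "D * (real m + real n) / (real n * real m) = D / m + D / n" using that by (simp add: field_simps)
    moreover have "\<bar>real m * a (fl (real n *\<^sub>R u)) - real n * a (fl (real m *\<^sub>R u))\<bar> / (real n * real m) =
      \<bar>a (fl (real n *\<^sub>R u)) / n - a (fl (real m *\<^sub>R u)) / m\<bar>"
    proof -
      have "a (fl (real n *\<^sub>R u)) / n - a (fl (real m *\<^sub>R u)) / m =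
        (real m * a (fl (real n *\<^sub>R u)) - real n * a (fl (real m *\<^sub>R u))) / (real n * real m)"
        using that by (simp add: field_simps)
      then show ?thesis by (simp add: abs_divide)
    qed
    ultimately show ?thesis by simp
  qed
  have Cauchy: "Cauchy (\<lambda>n. a (fl (real n *\<^sub>R u)) / n)" for u
  proof (rule metric_CauchyI)
    fix e :: real assume e: "0 < e"
    obtain M :: nat where M: "2 * D / e < M" using reals_Archimedean2 by blast
    have "dist (a (fl (real m *\<^sub>R u)) / m) (a (fl (real n *\<^sub>R u)) / n) < e" if "max 1 M \<le> m" "max 1 M \<le> n" for m n
    proof -
      have s: "D / k < e / 2" if "max 1 M \<le> k" for k
      proof -
        have "2 * D < e * M" using M e by (simp add: field_simps)
        also have "\<dots> \<le> e * k" using that e by (intro mult_left_mono) auto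
        finally show ?thesis using that by (simp add: field_simps)
      qed
      have "0 < m" "0 < n" using that by auto
      then show ?thesis unfolding dist_real_def
        using cauchy[of m n u] s[OF that(1)] s[OF that(2)] by linarith
    qed
    then show "\<exists>M. \<forall>m\<ge>M. \<forall>n\<ge>M. dist (a (fl (real m *\<^sub>R u)) / m) (a (fl (real n *\<^sub>R u)) / n) < e" by blast
  qed
  define N where "N u = lim (\<lambda>n. a (fl (real n *\<^sub>R u)) / n)" for u
  have lim: "(\<lambda>n. a (fl (real n *\<^sub>R u)) / n) \<longlonglongrightarrow> N u" for u
    unfolding N_def using Cauchy_convergent[OF Cauchy] by (simp add: convergent_LIMSEQ_iff)
  have near: "\<bar>a (fl (real n *\<^sub>R u)) - n * N u\<bar> \<le> D" if n: "0 < n" for u and n :: nat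
  proof -
    have "(\<lambda>m. \<bar>a (fl (real n *\<^sub>R u)) / n - a (fl (real m *\<^sub>R u)) / m\<bar>) \<longlonglongrightarrow> \<bar>a (fl (real n *\<^sub>R u)) / n - N u\<bar>"
      by (intro tendsto_intros lim)
    moreover have "(\<lambda>m. D / real m + D / n) \<longlonglongrightarrow> 0 + D / n"
      by (intro tendsto_add tendsto_const lim_const_over_n)
    ultimately have "\<bar>a (fl (real n *\<^sub>R u)) / n - N u\<bar> \<le> 0 + D / n"
      by (rule LIMSEQ_le) (use cauchy[OF n] in \<open>auto intro!: exI[of _ 1]\<close>)
    moreover have "a (fl (real n *\<^sub>R u)) / n - N u = (a (fl (real n *\<^sub>R u)) - n * N u) / n"
      using n by (simp add: field_simps)
    ultimately show ?thesis using n by (simp add: abs_divide field_simps)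
  qed
  \<comment> \<open>Any lattice point at bounded distance from nu may replace the rounded one. The
    axioms are obtained by inserting sums, negatives and multiples of rounded points.\<close>
  have key: "\<bar>a z - n * N u\<bar> \<le> D * (r + 2)" if "\<And>i. \<bar>real_of_int (z $ i) - n * u $ i\<bar> \<le> r" "0 < n" for z u r and n :: nat
  proof -
    have "real_of_int \<bar>z $ i - fl (real n *\<^sub>R u) $ i\<bar> \<le> r + 1" for i
      using that(1)[of i] fl[of "real n *\<^sub>R u" i] by simp
    then have "\<bar>a z - a (fl (real n *\<^sub>R u))\<bar> \<le> D * (r + 1)" by (rule lip)
    then show ?thesis using near[OF that(2), of u] by (simp add: algebra_simps)
  qed
  have N_lattice: "N (to_real_vec x) = a x" for x
  proof -
    have k: "\<bar>n * a x - n * N (to_real_vec x)\<bar> \<le> D * (0 + 2)" if "0 < n" for n :: nat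
      unfolding scale[symmetric] using that by (intro key) simp_all
    show ?thesis by (rule eq_of_linear_bound[OF k, symmetric])
  qed
  have N_tri: "N (u + w) \<le> N u + N w" for u w
  proof (rule le_of_linear_bound[of _ _ "D * 10"])
    fix n :: nat assume n: "0 < n"
    have 1: "\<bar>a (fl (real n *\<^sub>R u) + fl (real n *\<^sub>R w)) - n * N (u + w)\<bar> \<le> D * (2 + 2)"
    proof (rule key[OF _ n])
      fix i
      show "\<bar>real_of_int ((fl (real n *\<^sub>R u) + fl (real n *\<^sub>R w)) $ i) - n * (u + w) $ i\<bar> \<le> 2"
        using fl[of "real n *\<^sub>R u" i] fl[of "real n *\<^sub>R w" i] by (simp add: algebra_simps)
    qed
    show "n * N (u + w) \<le> n * (N u + N w) + D * 10"
      using 1 near[OF n, of u] near[OF n, of w] tri[of "fl (real n *\<^sub>R u)" "fl (real n *\<^sub>R w)"] D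
      by (simp add: algebra_simps abs_le_iff)
  qed
  have N_uminus: "N (- u) = N u" for u
  proof -
    have le: "N (- u) \<le> N u" for u
    proof (rule le_of_linear_bound[of _ _ "D * 4"])
      fix n :: nat assume n: "0 < n"
      have "\<bar>a (- fl (real n *\<^sub>R u)) - n * N (- u)\<bar> \<le> D * (1 + 2)"
      proof (rule key[OF _ n])
        fix i show "\<bar>real_of_int ((- fl (real n *\<^sub>R u)) $ i) - n * (- u) $ i\<bar> \<le> 1"
          using fl[of "real n *\<^sub>R u" i] by simp
      qed
      then show "n * N (- u) \<le> n * N u + D * 4" using near[OF n, of u] by (simp add: sym abs_le_iff)
    qed
    show ?thesis using le[of u] le[of "- u"] by simp
  qed
  have N_pos: "c * \<bar>u $ i\<bar> \<le> N u" for u i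
  proof (rule le_of_linear_bound[of _ _ "c + D"])
    fix n :: nat assume n: "0 < n"
    have "c * (n * \<bar>u $ i\<bar> - 1) \<le> c * real_of_int \<bar>fl (real n *\<^sub>R u) $ i\<bar>"
      using fl[of "real n *\<^sub>R u" i] c(1)
      by (intro mult_left_mono) (simp_all add: abs_mult[of "real n", simplified, symmetric])
    also have "\<dots> \<le> a (fl (real n *\<^sub>R u))" by (rule c(2))
    finally show "n * (c * \<bar>u $ i\<bar>) \<le> n * N u + (c + D)" using near[OF n, of u] by (simp add: algebra_simps abs_le_iff)
  qed
  have N_nonneg: "0 \<le> N u" for u
  proof -
    obtain i :: 'd where True by simp
    have "0 \<le> c * \<bar>u $ i\<bar>" using c(1) by simp
    then show ?thesis using N_pos[of u i] by simp
  qed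
  have N_scale: "N (s *\<^sub>R u) = s * N u" if s: "0 < s" for s u
  proof -
    define R where "R = (\<Sum>i\<in>UNIV. \<bar>u $ i\<bar>)"
    have R: "\<bar>u $ i\<bar> \<le> R" for i unfolding R_def by (rule member_le_sum) auto
    have k: "\<bar>n * N (s *\<^sub>R u) - n * (s * N u)\<bar> \<le> D * (1 + R + 2) + D * 3 + N u" if n: "0 < n" for n :: nat
    proof -
      \<comment> \<open>An integer close to ns, so that the rounding of mu approximates n times
        \<open>s *\<^sub>R u\<close>.\<close>
      define m where "m = nat \<lceil>n * s\<rceil>"
      have m: "0 < m" using n s by (simp add: m_def)
      have ms: "\<bar>real m - n * s\<bar> \<le> 1" using n s by (simp add: m_def) linarith
      have "\<bar>a (fl (real m *\<^sub>R u)) - n * N (s *\<^sub>R u)\<bar> \<le> D * (1 + R + 2)"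
      proof (rule key[OF _ n])
        fix i
        have "\<bar>(real m - n * s) * u $ i\<bar> \<le> 1 * R" unfolding abs_mult using ms R[of i] by (intro mult_mono) auto
        then show "\<bar>real_of_int (fl (real m *\<^sub>R u) $ i) - n * (s *\<^sub>R u) $ i\<bar> \<le> 1 + R"
          using fl[of "real m *\<^sub>R u" i] by (simp add: algebra_simps abs_le_iff)
      qed
      moreover have "\<bar>a (fl (real m *\<^sub>R u)) - m * N u\<bar> \<le> D" by (rule near[OF m])
      moreover have "\<bar>(real m - n * s) * N u\<bar> \<le> 1 * N u"
        unfolding abs_mult using ms N_nonneg[of u] by (intro mult_mono) auto
      ultimately show ?thesis using D by (simp add: algebra_simps abs_le_iff)
    qed
    show ?thesis by (rule eq_of_linear_bound[OF k])
  qed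
  have N0: "N 0 = 0"
  proof -
    have "to_real_vec 0 = (0 :: real ^ 'd)" by (simp add: vec_eq_iff)
    then show ?thesis using N_lattice[of 0] a0 by simp
  qed
  have "is_norm N"
    unfolding is_norm_def
  proof (intro conjI allI)
    fix u show "0 \<le> N u" by (rule N_nonneg)
    show "N u = 0 \<longleftrightarrow> u = 0"
    proof
      assume "N u = 0"
      then have "c * \<bar>u $ i\<bar> \<le> 0" for i using N_pos[of u i] by simp
      then have "u $ i = 0" for i using c(1) by (simp add: mult_le_0_iff)
      then show "u = 0" by (simp add: vec_eq_iff)
    qed (simp add: N0)
  next
    fix s u
    show "N (s *\<^sub>R u) = \<bar>s\<bar> * N u"
    proof (cases s "0 :: real" rule: linorder_cases)
      case less
      then have "N (- ((- s) *\<^sub>R u)) = (- s) * N u" unfolding N_uminus by (intro N_scale) simp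
      then show ?thesis using less by simp
    qed (auto simp: N0 N_scale)
  qed (rule N_tri)
  with N_lattice show ?thesis by blast
qed

section \<open>Necessity of the moment conditions\<close>

context prob_space
begin

lemma conv_prob_uminus: "conv_prob X c \<Longrightarrow> conv_prob (\<lambda>n w. - X n w) (- c)"
  by (simp add: conv_prob_def abs_minus_commute)

text \<open>Staying above \<open>a + r\<close> from some index on is contained in deviation events
  of vanishing probability. This is the upper half of the statement on the lower limit.\<close>

lemma conv_prob_frequently:
  assumes X: "conv_prob X a"
  shows "AE w in M. \<forall>c>a. \<exists>\<^sub>F n in sequentially. X n w < c"
proof -
  note [measurable] = conv_prob_measurable[OF X]
  have "AE w in M. \<exists>n\<ge>m. X n w < a + 1 / Suc k" for m k :: nat
  proof -
    define r where "r = 1 / real (Suc k)"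
    define A where "A = {w \<in> space M. \<forall>n\<ge>m. a + r \<le> X n w}"
    have [measurable]: "A \<in> sets M" unfolding A_def by measurable
    have pos: "0 < r / 2" by (simp add: r_def)
    have "prob A \<le> prob {w \<in> space M. r / 2 < \<bar>X n w - a\<bar>}" if n: "m \<le> n" for n
    proof (intro finite_measure_mono subsetI)
      fix w assume "w \<in> A"
      then have w: "w \<in> space M" "a + r \<le> X n w" using n by (auto simp: A_def)
      then have "r / 2 < \<bar>X n w - a\<bar>" using pos by linarith
      with w show "w \<in> {w \<in> space M. r / 2 < \<bar>X n w - a\<bar>}" by simp
    qed measurable
    then have "prob A \<le> 0"
      by (intro LIMSEQ_le_const[OF conv_probD[OF X pos]]) auto
    then have "prob A = 0" using measure_nonneg[of M A] by simp
    then have "AE w in M. w \<notin> A" by (simp add: prob_eq_0)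
    then show ?thesis using AE_space by eventually_elim (auto simp: A_def not_le r_def)
  qed
  then have "AE w in M. \<forall>m k. \<exists>n\<ge>m. X n w < a + 1 / Suc k"
    unfolding AE_all_countable by blast
  then show ?thesis
  proof eventually_elim
    case (elim w)
    show ?case
    proof (intro allI impI)
      fix c assume "a < c"
      then obtain k where k: "1 / real (Suc k) < c - a" using nat_approx_posE[of "c - a"] by auto
      show "\<exists>\<^sub>F n in sequentially. X n w < c"
        unfolding frequently_sequentially
      proof
        fix m
        obtain n where "m \<le> n" "X n w < a + 1 / Suc k" using elim by blast
        then show "\<exists>n\<ge>m. X n w < c" using k by (intro exI[of _ n]) simp
      qed
    qed
  qed
qed

text \<open>L is the difference of two sequences that converge in probability to constants, so the
  constant sequence L converges to a.\<close>

lemma conv_prob_limit_unique: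
  assumes X: "conv_prob X a" and L: "L \<in> borel_measurable M" and XL: "conv_prob (\<lambda>n w. X n w - L w) 0"
  shows "AE w in M. L w = a"
proof -
  have "conv_prob (\<lambda>n w. X n w + - (X n w - L w)) (a + - 0)"
    by (intro conv_prob_add X conv_prob_uminus XL)
  then have c: "conv_prob (\<lambda>n::nat. L) a" by simp
  have "AE w in M. \<bar>L w - a\<bar> \<le> 1 / Suc k" for k :: nat
  proof -
    have "prob {w \<in> space M. 1 / real (Suc k) < \<bar>L w - a\<bar>} = 0"
      using conv_probD[OF c, of "1 / real (Suc k)"] by (simp add: tendsto_const_iff)
    moreover have "{w \<in> space M. 1 / real (Suc k) < \<bar>L w - a\<bar>} \<in> sets M" using L by measurable
    ultimately have "AE w in M. w \<notin> {w \<in> space M. 1 / real (Suc k) < \<bar>L w - a\<bar>}" by (simp add: prob_eq_0)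
    then show ?thesis using AE_space by eventually_elim (auto simp: not_less)
  qed
  then have "AE w in M. \<forall>k::nat. \<bar>L w - a\<bar> \<le> 1 / Suc k" unfolding AE_all_countable by blast
  then show ?thesis
  proof eventually_elim
    case (elim w)
    show ?case
    proof (rule ccontr)
      assume "L w \<noteq> a"
      then obtain k where "1 / real (Suc k) < \<bar>L w - a\<bar>" using nat_approx_posE[of "\<bar>L w - a\<bar>"] by auto
      with elim show False by (simp add: not_le[symmetric])
    qed
  qed
qed

end

text \<open>A layer-cake bound: it turns an infinite mean into divergence of the sum of
  \<open>P(b * n < Z)\<close> for every slope b.\<close>

lemma linear_count_bound:
  fixes t b :: real
  assumes "0 < b"
  shows "ennreal t \<le> ennreal b * (1 + (\<Sum>n. indicator {s. b * real n < s} t))"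
proof (cases "t \<le> 0")
  case False
  define N where "N = nat \<lceil>t / b\<rceil>"
  have tb: "0 < t / b" using False assms by simp
  have N: "t / b \<le> real N" "real N < t / b + 1" using tb by (simp_all add: N_def) linarith+
  have "ennreal t \<le> ennreal (b * real N)"
    using N assms by (intro ennreal_leI) (simp add: field_simps)
  also have "\<dots> = ennreal b * of_nat N" using assms by (simp add: ennreal_mult ennreal_of_nat_eq_real_of_nat)
  also have "of_nat N = (\<Sum>n<N. indicator {s. b * real n < s} t :: ennreal)"
  proof -
    have "indicator {s. b * real n < s} t = (1 :: ennreal)" if "n < N" for n
    proof -
      have "real n + 1 \<le> real N" using that by simp
      then have "real n < t / b" using N by linarith
      then show ?thesis using assms by (simp add: field_simps)
    qed
    then show ?thesis by simp
  qed
  also have "\<dots> \<le> (\<Sum>n. indicator {s. b * real n < s} t)"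
    by (intro sum_le_suminf) auto
  also have "\<dots> \<le> 1 + (\<Sum>n. indicator {s. b * real n < s} t)" by simp
  finally show ?thesis by (simp add: mult_left_mono)
qed (simp add: ennreal_neg)

context iid_env
begin

definition min_abs :: "(int ^ 'd \<Rightarrow> real) \<Rightarrow> int ^ 'd \<Rightarrow> real" where
  "min_abs w y = Min ((\<lambda>z. \<bar>w (y + z)\<bar>) ` (nbrs :: (int ^ 'd) set))"

lemma measurable_min_abs [measurable]: "(\<lambda>w. min_abs w y) \<in> borel_measurable P"
  unfolding min_abs_def by (intro borel_measurable_Min) auto

lemma min_abs_translate: "min_abs (translate t w) y = min_abs w (y + t)"
  by (simp add: min_abs_def translate_def add_ac)

lemma min_abs_nonneg: "0 \<le> min_abs w y"
  unfolding min_abs_def by (intro Min.boundedI) auto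

lemma ennreal_min_abs: "ennreal (min_abs w 0) = Min ((\<lambda>z. ennreal \<bar>w z\<bar>) ` (nbrs :: (int ^ 'd) set))"
proof -
  have "mono ennreal" by (auto simp: mono_def intro: ennreal_leI)
  from mono_Min_commute[OF this, of "(\<lambda>z. \<bar>w z\<bar>) ` (nbrs :: (int ^ 'd) set)"]
  show ?thesis by (simp add: min_abs_def image_image)
qed

lemma min_abs_eq_min_neighbour: "ennreal (min_abs w y) = min_neighbour (\<lambda>z. ennreal \<bar>w z\<bar>) y"
proof -
  have "mono ennreal" by (auto simp: mono_def intro: ennreal_leI)
  from mono_Min_commute[OF this, of "(\<lambda>z. \<bar>w (y + z)\<bar>) ` (nbrs :: (int ^ 'd) set)"]
  show ?thesis by (simp add: min_abs_def image_image min_neighbour_def adjacent_set_eq)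
qed

lemma cost_ge_min_abs:
  assumes "x \<noteq> y"
  shows "min_abs w y \<le> cost w x y"
proof -
  have "exp (- cost w x y) \<le> exp (- min_abs w y)"
    unfolding exp_minus_cost
    using green_e_le_min_neighbour[OF assms, of "\<lambda>z. ennreal \<bar>w z\<bar>"]
    by (simp add: min_abs_eq_min_neighbour[symmetric] exp_minus_ennreal min_abs_nonneg)
  then show ?thesis by simp
qed

lemma depends_min_abs: "depends_on (cube 1 y) (\<lambda>w. min_abs w y)"
proof -
  have "(\<lambda>z. \<bar>w (y + z)\<bar>) ` nbrs = (\<lambda>z. \<bar>w' (y + z)\<bar>) ` nbrs" if "\<forall>z\<in>cube 1 y. w z = w' z" for w w'
    using that by (intro image_cong) (auto simp: cube_def nbrs_component)
  then show ?thesis unfolding depends_on_def min_abs_def by metis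
qed

text \<open>Second Borel--Cantelli lemma for the sites \<open>3 n x\<close>, whose neighbourhoods are disjoint.\<close>

theorem min_abs_integrable:
  assumes x: "x \<noteq> 0"
    and bdd: "AE w in P. \<exists>C. \<forall>\<^sub>F n in sequentially. min_abs w (int n *s x) \<le> C * real n"
  shows "(\<integral>\<^sup>+w. ennreal (min_abs w 0) \<partial>P) < \<infinity>"
proof (rule ccontr)
  assume inf: "\<not> ?thesis"
  obtain i where i: "x $ i \<noteq> 0" using x by (auto simp: vec_eq_iff)
  define y where "y n = int (3 * n) *s x" for n
  have io: "AE w in P. \<exists>n\<ge>m. b * real n < min_abs w (y n)" if b: "0 < b" for b :: real and m :: nat
  proof -
    define p where "p n = prob {w. b * real n < min_abs w 0}" for n
    have p: "prob {w. b * real n < min_abs w (y n)} = p n" for n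
      using prob_translate[of "\<lambda>w. b * real n < min_abs w 0" "y n"] by (simp add: p_def min_abs_translate)
    have "\<not> summable p"
    proof
      assume s: "summable p"
      have "(\<integral>\<^sup>+w. ennreal (min_abs w 0) \<partial>P) \<le> (\<integral>\<^sup>+w. ennreal b * (1 + (\<Sum>n. indicator {s. b * real n < s} (min_abs w 0))) \<partial>P)"
        by (intro nn_integral_mono linear_count_bound b)
      also have "\<dots> = ennreal b * (1 + (\<Sum>n. \<integral>\<^sup>+w. indicator {s. b * real n < s} (min_abs w 0) \<partial>P))"
        using emeasure_space_1 by (simp add: nn_integral_cmult nn_integral_add nn_integral_suminf)
      also have "(\<Sum>n. \<integral>\<^sup>+w. indicator {s. b * real n < s} (min_abs w 0) \<partial>P) = (\<Sum>n. ennreal (p n))"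
      proof (rule suminf_cong)
        fix n
        have "(\<integral>\<^sup>+w. indicator {s. b * real n < s} (min_abs w 0) \<partial>P) = (\<integral>\<^sup>+w. indicator {w. b * real n < min_abs w 0} w \<partial>P)"
          by (intro nn_integral_cong) (auto simp: indicator_def)
        also have "\<dots> = emeasure P {w. b * real n < min_abs w 0}"
          by (rule nn_integral_indicator) (rule sets_Collect_P, measurable)
        finally show "(\<integral>\<^sup>+w. indicator {s. b * real n < s} (min_abs w 0) \<partial>P) = ennreal (p n)"
          by (simp add: p_def emeasure_eq_measure)
      qed
      also have "(\<Sum>n. ennreal (p n)) = ennreal (\<Sum>n. p n)" by (rule suminf_ennreal2[OF _ s]) (simp add: p_def)
      also have "ennreal b * (1 + ennreal (\<Sum>n. p n)) < \<infinity>" by (simp add: ennreal_mult_less_top)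
      finally show False using inf by simp
    qed
    have step: "prob {w. \<forall>n\<in>{m..<N}. \<not> b * real n < min_abs w (y n)} \<le> exp (- (\<Sum>n\<in>{m..<N}. p n))" for N
    proof (induction N)
      case 0
      show ?case by simp
    next
      case (Suc N)
      show ?case
      proof (cases "m \<le> N")
        case True
        let ?E = "\<lambda>w. \<forall>n\<in>{m..<N}. \<not> b * real n < min_abs w (y n)"
        let ?F = "\<lambda>w. \<not> b * real N < min_abs w (y N)"
        have "prob {w. ?E w \<and> ?F w} = prob {w. ?E w} * prob {w. ?F w}"
        proof (rule prob_indep)
          show "depends_on (\<Union>n\<in>{m..<N}. cube 1 (y n)) ?E"
            unfolding depends_on_def
          proof (intro allI impI ball_cong refl)
            fix w w' :: "int ^ 'd \<Rightarrow> real" and n assume "\<forall>z\<in>\<Union>n\<in>{m..<N}. cube 1 (y n). w z = w' z" "n \<in> {m..<N}"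
            then have "min_abs w (y n) = min_abs w' (y n)" by (intro depends_onD[OF depends_min_abs]) auto
            then show "(\<not> b * real n < min_abs w (y n)) = (\<not> b * real n < min_abs w' (y n))" by simp
          qed
          show "depends_on (cube 1 (y N)) ?F"
            using depends_min_abs[of "y N"] unfolding depends_on_def by metis
          show "(\<Union>n\<in>{m..<N}. cube 1 (y n)) \<inter> cube 1 (y N) = {}"
          proof (rule ccontr)
            assume "\<not> ?thesis"
            then obtain n z where n: "n < N" "z \<in> cube 1 (y n)" "z \<in> cube 1 (y N)" by auto
            from cube_trans[OF cube_sym[OF n(3)] n(2)] have "\<bar>y N $ i - y n $ i\<bar> \<le> 2" by (simp add: cube_def)
            moreover have eq: "y N $ i - y n $ i = int (3 * (N - n)) * x $ i"
              using n(1) by (simp add: y_def algebra_simps of_nat_diff)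
            have "\<bar>y N $ i - y n $ i\<bar> = int (3 * (N - n)) * \<bar>x $ i\<bar>"
              unfolding eq by (simp only: abs_mult abs_of_nat)
            moreover have "3 * 1 \<le> int (3 * (N - n)) * \<bar>x $ i\<bar>" using n(1) i by (intro mult_mono) auto
            ultimately show False by linarith
          qed
        qed measurable
        also have "prob {w. ?F w} = 1 - p N"
          using prob_neg[of "\<lambda>w. b * real N < min_abs w (y N)"] p[of N]
            sets_Collect_P[of "\<lambda>w. b * real N < min_abs w (y N)"] by simp
        also have "prob {w. ?E w} * (1 - p N) \<le> exp (- (\<Sum>n\<in>{m..<N}. p n)) * exp (- p N)"
          using Suc exp_ge_add_one_self[of "- p N"] by (intro mult_mono) (auto simp: p_def)
        also have "\<dots> = exp (- (\<Sum>n\<in>{m..<Suc N}. p n))" using True by (simp add: exp_add[symmetric])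
        also have "{w. ?E w \<and> ?F w} = {w. \<forall>n\<in>{m..<Suc N}. \<not> b * real n < min_abs w (y n)}"
          using True by (auto simp: less_Suc_eq)
        finally show ?thesis .
      qed simp
    qed
    have p0: "0 \<le> p n" for n by (simp add: p_def)
    \<comment> \<open>Divergence of the sum makes the product bound arbitrarily small, however late
      the starting index m.\<close>
    have small: "\<exists>N. exp (- (\<Sum>n\<in>{m..<N}. p n)) < e" if e: "0 < e" for e :: real
    proof (rule ccontr)
      assume no: "\<not> ?thesis"
      have "(\<Sum>n<N. p n) \<le> (\<Sum>n<m. p n) - ln e" for N
      proof -
        have "e \<le> exp (- (\<Sum>n\<in>{m..<N}. p n))" using no by (auto simp: not_less)
        then have "ln e \<le> ln (exp (- (\<Sum>n\<in>{m..<N}. p n)))" using e by (intro ln_mono) auto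
        then have "ln e \<le> - (\<Sum>n\<in>{m..<N}. p n)" by simp
        moreover have "(\<Sum>n<N. p n) \<le> (\<Sum>n<m. p n) + (\<Sum>n\<in>{m..<N}. p n)"
        proof -
          have "(\<Sum>n<N. p n) \<le> (\<Sum>n\<in>{..<m} \<union> {m..<N}. p n)" by (intro sum_mono2) (auto simp: p0)
          also have "\<dots> = (\<Sum>n<m. p n) + (\<Sum>n\<in>{m..<N}. p n)" by (intro sum.union_disjoint) auto
          finally show ?thesis .
        qed
        ultimately show ?thesis by linarith
      qed
      then have "summable p" by (intro bounded_imp_summable[where a=p and B="(\<Sum>n<m. p n) - ln e"] p0) (simp only: lessThan_Suc_atMost[symmetric])
      with \<open>\<not> summable p\<close> show False by blast
    qed
    define A where "A = {w. \<forall>n\<ge>m. \<not> b * real n < min_abs w (y n)}"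
    have [measurable]: "A \<in> sets P" unfolding A_def by (rule sets_Collect_P) measurable
    have "prob A \<le> e" if e: "0 < e" for e
    proof -
      obtain N where N: "exp (- (\<Sum>n\<in>{m..<N}. p n)) < e" using small[OF e] by blast
      have "prob A \<le> prob {w. \<forall>n\<in>{m..<N}. \<not> b * real n < min_abs w (y n)}"
        by (intro finite_measure_mono sets_Collect_P) (auto simp: A_def)
      with step[of N] N show ?thesis by linarith
    qed
    then have "prob A \<le> 0" by (rule field_le_epsilon[of _ 0, simplified])
    then have "prob A = 0" using measure_nonneg[of P A] by simp
    then have "AE w in P. w \<notin> A" by (simp add: prob_eq_0)
    then show ?thesis by eventually_elim (auto simp: A_def)
  qed
  have "AE w in P. \<forall>k m. \<exists>n\<ge>m. real (Suc k) * real n < min_abs w (y n)"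
    unfolding AE_all_countable by (intro allI io) simp
  with bdd have "AE w in P. False"
  proof eventually_elim
    case (elim w)
    obtain C n0 where C: "\<And>n. n0 \<le> n \<Longrightarrow> min_abs w (int n *s x) \<le> C * real n"
      using elim(1) by (auto simp: eventually_sequentially)
    \<comment> \<open>The factor 3 enters because \<open>y n\<close> is the multiple 3n of x. The
      constant C may depend on the environment, hence the statement for all slopes
      simultaneously.\<close>
    obtain k :: nat where k: "3 * C < k" using reals_Archimedean2 by blast
    obtain n where n: "n0 + 1 \<le> n" "real (Suc k) * real n < min_abs w (y n)" using elim(2) by blast
    have "min_abs w (y n) \<le> C * real (3 * n)" unfolding y_def using n(1) by (intro C) simp
    also have "\<dots> = (3 * C) * real n" by simp
    also have "\<dots> \<le> real (Suc k) * real n" using k by (intro mult_right_mono) auto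
    finally show ?case using n(2) by simp
  qed
  then show False by simp
qed

end

section \<open>Transfer to the original potential\<close>

lemma enn2ereal_le_minus_log:
  assumes "0 \<le> g" "g \<le> exp_minus t"
  shows "enn2ereal t \<le> minus_log g"
proof (cases t)
  case (real r)
  show ?thesis
  proof (cases "g = 0")
    case False
    then have "ln g \<le> ln (exp (- r))"
      using assms real by (intro ln_mono) (auto simp: exp_minus_ennreal)
    then have "ln g \<le> - r" by simp
    then show ?thesis using False real by (simp add: minus_log_def)
  qed (simp add: minus_log_def)
next
  case top
  then show ?thesis using assms by (simp add: exp_minus_def minus_log_def)
qed

lemma measurable_minus_log [measurable]: "minus_log \<in> borel_measurable borel"
  unfolding minus_log_def by measurable

locale iid_potential = prob_space M for M :: "'w measure" +
  fixes V :: "int ^ 'd::finite \<Rightarrow> 'w \<Rightarrow> ennreal"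
  assumes iid: "iid_field M V"
begin

lemma indep_V: "indep_vars (\<lambda>_. borel) V UNIV"
  using iid by (simp add: iid_field_def)

lemma measurable_V [measurable]: "V z \<in> borel_measurable M"
  using indep_V by (simp add: indep_vars_def2)

lemma distr_V: "distr M borel (V z) = distr M borel (V 0)"
  using iid unfolding iid_field_def by blast

lemma measurable_scaled_cost [measurable]: "scaled_cost V x n \<in> borel_measurable M"
  unfolding scaled_cost_def cost_a_def by measurable

lemma scaled_ne_0:
  fixes x :: "int ^ 'd"
  shows "0 < n \<Longrightarrow> x \<noteq> 0 \<Longrightarrow> int n *s x \<noteq> 0"
  by (auto simp: vec_eq_iff)

lemma cost_a_ge_start:
  fixes x :: "int ^ 'd"
  assumes "0 < n" "x \<noteq> 0"
  shows "enn2ereal (v 0) \<le> cost_a v 0 (int n *s x)"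
  unfolding cost_a_def
  by (intro enn2ereal_le_minus_log green_e_bounds green_e_le_start) (use scaled_ne_0[OF assms] in auto)

lemma scaled_cost_infinite:
  assumes "0 < n" "x \<noteq> 0" "V 0 \<omega> = \<infinity>"
  shows "scaled_cost V x n \<omega> = \<infinity>"
  using cost_a_ge_start[OF assms(1,2), of "\<lambda>z. V z \<omega>"] assms(1,3) by (simp add: scaled_cost_def)

text \<open>The cost is at least \<open>V 0\<close>, so a single n at which the distance to L has
  finite mean bounds the mean of \<open>V 0\<close>.\<close>

lemma tendsto_L1_finite:
  assumes x: "x \<noteq> 0" and L1: "tendsto_L1 M (scaled_cost V x) L"
  shows "(\<integral>\<^sup>+\<omega>. V 0 \<omega> \<partial>M) < \<infinity>"
proof -
  have L: "integrable M L" and lim: "(\<lambda>n. \<integral>\<^sup>+\<omega>. e2ennreal \<bar>scaled_cost V x n \<omega> - ereal (L \<omega>)\<bar> \<partial>M) \<longlonglongrightarrow> 0"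
    using L1 by (auto simp: tendsto_L1_def)
  note [measurable] = borel_measurable_integrable[OF L]
  have "eventually (\<lambda>n. (\<integral>\<^sup>+\<omega>. e2ennreal \<bar>scaled_cost V x n \<omega> - ereal (L \<omega>)\<bar> \<partial>M) < 1 \<and> 0 < n) sequentially"
    using order_tendstoD(2)[OF lim, of 1] eventually_gt_at_top[of 0] by (auto intro: eventually_conj)
  then obtain n where n: "(\<integral>\<^sup>+\<omega>. e2ennreal \<bar>scaled_cost V x n \<omega> - ereal (L \<omega>)\<bar> \<partial>M) < 1" "0 < n"
    by (auto simp: eventually_sequentially)
  have le: "V 0 \<omega> \<le> ennreal (real n) * (e2ennreal \<bar>scaled_cost V x n \<omega> - ereal (L \<omega>)\<bar> + ennreal \<bar>L \<omega>\<bar>)" for \<omega>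
  proof (cases "cost_a (\<lambda>z. V z \<omega>) 0 (int n *s x)")
    case (real r)
    have V: "enn2ereal (V 0 \<omega>) \<le> ereal r"
      using cost_a_ge_start[OF n(2) x, of "\<lambda>z. V z \<omega>"] real by simp
    then have r: "V 0 \<omega> \<le> ennreal r"
      by (metis e2ennreal_enn2ereal e2ennreal_mono ennreal.abs_eq ennreal_def e2ennreal_ereal)
    have sc: "scaled_cost V x n \<omega> = ereal (r / n)" using n real by (simp add: scaled_cost_def)
    have "r / n \<le> \<bar>r / n - L \<omega>\<bar> + \<bar>L \<omega>\<bar>" by simp
    then have "real n * (r / n) \<le> real n * (\<bar>r / n - L \<omega>\<bar> + \<bar>L \<omega>\<bar>)" by (intro mult_left_mono) auto
    then have "r \<le> real n * (\<bar>r / n - L \<omega>\<bar> + \<bar>L \<omega>\<bar>)" using n(2) by simp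
    then have "ennreal r \<le> ennreal (real n * (\<bar>r / n - L \<omega>\<bar> + \<bar>L \<omega>\<bar>))" by (rule ennreal_leI)
    also have "\<dots> = ennreal (real n) * (e2ennreal \<bar>scaled_cost V x n \<omega> - ereal (L \<omega>)\<bar> + ennreal \<bar>L \<omega>\<bar>)"
      by (simp add: sc ennreal_mult e2ennreal_ereal)
    finally show ?thesis using r by simp
  next
    case PInf
    then have "scaled_cost V x n \<omega> = \<infinity>" using n by (simp add: scaled_cost_def)
    then show ?thesis using n by (simp add: e2ennreal_infty ennreal_mult_top)
  next
    case MInf
    then show ?thesis using cost_a_ge_start[OF n(2) x, of "\<lambda>z. V z \<omega>"] by simp
  qed
  have "(\<integral>\<^sup>+\<omega>. V 0 \<omega> \<partial>M) \<le> (\<integral>\<^sup>+\<omega>. ennreal (real n) * (e2ennreal \<bar>scaled_cost V x n \<omega> - ereal (L \<omega>)\<bar> + ennreal \<bar>L \<omega>\<bar>) \<partial>M)"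
    by (intro nn_integral_mono le)
  also have "\<dots> = ennreal (real n) * ((\<integral>\<^sup>+\<omega>. e2ennreal \<bar>scaled_cost V x n \<omega> - ereal (L \<omega>)\<bar> \<partial>M) + (\<integral>\<^sup>+\<omega>. ennreal \<bar>L \<omega>\<bar> \<partial>M))"
    by (subst nn_integral_cmult) (auto simp: nn_integral_add)
  also have "\<dots> < \<infinity>"
  proof -
    have "(\<integral>\<^sup>+\<omega>. ennreal \<bar>L \<omega>\<bar> \<partial>M) < \<infinity>" using L by (simp add: integrable_iff_bounded)
    then show ?thesis using n by (simp add: ennreal_mult_less_top less_trans[OF n(1)])
  qed
  finally show ?thesis .
qed

lemma tendsto_AE_finite:
  assumes x: "x \<noteq> 0" and ae: "tendsto_AE M (scaled_cost V x) L"
  shows "AE \<omega> in M. V 0 \<omega> < \<infinity>"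
proof -
  have "AE \<omega> in M. (\<lambda>n. scaled_cost V x n \<omega>) \<longlonglongrightarrow> ereal (L \<omega>)" using ae by (simp add: tendsto_AE_def)
  then show ?thesis
  proof eventually_elim
    case (elim \<omega>)
    show ?case
    proof (rule ccontr)
      assume "\<not> V 0 \<omega> < \<infinity>"
      then have "V 0 \<omega> = \<infinity>" by (simp add: less_top[symmetric])
      then have "eventually (\<lambda>n. scaled_cost V x n \<omega> = \<infinity>) sequentially"
        using scaled_cost_infinite[OF _ x] by (intro eventually_sequentiallyI[of 1]) auto
      then have "(\<lambda>n. scaled_cost V x n \<omega>) \<longlonglongrightarrow> \<infinity>" by (rule tendsto_eventually)
      with elim have "ereal (L \<omega>) = \<infinity>" by (rule LIMSEQ_unique)
      then show False by simp
    qed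
  qed
qed

text \<open>Where \<open>V 0\<close> is infinite all scaled costs are infinite, while L is finite,
  so this event lies in every deviation event.\<close>

lemma tendsto_prob_finite:
  assumes x: "x \<noteq> 0" and pr: "tendsto_prob M (scaled_cost V x) L"
  shows "AE \<omega> in M. V 0 \<omega> < \<infinity>"
proof -
  have [measurable]: "L \<in> borel_measurable M" using pr by (simp add: tendsto_prob_def)
  have lim: "(\<lambda>n. prob {\<omega> \<in> space M. \<bar>scaled_cost V x n \<omega> - ereal (L \<omega>)\<bar> > ereal 1}) \<longlonglongrightarrow> 0"
    using pr by (simp add: tendsto_prob_def)
  have "prob {\<omega> \<in> space M. V 0 \<omega> = \<infinity>} \<le> prob {\<omega> \<in> space M. \<bar>scaled_cost V x n \<omega> - ereal (L \<omega>)\<bar> > ereal 1}" if "1 \<le> n" for n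
  proof (rule finite_measure_mono)
    show "{\<omega> \<in> space M. \<bar>scaled_cost V x n \<omega> - ereal (L \<omega>)\<bar> > ereal 1} \<in> sets M" by measurable
  qed (use scaled_cost_infinite[OF _ x] that in auto)
  then have "prob {\<omega> \<in> space M. V 0 \<omega> = \<infinity>} \<le> 0"
    by (intro LIMSEQ_le_const[OF lim]) auto
  then have "prob {\<omega> \<in> space M. V 0 \<omega> = \<infinity>} = 0" using measure_nonneg[of M] by (metis antisym)
  moreover have "{\<omega> \<in> space M. V 0 \<omega> = \<infinity>} \<in> sets M" by measurable
  ultimately have "AE \<omega> in M. \<omega> \<notin> {\<omega> \<in> space M. V 0 \<omega> = \<infinity>}" by (simp add: prob_eq_0)
  then show ?thesis using AE_space by eventually_elim (auto simp: less_top[symmetric])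
qed

lemma integral_finite: "(\<integral>\<^sup>+\<omega>. V 0 \<omega> \<partial>M) < \<infinity> \<Longrightarrow> AE \<omega> in M. V 0 \<omega> < \<infinity>"
  using nn_integral_PInf_AE[of "V 0" M] by (auto simp: less_top[symmetric])

text \<open>If V were infinite with probability p > 0, all neighbours would be infinite together
  with probability \<open>p ^ card nbrs\<close>, and the minimum would have infinite mean.\<close>

lemma min_neighbour_finite:
  assumes "(\<integral>\<^sup>+\<omega>. min_neighbour (\<lambda>z. V z \<omega>) 0 \<partial>M) < \<infinity>"
  shows "AE \<omega> in M. V 0 \<omega> < \<infinity>"
proof -
  let ?N = "nbrs :: (int ^ 'd) set"
  have mn: "min_neighbour (\<lambda>z. V z \<omega>) 0 = Min ((\<lambda>z. V z \<omega>) ` ?N)" for \<omega>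
    by (simp add: min_neighbour_def adjacent_set_eq image_image)
  have [measurable]: "(\<lambda>\<omega>. min_neighbour (\<lambda>z. V z \<omega>) 0) \<in> borel_measurable M"
    unfolding mn by (intro borel_measurable_Min) auto
  have "AE \<omega> in M. min_neighbour (\<lambda>z. V z \<omega>) 0 \<noteq> \<infinity>"
    using assms by (intro nn_integral_PInf_AE) auto
  then have ae: "AE \<omega> in M. \<not> (\<forall>z\<in>?N. V z \<omega> = \<infinity>)"
  proof eventually_elim
    case (elim \<omega>)
    have "Min ((\<lambda>z. V z \<omega>) ` ?N) \<in> (\<lambda>z. V z \<omega>) ` ?N" by (intro Min_in) auto
    with elim show ?case unfolding mn by force
  qed
  define p where "p = prob {\<omega> \<in> space M. V 0 \<omega> = \<infinity>}"
  have pz: "prob (V z -` {\<infinity>} \<inter> space M) = p" for z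
  proof -
    have "prob (V z -` {\<infinity>} \<inter> space M) = measure (distr M borel (V z)) {\<infinity>}"
      by (rule measure_distr[symmetric]) auto
    also have "\<dots> = measure (distr M borel (V 0)) {\<infinity>}" by (simp only: distr_V[of z])
    also have "\<dots> = prob (V 0 -` {\<infinity>} \<inter> space M)" by (rule measure_distr) auto
    finally show ?thesis by (simp add: p_def vimage_def Int_def conj_commute)
  qed
  have "prob (\<Inter>z\<in>?N. V z -` {\<infinity>} \<inter> space M) = (\<Prod>z\<in>?N. prob (V z -` {\<infinity>} \<inter> space M))"
    by (rule indep_varsD[OF indep_V, where A="\<lambda>_. {\<infinity>}"]) auto
  also have "\<dots> = p ^ card ?N" by (simp only: pz prod_constant)
  finally have "p ^ card ?N = prob (\<Inter>z\<in>?N. V z -` {\<infinity>} \<inter> space M)" ..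
  also have "\<dots> = 0"
  proof -
    have "AE \<omega> in M. \<omega> \<notin> (\<Inter>z\<in>?N. V z -` {\<infinity>} \<inter> space M)" using ae by eventually_elim auto
    moreover have "(\<Inter>z\<in>?N. V z -` {\<infinity>} \<inter> space M) \<in> sets M"
      by (intro sets.finite_INT) auto
    ultimately show ?thesis by (simp add: prob_eq_0)
  qed
  finally have "p = 0" by simp
  moreover have "{\<omega> \<in> space M. V 0 \<omega> = \<infinity>} \<in> sets M" by measurable
  ultimately have "AE \<omega> in M. \<omega> \<notin> {\<omega> \<in> space M. V 0 \<omega> = \<infinity>}" by (simp add: p_def prob_eq_0)
  then show ?thesis using AE_space by eventually_elim (auto simp: less_top[symmetric])
qed

end

section \<open>Almost surely finite potentials\<close>

locale finite_potential = iid_potential M V for M :: "'w measure" and V :: "int ^ 'd::finite \<Rightarrow> 'w \<Rightarrow> ennreal" +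
  assumes finite_V0: "AE \<omega> in M. V 0 \<omega> < \<infinity>"
begin

text \<open>Replacing infinite values by 0 changes V on a null set only and yields an environment
  with a product law, to which the results on costs apply.\<close>

definition W :: "'w \<Rightarrow> int ^ 'd \<Rightarrow> real" where
  "W \<omega> = (\<lambda>z. enn2real (V z \<omega>))"

definition \<nu> :: "real measure" where
  "\<nu> = distr M borel (\<lambda>\<omega>. W \<omega> 0)"

definition env :: "(int ^ 'd \<Rightarrow> real) measure" where
  "env = Pi\<^sub>M UNIV (\<lambda>_. \<nu>)"

lemma measurable_W_coord [measurable]: "(\<lambda>\<omega>. W \<omega> z) \<in> borel_measurable M"
  unfolding W_def by measurable

lemma prob_space_\<nu>: "prob_space \<nu>"
  unfolding \<nu>_def by (rule prob_space_distr) measurable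

sublocale env: iid_env \<nu> env
  by (rule iid_env.intro) (simp_all add: prob_space_\<nu> env_def, simp add: \<nu>_def)

lemma measurable_W [measurable]: "W \<in> measurable M env"
  by (rule env.measurable_into_P) measurable

lemma distr_W: "distr M env W = env"
proof -
  have "indep_vars (\<lambda>_. borel) (\<lambda>z \<omega>. enn2real (V z \<omega>)) UNIV"
    by (rule indep_vars_compose2[OF indep_V]) measurable
  then have "indep_vars (\<lambda>_. borel) (\<lambda>z \<omega>. W \<omega> z) UNIV" by (simp add: W_def)
  then have "distr M (Pi\<^sub>M UNIV (\<lambda>_. borel)) (\<lambda>\<omega>. \<lambda>z\<in>UNIV. W \<omega> z) = Pi\<^sub>M UNIV (\<lambda>z. distr M borel (\<lambda>\<omega>. W \<omega> z))"
    by (subst (asm) indep_vars_iff_distr_eq_PiM) auto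
  moreover have "distr M borel (\<lambda>\<omega>. W \<omega> z) = \<nu>" for z
  proof -
    have "distr M borel (\<lambda>\<omega>. W \<omega> z) = distr (distr M borel (V z)) borel enn2real"
      by (simp add: distr_distr W_def comp_def)
    also have "\<dots> = distr (distr M borel (V 0)) borel enn2real" by (simp only: distr_V[of z])
    also have "\<dots> = \<nu>" by (simp add: distr_distr W_def comp_def \<nu>_def)
    finally show ?thesis .
  qed
  ultimately have "distr M (Pi\<^sub>M UNIV (\<lambda>_. borel)) W = env" by (simp add: env_def restrict_def)
  moreover have "distr M env W = distr M (Pi\<^sub>M UNIV (\<lambda>_. borel)) W"
    by (rule distr_cong) (auto simp: env.sets_P)
  ultimately show ?thesis by simp
qed

lemma AE_env: "AE w in env. Q w \<Longrightarrow> AE \<omega> in M. Q (W \<omega>)"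
  using AE_distrD[OF measurable_W, of Q] unfolding distr_W .

lemma AE_V_eq: "AE \<omega> in M. \<forall>z. V z \<omega> = ennreal \<bar>W \<omega> z\<bar>"
  unfolding AE_all_countable
proof
  fix z
  have "AE t in distr M borel (V 0). t < \<infinity>"
    using finite_V0 by (subst AE_distr_iff) auto
  then have "AE t in distr M borel (V z). t < \<infinity>" by (simp only: distr_V[of z])
  then have "AE \<omega> in M. V z \<omega> < \<infinity>" by (subst (asm) AE_distr_iff) auto
  then show "AE \<omega> in M. V z \<omega> = ennreal \<bar>W \<omega> z\<bar>" by eventually_elim (simp add: W_def)
qed

lemma nn_integral_env: "f \<in> borel_measurable env \<Longrightarrow> (\<integral>\<^sup>+\<omega>. f (W \<omega>) \<partial>M) = (\<integral>\<^sup>+w. f w \<partial>env)"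
  using nn_integral_distr[OF measurable_W, of f] by (simp add: distr_W)

definition X :: "int ^ 'd \<Rightarrow> nat \<Rightarrow> 'w \<Rightarrow> real" where
  "X x n \<omega> = cost (W \<omega>) 0 (int n *s x) / real n"

lemma measurable_X [measurable]: "X x n \<in> borel_measurable M"
  unfolding X_def by measurable

lemma scaled_cost_eq: "AE \<omega> in M. \<forall>n>0. scaled_cost V x n \<omega> = ereal (X x n \<omega>)"
  using AE_V_eq
proof eventually_elim
  case (elim \<omega>)
  then have "(\<lambda>z. V z \<omega>) = (\<lambda>z. ennreal \<bar>W \<omega> z\<bar>)" by auto
  then have "cost_a (\<lambda>z. V z \<omega>) 0 y = ereal (cost (W \<omega>) 0 y)" for y
    using green_e_pos[of "W \<omega>" 0 y] by (simp add: cost_a_def minus_log_def cost_def)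
  then show ?case by (simp add: scaled_cost_def X_def)
qed

lemma conv_prob_env:
  assumes "env.conv_prob Y c"
  shows "conv_prob (\<lambda>n \<omega>. Y n (W \<omega>)) c"
  unfolding conv_prob_def
proof (intro conjI allI impI)
  note [measurable] = env.conv_prob_measurable[OF assms]
  show "(\<lambda>\<omega>. Y n (W \<omega>)) \<in> borel_measurable M" for n by measurable
  fix e :: real assume e: "0 < e"
  have "prob {\<omega> \<in> space M. e < \<bar>Y n (W \<omega>) - c\<bar>} = env.prob {w \<in> space env. e < \<bar>Y n w - c\<bar>}" for n
  proof -
    have S: "{w \<in> space env. e < \<bar>Y n w - c\<bar>} \<in> sets env" by measurable
    have "env.prob {w \<in> space env. e < \<bar>Y n w - c\<bar>} = measure (distr M env W) {w \<in> space env. e < \<bar>Y n w - c\<bar>}"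
      by (simp add: distr_W)
    also have "\<dots> = prob {\<omega> \<in> space M. e < \<bar>Y n (W \<omega>) - c\<bar>}"
      by (subst measure_distr[OF measurable_W S]) (simp add: vimage_def Int_def conj_commute)
    finally show ?thesis by simp
  qed
  then show "(\<lambda>n. prob {\<omega> \<in> space M. e < \<bar>Y n (W \<omega>) - c\<bar>}) \<longlonglongrightarrow> 0"
    using env.conv_probD[OF assms e] by simp
qed

lemma tendsto_prob_iff_conv:
  assumes L [measurable]: "L \<in> borel_measurable M"
  shows "tendsto_prob M (scaled_cost V x) L \<longleftrightarrow> conv_prob (\<lambda>n \<omega>. X x n \<omega> - L \<omega>) 0"
proof -
  have eq: "eventually (\<lambda>n. prob {\<omega> \<in> space M. \<bar>scaled_cost V x n \<omega> - ereal (L \<omega>)\<bar> > ereal e} =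
    prob {\<omega> \<in> space M. e < \<bar>X x n \<omega> - L \<omega> - 0\<bar>}) sequentially" for e
  proof (rule eventually_sequentiallyI[of 1])
    fix n :: nat assume n: "1 \<le> n"
    have 1: "AE \<omega> in M. (\<bar>scaled_cost V x n \<omega> - ereal (L \<omega>)\<bar> > ereal e) = (e < \<bar>X x n \<omega> - L \<omega> - 0\<bar>)"
      using scaled_cost_eq[of x] by eventually_elim (use n in simp)
    show "prob {\<omega> \<in> space M. \<bar>scaled_cost V x n \<omega> - ereal (L \<omega>)\<bar> > ereal e} = prob {\<omega> \<in> space M. e < \<bar>X x n \<omega> - L \<omega> - 0\<bar>}"
    proof (rule measure_eq_AE)
      show "AE \<omega> in M. (\<omega> \<in> {\<omega> \<in> space M. \<bar>scaled_cost V x n \<omega> - ereal (L \<omega>)\<bar> > ereal e}) = (\<omega> \<in> {\<omega> \<in> space M. e < \<bar>X x n \<omega> - L \<omega> - 0\<bar>})"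
        using 1 by eventually_elim auto
    qed measurable
  qed
  have "(\<lambda>n. prob {\<omega> \<in> space M. \<bar>scaled_cost V x n \<omega> - ereal (L \<omega>)\<bar> > ereal e}) \<longlonglongrightarrow> 0 \<longleftrightarrow>
    (\<lambda>n. prob {\<omega> \<in> space M. e < \<bar>X x n \<omega> - L \<omega> - 0\<bar>}) \<longlonglongrightarrow> 0" for e
    by (rule tendsto_cong[OF eq])
  then show ?thesis by (simp add: tendsto_prob_def conv_prob_def)
qed

lemma tendsto_AE_iff_X:
  "tendsto_AE M (scaled_cost V x) L \<longleftrightarrow> L \<in> borel_measurable M \<and> (AE \<omega> in M. (\<lambda>n. X x n \<omega>) \<longlonglongrightarrow> L \<omega>)"
proof -
  have "AE \<omega> in M. ((\<lambda>n. scaled_cost V x n \<omega>) \<longlonglongrightarrow> ereal (L \<omega>)) = ((\<lambda>n. X x n \<omega>) \<longlonglongrightarrow> L \<omega>)"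
    using scaled_cost_eq[of x]
  proof eventually_elim
    case (elim \<omega>)
    then have "eventually (\<lambda>n. scaled_cost V x n \<omega> = ereal (X x n \<omega>)) sequentially"
      by (intro eventually_sequentiallyI[of 1]) auto
    from tendsto_cong[OF this] show ?case by simp
  qed
  then have "(AE \<omega> in M. (\<lambda>n. scaled_cost V x n \<omega>) \<longlonglongrightarrow> ereal (L \<omega>)) \<longleftrightarrow> (AE \<omega> in M. (\<lambda>n. X x n \<omega>) \<longlonglongrightarrow> L \<omega>)"
    by (rule eventually_subst)
  then show ?thesis by (simp add: tendsto_AE_def)
qed

lemma tendsto_AE_conv:
  assumes "tendsto_AE M (scaled_cost V x) L"
  shows "conv_prob (\<lambda>n \<omega>. X x n \<omega> - L \<omega>) 0"
proof (rule conv_prob_AE)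
  have L [measurable]: "L \<in> borel_measurable M" and lim: "AE \<omega> in M. (\<lambda>n. X x n \<omega>) \<longlonglongrightarrow> L \<omega>"
    using assms unfolding tendsto_AE_iff_X by auto
  show "(\<lambda>\<omega>. X x n \<omega> - L \<omega>) \<in> borel_measurable M" for n by measurable
  show "AE \<omega> in M. (\<lambda>n. X x n \<omega> - L \<omega>) \<longlonglongrightarrow> 0"
    using lim by eventually_elim (simp add: LIM_zero_iff)
qed

lemma nn_integral_scaled_cost:
  assumes "0 < n"
  shows "(\<integral>\<^sup>+\<omega>. e2ennreal \<bar>scaled_cost V x n \<omega> - ereal (L \<omega>)\<bar> \<partial>M) = (\<integral>\<^sup>+\<omega>. ennreal \<bar>X x n \<omega> - L \<omega>\<bar> \<partial>M)"
proof (rule nn_integral_cong_AE)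
  show "AE \<omega> in M. e2ennreal \<bar>scaled_cost V x n \<omega> - ereal (L \<omega>)\<bar> = ennreal \<bar>X x n \<omega> - L \<omega>\<bar>"
    using scaled_cost_eq[of x] by eventually_elim (use assms in \<open>simp add: e2ennreal_ereal\<close>)
qed

lemma tendsto_L1_iff_X:
  "tendsto_L1 M (scaled_cost V x) L \<longleftrightarrow> integrable M L \<and> (\<lambda>n. \<integral>\<^sup>+\<omega>. ennreal \<bar>X x n \<omega> - L \<omega>\<bar> \<partial>M) \<longlonglongrightarrow> 0"
proof -
  have "eventually (\<lambda>n. (\<integral>\<^sup>+\<omega>. e2ennreal \<bar>scaled_cost V x n \<omega> - ereal (L \<omega>)\<bar> \<partial>M) =
    (\<integral>\<^sup>+\<omega>. ennreal \<bar>X x n \<omega> - L \<omega>\<bar> \<partial>M)) sequentially"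
    by (intro eventually_sequentiallyI[of 1] nn_integral_scaled_cost) simp
  from tendsto_cong[OF this] show ?thesis by (simp add: tendsto_L1_def)
qed

lemma tendsto_L1_conv:
  assumes "tendsto_L1 M (scaled_cost V x) L"
  shows "conv_prob (\<lambda>n \<omega>. X x n \<omega> - L \<omega>) 0"
  unfolding conv_prob_def
proof (intro conjI allI impI)
  have L: "integrable M L" and lim: "(\<lambda>n. \<integral>\<^sup>+\<omega>. ennreal \<bar>X x n \<omega> - L \<omega>\<bar> \<partial>M) \<longlonglongrightarrow> 0"
    using assms unfolding tendsto_L1_iff_X by auto
  note [measurable] = borel_measurable_integrable[OF L]
  show "(\<lambda>\<omega>. X x n \<omega> - L \<omega>) \<in> borel_measurable M" for n by measurable
  fix e :: real assume e: "0 < e"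
  have le: "emeasure M {\<omega> \<in> space M. e < \<bar>X x n \<omega> - L \<omega> - 0\<bar>} \<le> ennreal (1 / e) * (\<integral>\<^sup>+\<omega>. ennreal \<bar>X x n \<omega> - L \<omega>\<bar> \<partial>M)" for n
  proof -
    have "emeasure M {\<omega> \<in> space M. e < \<bar>X x n \<omega> - L \<omega> - 0\<bar>} = (\<integral>\<^sup>+\<omega>. indicator {\<omega> \<in> space M. e < \<bar>X x n \<omega> - L \<omega> - 0\<bar>} \<omega> \<partial>M)"
      by (rule nn_integral_indicator[symmetric]) measurable
    also have "\<dots> \<le> (\<integral>\<^sup>+\<omega>. ennreal (1 / e) * ennreal \<bar>X x n \<omega> - L \<omega>\<bar> \<partial>M)"
    proof (rule nn_integral_mono)
      fix \<omega>
      show "indicator {\<omega> \<in> space M. e < \<bar>X x n \<omega> - L \<omega> - 0\<bar>} \<omega> \<le> ennreal (1 / e) * ennreal \<bar>X x n \<omega> - L \<omega>\<bar>"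
        using e by (auto simp: indicator_def ennreal_mult[symmetric] field_simps)
    qed
    also have "\<dots> = ennreal (1 / e) * (\<integral>\<^sup>+\<omega>. ennreal \<bar>X x n \<omega> - L \<omega>\<bar> \<partial>M)" by (rule nn_integral_cmult) measurable
    finally show ?thesis .
  qed
  have "(\<lambda>n. ennreal (1 / e) * (\<integral>\<^sup>+\<omega>. ennreal \<bar>X x n \<omega> - L \<omega>\<bar> \<partial>M)) \<longlonglongrightarrow> ennreal (1 / e) * 0"
    by (rule ennreal_tendsto_cmult[OF _ lim]) simp
  then have "(\<lambda>n. ennreal (1 / e) * (\<integral>\<^sup>+\<omega>. ennreal \<bar>X x n \<omega> - L \<omega>\<bar> \<partial>M)) \<longlonglongrightarrow> 0" by simp
  then have "(\<lambda>n. emeasure M {\<omega> \<in> space M. e < \<bar>X x n \<omega> - L \<omega> - 0\<bar>}) \<longlonglongrightarrow> 0"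
    by (rule tendsto_sandwich[OF always_eventually always_eventually tendsto_const, rotated 2]) (use le in auto)
  then show "(\<lambda>n. prob {\<omega> \<in> space M. e < \<bar>X x n \<omega> - L \<omega> - 0\<bar>}) \<longlonglongrightarrow> 0"
    by (simp add: emeasure_eq_measure ennreal_tendsto_0_iff)
qed

lemma min_neighbour_integral:
  "(\<integral>\<^sup>+\<omega>. min_neighbour (\<lambda>z. V z \<omega>) 0 \<partial>M) = (\<integral>\<^sup>+w. ennreal (env.min_abs w 0) \<partial>env)"
proof -
  have "(\<integral>\<^sup>+\<omega>. min_neighbour (\<lambda>z. V z \<omega>) 0 \<partial>M) = (\<integral>\<^sup>+\<omega>. ennreal (env.min_abs (W \<omega>) 0) \<partial>M)"
  proof (rule nn_integral_cong_AE)
    show "AE \<omega> in M. min_neighbour (\<lambda>z. V z \<omega>) 0 = ennreal (env.min_abs (W \<omega>) 0)"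
      using AE_V_eq
    proof eventually_elim
      case (elim \<omega>)
      then have "(\<lambda>z. V z \<omega>) = (\<lambda>z. ennreal \<bar>W \<omega> z\<bar>)" by auto
      then show ?case by (simp add: env.min_abs_eq_min_neighbour)
    qed
  qed
  also have "\<dots> = (\<integral>\<^sup>+w. ennreal (env.min_abs w 0) \<partial>env)" by (rule nn_integral_env) measurable
  finally show ?thesis .
qed

lemma V_integral: "(\<integral>\<^sup>+\<omega>. V 0 \<omega> \<partial>M) = (\<integral>\<^sup>+w. ennreal \<bar>w 0\<bar> \<partial>env)"
proof -
  have "(\<integral>\<^sup>+\<omega>. V 0 \<omega> \<partial>M) = (\<integral>\<^sup>+\<omega>. ennreal \<bar>W \<omega> 0\<bar> \<partial>M)"
    using AE_V_eq by (intro nn_integral_cong_AE) (auto elim: eventually_mono)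
  also have "\<dots> = (\<integral>\<^sup>+w. ennreal \<bar>w 0\<bar> \<partial>env)" by (rule nn_integral_env) measurable
  finally show ?thesis .
qed

lemma tendsto_AE_min_neighbour:
  assumes x: "x \<noteq> 0" and ae: "tendsto_AE M (scaled_cost V x) L"
  shows "(\<integral>\<^sup>+\<omega>. min_neighbour (\<lambda>z. V z \<omega>) 0 \<partial>M) < \<infinity>"
  unfolding min_neighbour_integral
proof (rule env.min_abs_integrable[OF x])
  \<comment> \<open>Natural constants make the event measurable, which is needed to carry an almost
    sure statement from M back to the law of the environment.\<close>
  define Q where "Q w \<longleftrightarrow> (\<exists>C::nat. \<forall>\<^sub>F n in sequentially. env.min_abs w (int n *s x) \<le> real C * real n)" for w
  have Q_meas: "Measurable.pred env Q" unfolding Q_def eventually_sequentially by measurable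
  have "AE \<omega> in M. (\<lambda>n. X x n \<omega>) \<longlonglongrightarrow> L \<omega>" using ae unfolding tendsto_AE_iff_X by simp
  then have "AE \<omega> in M. Q (W \<omega>)"
  proof eventually_elim
    case (elim \<omega>)
    obtain C :: nat where C: "L \<omega> < C" using reals_Archimedean2 by blast
    from order_tendstoD(2)[OF elim C] eventually_gt_at_top[of 0]
    have "\<forall>\<^sub>F n in sequentially. env.min_abs (W \<omega>) (int n *s x) \<le> real C * real n"
    proof eventually_elim
      case (elim n)
      then have "cost (W \<omega>) 0 (int n *s x) \<le> C * n" by (simp add: X_def field_simps)
      then show ?case using env.cost_ge_min_abs[of 0 "int n *s x" "W \<omega>"] scaled_ne_0[of n x] x elim by simp
    qed
    then show ?case unfolding Q_def by blast
  qed
  then have "AE w in distr M env W. Q w"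
    using Q_meas by (subst AE_distr_iff) (auto simp: pred_def)
  then have "AE w in env. Q w" unfolding distr_W .
  then show "AE w in env. \<exists>C. \<forall>\<^sub>F n in sequentially. env.min_abs w (int n *s x) \<le> C * real n"
    by eventually_elim (auto simp: Q_def)
qed

text \<open>A finite random variable has vanishing tails, stated here as convergence of
  \<open>w 0 / n\<close> to 0 in probability.\<close>

lemma exists_sparse_level: "\<exists>K\<ge>0. (31 * 16) ^ (2 * CARD('d)) * env.prob {w. K < \<bar>w 0\<bar>} \<le> 1 / 2"
proof -
  define c :: real where "c = (31 * 16) ^ (2 * CARD('d))"
  have c: "0 < c" by (simp add: c_def)
  have "env.conv_prob (\<lambda>n w. w 0 / real n) 0"
  proof (rule env.conv_prob_AE)
    show "AE w in env. (\<lambda>n. w 0 / real n) \<longlonglongrightarrow> 0" by (intro AE_I2 lim_const_over_n)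
  qed measurable
  then have "(\<lambda>n. env.prob {w \<in> space env. 1 < \<bar>w 0 / real n - 0\<bar>}) \<longlonglongrightarrow> 0"
    by (rule env.conv_probD) simp
  then have "eventually (\<lambda>n. env.prob {w \<in> space env. 1 < \<bar>w 0 / real n - 0\<bar>} < 1 / (2 * c) \<and> 0 < n) sequentially"
    using c order_tendstoD(2)[of "\<lambda>n. env.prob {w \<in> space env. 1 < \<bar>w 0 / real n - 0\<bar>}" 0 sequentially "1 / (2 * c)"]
      eventually_gt_at_top[of 0] by (auto intro: eventually_conj)
  then obtain n where n: "env.prob {w \<in> space env. 1 < \<bar>w 0 / real n - 0\<bar>} < 1 / (2 * c)" "0 < n"
    by (auto simp: eventually_sequentially)
  have "{w \<in> space env. 1 < \<bar>w 0 / real n - 0\<bar>} = {w. real n < \<bar>w 0\<bar>}"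
    using n(2) by (auto simp: field_simps)
  then have "c * env.prob {w. real n < \<bar>w 0\<bar>} \<le> c * (1 / (2 * c))" using n c by (intro mult_left_mono) auto
  then show ?thesis using c by (intro exI[of _ "real n"]) (simp add: c_def)
qed

text \<open>The level K, and with it the anchors, is chosen inside the proof; the exported facts
  speak only of costs between sites.\<close>

theorem shape_norm:
  assumes dim: "2 \<le> CARD('d)" and nonzero: "\<not> (AE \<omega> in M. V 0 \<omega> = 0)"
  obtains \<alpha> where "is_norm \<alpha>"
    and "\<And>x. x \<noteq> 0 \<Longrightarrow> conv_prob (X x) (\<alpha> (to_real_vec x))"
    and "\<And>x. x \<noteq> 0 \<Longrightarrow> AE \<omega> in M. \<forall>c<\<alpha> (to_real_vec x). \<forall>\<^sub>F n in sequentially. c < X x n \<omega>"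
    and "\<And>x. x \<noteq> 0 \<Longrightarrow> (\<integral>\<^sup>+\<omega>. min_neighbour (\<lambda>z. V z \<omega>) 0 \<partial>M) < \<infinity> \<Longrightarrow>
      AE \<omega> in M. (\<lambda>n. X x n \<omega>) \<longlonglongrightarrow> \<alpha> (to_real_vec x)"
    and "\<And>x. x \<noteq> 0 \<Longrightarrow> (\<integral>\<^sup>+\<omega>. V 0 \<omega> \<partial>M) < \<infinity> \<Longrightarrow>
      (\<lambda>n. \<integral>\<^sup>+\<omega>. ennreal \<bar>X x n \<omega> - \<alpha> (to_real_vec x)\<bar> \<partial>M) \<longlonglongrightarrow> 0"
proof -
  obtain K where K: "0 \<le> K" "(31 * 16) ^ (2 * CARD('d)) * env.prob {w. K < \<bar>w 0\<bar>} \<le> 1 / 2"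
    using exists_sparse_level by blast
  interpret S: sparse_env \<nu> env K
    by unfold_locales (use K dim in auto)
  have "\<not> (AE w in env. w 0 = 0)"
  proof
    assume "AE w in env. w 0 = 0"
    from AE_env[OF this] AE_V_eq have "AE \<omega> in M. V 0 \<omega> = 0" by eventually_elim simp
    with nonzero show False by simp
  qed
  then have \<phi>: "0 < - ln env.\<phi>" using env.\<phi>_less_1 env.\<phi>_pos by simp
  have "\<exists>N. is_norm N \<and> (\<forall>x. N (to_real_vec x) = S.time_constant x)"
  proof (rule lattice_norm_extension[OF _ _ _ _ \<phi>])
    show "- ln env.\<phi> * real_of_int \<bar>x $ i\<bar> \<le> S.time_constant x" for x i
      using S.time_constant_lower[of x i] by (simp add: mult.commute)
  qed (rule S.time_constant_triangle S.time_constant_nonneg S.time_constant_scale S.time_constant_uminus)+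
  then obtain \<alpha> where \<alpha>: "is_norm \<alpha>" "\<And>x. \<alpha> (to_real_vec x) = S.time_constant x" by blast
  show ?thesis
  proof (rule that[OF \<alpha>(1)])
    fix x :: "int ^ 'd" assume x: "x \<noteq> 0"
    show "conv_prob (X x) (\<alpha> (to_real_vec x))"
      using conv_prob_env[OF S.cost_conv_prob[OF x]] by (simp add: \<alpha> X_def[abs_def])
    show "AE \<omega> in M. \<forall>c<\<alpha> (to_real_vec x). \<forall>\<^sub>F n in sequentially. c < X x n \<omega>"
      using AE_env[OF S.cost_eventually_ge[OF x]] by (simp add: \<alpha> X_def)
    show "AE \<omega> in M. (\<lambda>n. X x n \<omega>) \<longlonglongrightarrow> \<alpha> (to_real_vec x)"
      if Z: "(\<integral>\<^sup>+\<omega>. min_neighbour (\<lambda>z. V z \<omega>) 0 \<partial>M) < \<infinity>"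
    proof -
      have "integrable env S.from_anchor"
        using Z unfolding min_neighbour_integral env.ennreal_min_abs by (rule S.integrable_from_anchor)
      from AE_env[OF S.cost_tendsto_AE[OF x this]] show ?thesis by (simp add: \<alpha> X_def)
    qed
    show "(\<lambda>n. \<integral>\<^sup>+\<omega>. ennreal \<bar>X x n \<omega> - \<alpha> (to_real_vec x)\<bar> \<partial>M) \<longlonglongrightarrow> 0"
      if V: "(\<integral>\<^sup>+\<omega>. V 0 \<omega> \<partial>M) < \<infinity>"
    proof -
      have int: "integrable env (\<lambda>w. \<bar>w 0\<bar>)"
        using V unfolding V_integral by (intro integrableI_nonneg) auto
      have eq: "(\<integral>\<^sup>+\<omega>. ennreal \<bar>X x n \<omega> - \<alpha> (to_real_vec x)\<bar> \<partial>M) =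
        ennreal (\<integral>w. \<bar>cost w 0 (int n *s x) / real n - S.time_constant x\<bar> \<partial>env)" for n
      proof -
        have "(\<integral>\<^sup>+\<omega>. ennreal \<bar>X x n \<omega> - \<alpha> (to_real_vec x)\<bar> \<partial>M) =
          (\<integral>\<^sup>+w. ennreal \<bar>cost w 0 (int n *s x) / real n - S.time_constant x\<bar> \<partial>env)"
          unfolding X_def \<alpha> by (rule nn_integral_env) measurable
        also have "\<dots> = ennreal (\<integral>w. \<bar>cost w 0 (int n *s x) / real n - S.time_constant x\<bar> \<partial>env)"
          using S.integrable_cost[OF int] by (intro nn_integral_eq_integral) auto
        finally show ?thesis .
      qed
      show ?thesis unfolding eq
        using tendsto_ennrealI[OF S.cost_tendsto_L1[OF x int]] by simp
    qed
  qed
qed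

end

lemma is_norm_norm: "is_norm (norm :: real ^ 'd::finite \<Rightarrow> real)"
  by (simp add: is_norm_def norm_triangle_ineq)

lemma liminf_ereal_eqI:
  fixes f :: "nat \<Rightarrow> ereal" and g :: "nat \<Rightarrow> real"
  assumes eq: "\<forall>n>0. f n = ereal (g n)"
    and ge: "\<forall>c<a. \<forall>\<^sub>F n in sequentially. c < g n" and le: "\<forall>c>a. \<exists>\<^sub>F n in sequentially. g n < c"
  shows "liminf f = ereal a"
proof (rule antisym)
  have ev: "\<forall>\<^sub>F n in sequentially. f n = ereal (g n)"
    using eq by (intro eventually_sequentiallyI[of 1]) auto
  show "ereal a \<le> liminf f"
    unfolding le_Liminf_iff
  proof (intro allI impI)
    fix y assume "y < ereal a"
    then obtain c where c: "y < ereal c" "c < a" using ereal_dense2 by force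
    from ge c(2) have "\<forall>\<^sub>F n in sequentially. c < g n" by blast
    with ev show "\<forall>\<^sub>F n in sequentially. y < f n"
      by eventually_elim (use c(1) in \<open>auto intro: less_trans\<close>)
  qed
  show "liminf f \<le> ereal a"
  proof (rule ccontr)
    assume "\<not> liminf f \<le> ereal a"
    then obtain c where c: "a < c" "ereal c < liminf f" using ereal_dense2[of "ereal a" "liminf f"] by force
    from less_LiminfD[OF c(2)] ev have "\<forall>\<^sub>F n in sequentially. \<not> g n < c"
      by eventually_elim auto
    moreover have "\<exists>\<^sub>F n in sequentially. g n < c" using le c(1) by blast
    ultimately show False by (simp add: frequently_def)
  qed
qed

theorem theorem1p1:
  fixes M :: "'w measure"
    and V :: "int ^ 'd::finite \<Rightarrow> 'w \<Rightarrow> ennreal"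
  assumes "CARD('d) \<ge> 2"
    and "prob_space M"
    and "iid_field M V"
    and "\<not> (AE \<omega> in M. V 0 \<omega> = 0)"
    and "measure M {\<omega> \<in> space M. V 0 \<omega> < \<infinity>} > site_pc TYPE('d)"
  shows
    "(\<forall>x. x \<noteq> 0 \<longrightarrow>
        ((\<exists>L. tendsto_L1 M (scaled_cost V x) L) \<longleftrightarrow> (\<integral>\<^sup>+\<omega>. V 0 \<omega> \<partial>M) < \<infinity>) \<and>
        ((\<exists>L. tendsto_AE M (scaled_cost V x) L) \<longleftrightarrow>
           (\<integral>\<^sup>+\<omega>. min_neighbour (\<lambda>z. V z \<omega>) 0 \<partial>M) < \<infinity>) \<and>
        ((\<exists>L. tendsto_prob M (scaled_cost V x) L) \<longleftrightarrow> (AE \<omega> in M. V 0 \<omega> < \<infinity>)))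
     \<and> (\<exists>\<alpha>. is_norm \<alpha> \<and>
        (\<forall>x. x \<noteq> 0 \<longrightarrow>
           (\<forall>L. tendsto_L1 M (scaled_cost V x) L \<or> tendsto_AE M (scaled_cost V x) L \<or>
                tendsto_prob M (scaled_cost V x) L \<longrightarrow>
              (AE \<omega> in M. L \<omega> = \<alpha> (to_real_vec x))) \<and>
           ((AE \<omega> in M. V 0 \<omega> < \<infinity>) \<longrightarrow>
              (AE \<omega> in M. liminf (\<lambda>n. scaled_cost V x n \<omega>) = ereal (\<alpha> (to_real_vec x))))))"
proof -
  interpret I: iid_potential M V
    using assms(2,3) by (simp add: iid_potential_def iid_potential_axioms_def)
  show ?thesis
  proof (cases "AE \<omega> in M. V 0 \<omega> < \<infinity>")
    case False
    have "\<not> (\<integral>\<^sup>+\<omega>. V 0 \<omega> \<partial>M) < \<infinity>" "\<not> (\<integral>\<^sup>+\<omega>. min_neighbour (\<lambda>z. V z \<omega>) 0 \<partial>M) < \<infinity>"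
      using False I.integral_finite I.min_neighbour_finite by blast+
    moreover have "\<not> tendsto_L1 M (scaled_cost V x) L" "\<not> tendsto_AE M (scaled_cost V x) L"
      "\<not> tendsto_prob M (scaled_cost V x) L" if "x \<noteq> 0" for x L
      using False I.tendsto_L1_finite[OF that] I.integral_finite I.tendsto_AE_finite[OF that]
        I.tendsto_prob_finite[OF that] by blast+
    \<comment> \<open>No convergence takes place, so every clause about \<alpha> is vacuous and any
      norm serves.\<close>
    ultimately show ?thesis using False is_norm_norm by blast
  next
    case True
    interpret F: finite_potential M V
      by unfold_locales (rule True)
    obtain \<alpha> where norm: "is_norm \<alpha>"
      and prob: "\<And>x. x \<noteq> 0 \<Longrightarrow> I.conv_prob (F.X x) (\<alpha> (to_real_vec x))"
      and below: "\<And>x. x \<noteq> 0 \<Longrightarrow> AE \<omega> in M. \<forall>c<\<alpha> (to_real_vec x). \<forall>\<^sub>F n in sequentially. c < F.X x n \<omega>"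
      and ae: "\<And>x. x \<noteq> 0 \<Longrightarrow> (\<integral>\<^sup>+\<omega>. min_neighbour (\<lambda>z. V z \<omega>) 0 \<partial>M) < \<infinity> \<Longrightarrow>
        AE \<omega> in M. (\<lambda>n. F.X x n \<omega>) \<longlonglongrightarrow> \<alpha> (to_real_vec x)"
      and L1: "\<And>x. x \<noteq> 0 \<Longrightarrow> (\<integral>\<^sup>+\<omega>. V 0 \<omega> \<partial>M) < \<infinity> \<Longrightarrow>
        (\<lambda>n. \<integral>\<^sup>+\<omega>. ennreal \<bar>F.X x n \<omega> - \<alpha> (to_real_vec x)\<bar> \<partial>M) \<longlonglongrightarrow> 0"
      using F.shape_norm[OF assms(1,4)] by blast
    have iff_L1: "(\<exists>L. tendsto_L1 M (scaled_cost V x) L) \<longleftrightarrow> (\<integral>\<^sup>+\<omega>. V 0 \<omega> \<partial>M) < \<infinity>" if x: "x \<noteq> 0" for x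
    proof
      assume "(\<integral>\<^sup>+\<omega>. V 0 \<omega> \<partial>M) < \<infinity>"
      from L1[OF x this] have "tendsto_L1 M (scaled_cost V x) (\<lambda>_. \<alpha> (to_real_vec x))"
        unfolding F.tendsto_L1_iff_X by simp
      then show "\<exists>L. tendsto_L1 M (scaled_cost V x) L" by blast
    qed (use I.tendsto_L1_finite[OF x] in blast)
    have iff_AE: "(\<exists>L. tendsto_AE M (scaled_cost V x) L) \<longleftrightarrow>
      (\<integral>\<^sup>+\<omega>. min_neighbour (\<lambda>z. V z \<omega>) 0 \<partial>M) < \<infinity>" if x: "x \<noteq> 0" for x
    proof
      assume "(\<integral>\<^sup>+\<omega>. min_neighbour (\<lambda>z. V z \<omega>) 0 \<partial>M) < \<infinity>"
      from ae[OF x this] have "tendsto_AE M (scaled_cost V x) (\<lambda>_. \<alpha> (to_real_vec x))"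
        unfolding F.tendsto_AE_iff_X by simp
      then show "\<exists>L. tendsto_AE M (scaled_cost V x) L" by blast
    qed (use F.tendsto_AE_min_neighbour[OF x] in blast)
    have conv: "tendsto_prob M (scaled_cost V x) (\<lambda>_. \<alpha> (to_real_vec x))" if x: "x \<noteq> 0" for x
    proof -
      have "I.conv_prob (\<lambda>n \<omega>. F.X x n \<omega> - \<alpha> (to_real_vec x)) 0"
        using prob[OF x] by (simp add: I.conv_prob_def)
      then show ?thesis by (subst F.tendsto_prob_iff_conv) auto
    qed
    have unique: "AE \<omega> in M. L \<omega> = \<alpha> (to_real_vec x)"
      if x: "x \<noteq> 0" and L: "tendsto_L1 M (scaled_cost V x) L \<or> tendsto_AE M (scaled_cost V x) L \<or>
        tendsto_prob M (scaled_cost V x) L" for x L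
    proof -
      have meas: "L \<in> borel_measurable M"
        using L by (auto simp: tendsto_L1_def tendsto_AE_def tendsto_prob_def)
      have "I.conv_prob (\<lambda>n \<omega>. F.X x n \<omega> - L \<omega>) 0"
        using L F.tendsto_L1_conv F.tendsto_AE_conv F.tendsto_prob_iff_conv[OF meas] by blast
      then show ?thesis by (rule I.conv_prob_limit_unique[OF prob[OF x] meas])
    qed
    \<comment> \<open>The lower bound is almost sure; the upper bound holds because convergence in
      probability brings the costs close to the limit infinitely often.\<close>
    have lim_inf: "AE \<omega> in M. liminf (\<lambda>n. scaled_cost V x n \<omega>) = ereal (\<alpha> (to_real_vec x))" if x: "x \<noteq> 0" for x
      using F.scaled_cost_eq[of x] below[OF x] I.conv_prob_frequently[OF prob[OF x]]
      by eventually_elim (rule liminf_ereal_eqI)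
    show ?thesis
      using iff_L1 iff_AE conv True norm unique lim_inf by blast
  qed
qed

end
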